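(* Let $K$ be a knot with crossing number $c(K)$. Then $\operatorname{MRI}(K)\leq 2c(K)$.
   Context: For a knot diagram $D$, let $|D|$ be the $4$-regular planar graph obtained by forgetting crossing information. A region of $D$ is a connected component of $S^2-|D|$. A region crossing change at a region $R$ changes every crossing in the boundary of $R$. For a region $R$, let $c(R)$ denote the number of crossings in the boundary of $R$. A set of unknotting regions of $D$ is a set of regions of $D$ such that performing region crossing changes at all regions of the set yields a diagram of the unknot. The multi-region index of $D$ is $\operatorname{MRI}(D)=\min\{\sum_{j=1}^k c(R_{i_j}) : \{R_{i_1},\dots,R_{i_k}\}$ is a set of unknotting regions of $D\}$ (a crossing is counted once for each region of the set whose boundary contains it), and the multi-region index $\operatorname{MRI}(K)$ of a knot $K$ is the minimum of $\operatorname{MRI}(D)$ over all diagrams $D$ of $K$. The crossing number $c(K)$ is the minimum number of crossings over all diagrams of $K$. *)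

theory Defs
  imports "HOL-Analysis.Analysis"
begin

text \<open>
  Combinatorial-geometric model of knot diagrams.
  The plane is real \<times> real, space is (real \<times> real) \<times> real, and the
  projection of a diagram is the map fst (forget the height).
  A diagram is a pair (P, O): P is the cyclic vertex list of a closed polygonal
  plane curve, parametrised by t in [0, length P]; O assigns to each crossing
  the parameter value of the over-strand.
\<close>

type_synonym point2 = "real \<times> real"
type_synonym point3 = "(real \<times> real) \<times> real"
type_synonym diagram = "point2 list \<times> (point2 \<Rightarrow> real)"

definition seg_idx :: "nat \<Rightarrow> real \<Rightarrow> nat" where
  "seg_idx n t = nat \<lfloor>t\<rfloor> mod n"

definition pos :: "point2 list \<Rightarrow> real \<Rightarrow> point2" where
  "pos P t = (let n = length P; i = seg_idx n t; s = t - of_int \<lfloor>t\<rfloor>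
              in (1 - s) *\<^sub>R (P ! i) + s *\<^sub>R (P ! ((i + 1) mod n)))"

definition seg_dir :: "point2 list \<Rightarrow> real \<Rightarrow> point2" where
  "seg_dir P t = (let n = length P; i = seg_idx n t in P ! ((i + 1) mod n) - P ! i)"

definition preimages :: "point2 list \<Rightarrow> point2 \<Rightarrow> real set" where
  "preimages P x = {t. 0 \<le> t \<and> t < real (length P) \<and> pos P t = x}"

definition curve_image :: "point2 list \<Rightarrow> point2 set" where
  "curve_image P = pos P ` {0 .. real (length P)}"

definition generic_curve :: "point2 list \<Rightarrow> bool" where
  "generic_curve P \<longleftrightarrow> length P \<ge> 3 \<and>
     (\<forall>x. finite (preimages P x) \<and> card (preimages P x) \<le> 2) \<and>
     (\<forall>x. card (preimages P x) = 2 \<longrightarrow>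
        (\<forall>t \<in> preimages P x. t \<noteq> of_int \<lfloor>t\<rfloor>) \<and>
        (\<forall>t \<in> preimages P x. \<forall>u \<in> preimages P x. t \<noteq> u \<longrightarrow>
            fst (seg_dir P t) * snd (seg_dir P u) - snd (seg_dir P t) * fst (seg_dir P u) \<noteq> 0))"

definition crossings :: "point2 list \<Rightarrow> point2 set" where
  "crossings P = {x. card (preimages P x) = 2}"

definition knot_diagram :: "diagram \<Rightarrow> bool" where
  "knot_diagram D \<longleftrightarrow> generic_curve (fst D) \<and>
     (\<forall>x \<in> crossings (fst D). snd D x \<in> preimages (fst D) x)"

definition other_strand :: "point2 list \<Rightarrow> point2 \<Rightarrow> real \<Rightarrow> real" where
  "other_strand P x t = (THE u. u \<in> preimages P x \<and> u \<noteq> t)"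

definition valid_lift :: "diagram \<Rightarrow> (real \<Rightarrow> real) \<Rightarrow> bool" where
  "valid_lift D h \<longleftrightarrow> continuous_on {0 .. real (length (fst D))} h \<and>
     h 0 = h (real (length (fst D))) \<and>
     (\<forall>x \<in> crossings (fst D). h (snd D x) > h (other_strand (fst D) x (snd D x)))"

definition lift_image :: "diagram \<Rightarrow> (real \<Rightarrow> real) \<Rightarrow> point3 set" where
  "lift_image D h = (\<lambda>t. (pos (fst D) t, h t)) ` {0 .. real (length (fst D))}"

definition ambient_isotopic :: "point3 set \<Rightarrow> point3 set \<Rightarrow> bool" where
  "ambient_isotopic K K' \<longleftrightarrow> (\<exists>H :: real \<Rightarrow> point3 \<Rightarrow> point3.
      continuous_on ({0..1} \<times> UNIV) (\<lambda>(t, x). H t x) \<and>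
      (\<forall>t \<in> {0..1}. \<exists>g. homeomorphism UNIV UNIV (H t) g) \<and>
      H 0 = id \<and> H 1 ` K = K')"

definition diagram_of :: "diagram \<Rightarrow> point3 set \<Rightarrow> bool" where
  "diagram_of D K \<longleftrightarrow> knot_diagram D \<and>
     (\<exists>h. valid_lift D h \<and> ambient_isotopic (lift_image D h) K)"

definition standard_unknot :: "point3 set" where
  "standard_unknot = (\<lambda>p. (p, 0)) ` sphere (0 :: point2) 1"

definition is_unknot_diagram :: "diagram \<Rightarrow> bool" where
  "is_unknot_diagram D \<longleftrightarrow> diagram_of D standard_unknot"

text \<open>Regions: connected components of the complement of the curve
  (components of the plane complement correspond bijectively to those of the
  sphere complement).\<close>
definition regions :: "diagram \<Rightarrow> point2 set set" where
  "regions D = components (- curve_image (fst D))"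

definition region_crossings :: "diagram \<Rightarrow> point2 set \<Rightarrow> point2 set" where
  "region_crossings D R = {x \<in> crossings (fst D). x \<in> frontier R}"

definition c_region :: "diagram \<Rightarrow> point2 set \<Rightarrow> nat" where
  "c_region D R = card (region_crossings D R)"

text \<open>Performing region crossing changes at all regions of S: a crossing is
  changed once for each region of S whose boundary contains it.\<close>
definition rcc :: "diagram \<Rightarrow> point2 set set \<Rightarrow> diagram" where
  "rcc D S = (fst D, \<lambda>x. if x \<in> crossings (fst D) \<and> odd (card {R \<in> S. x \<in> region_crossings D R})
                         then other_strand (fst D) x (snd D x) else snd D x)"

definition unknotting_regions :: "diagram \<Rightarrow> point2 set set \<Rightarrow> bool" where
  "unknotting_regions D S \<longleftrightarrow> S \<subseteq> regions D \<and> finite S \<and> is_unknot_diagram (rcc D S)"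

definition MRI_diagram :: "diagram \<Rightarrow> nat" where
  "MRI_diagram D = (LEAST n. \<exists>S. unknotting_regions D S \<and> n = (\<Sum>R\<in>S. c_region D R))"

definition MRI :: "point3 set \<Rightarrow> nat" where
  "MRI K = (LEAST n. \<exists>D. diagram_of D K \<and> n = MRI_diagram D)"

definition crossing_number :: "point3 set \<Rightarrow> nat" where
  "crossing_number K = (LEAST n. \<exists>D. diagram_of D K \<and> n = card (crossings (fst D)))"

end

theory Submission
  imports Defs
begin

text \<open>
  On a diagram with the minimal number of crossings, change crossings so that every over-strand is the
  first passage from a fixed base point. The resulting descending knot lifts to a curve meeting every
  level in two points, one of them on a short crossing-free segment; translating, rotating and
  scaling each level turns it into a round circle.

  For the regions, work over the field with two elements. Splitting the curve at a crossing x gives a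
  loop avoiding the base point, and the regions with odd winding number about it (relative to
  the base point) flip x. They may flip other crossings only where two opposite corners lie in the
  same region, and for such nugatory x only crossings inside the loop, so the system is
  triangular and every set of crossings can be realised by regions different from any prescribed
  one (put the base point on its boundary). Hence every region at a crossing lies in some
  element of the kernel, so it belongs to exactly half of the solutions. As each crossing has at most four
  adjacent regions, the average cost of a solution is at most 2c.
\<close>

section \<open>The closed polygonal curve\<close>

text \<open>A region crossing change acts once on a crossing even if the region touches it at two
  opposite corners. Modulo two such a double contact counts as 1 instead of 1 + 1 = 0, so there the
  number of selected corners no longer determines the number of selected regions; this is the
  obstacle behind nugatory crossings. All separation facts come from winding numbers: they are
  constant on connected sets off a cycle and change by one across a strand traversed once. Writing
  them as sums of principal angles makes this jump an explicit sign change of a logarithm. On the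
  geometric side a lift may carry any continuous height function respecting the crossings. The
  heights can thus be those of the target circle from the start, and up to a tilt the isotopy only
  moves points within their levels.\<close>

definition cross2 :: "point2 \<Rightarrow> point2 \<Rightarrow> real" where
  "cross2 v w = fst v * snd w - snd v * fst w"

locale plane_curve =
  fixes P :: "point2 list"
  assumes generic: "generic_curve P"
begin

abbreviation n :: nat where "n \<equiv> length P"

abbreviation p :: "real \<Rightarrow> point2" where "p \<equiv> pos P"

definition edge :: "nat \<Rightarrow> point2" where
  "edge k = P ! (Suc k mod n) - P ! (k mod n)"

text \<open>Parameters live on the nonnegative half-line instead of a circle, so that an arc through
  the starting vertex is still an interval. \<open>pos\<close> is periodic only there:
  \<open>nat\<close> sends every negative floor to 0.\<close>

definition same :: "real \<Rightarrow> real \<Rightarrow> bool" where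
  "same w w' \<longleftrightarrow> (\<exists>k::int. w' = w + of_int k * real n)"

lemma n_ge: "n \<ge> 3"
  using generic by (simp add: generic_curve_def)

lemma n_pos: "0 < real n"
  using n_ge by linarith

text \<open>The right end is included although \<open>pos\<close> has already switched to the next
  edge: both formulas give the shared vertex. This allows gluing along closed intervals.\<close>

lemma p_affine:
  assumes "real k \<le> x" "x \<le> real k + 1"
  shows "p x = P ! (k mod n) + (x - real k) *\<^sub>R edge k"
proof (cases "x = real k + 1")
  case True
  then have "\<lfloor>x\<rfloor> = int (Suc k)" by (simp add: floor_eq_iff)
  then have "p x = P ! (Suc k mod n)"
    by (simp add: pos_def seg_idx_def Let_def True del: of_nat_Suc) (simp add: nat_add_distrib)
  then show ?thesis by (simp add: True edge_def)
next
  case False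
  then have fl: "\<lfloor>x\<rfloor> = int k" using assms by (simp add: floor_eq_iff)
  show ?thesis
    by (simp add: pos_def seg_idx_def Let_def fl edge_def mod_Suc_eq algebra_simps)
qed

lemma seg_dir_edge:
  assumes "real k \<le> x" "x < real k + 1"
  shows "seg_dir P x = edge k"
proof -
  have fl: "\<lfloor>x\<rfloor> = int k" using assms by (simp add: floor_eq_iff)
  show ?thesis by (simp add: seg_dir_def seg_idx_def Let_def fl edge_def mod_Suc_eq)
qed

lemma p_within_edge:
  assumes "real k \<le> x" "x < real k + 1" "real k \<le> y" "y \<le> real k + 1"
  shows "p y = p x + (y - x) *\<^sub>R seg_dir P x"
  using assms by (simp add: p_affine[of k] seg_dir_edge[of k] algebra_simps)

lemma p_shift_nat:
  assumes "x \<ge> 0"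
  shows "p (x + real j * real n) = p x"
proof -
  define k where "k = nat \<lfloor>x\<rfloor>"
  have k: "real k \<le> x" "x \<le> real k + 1" using assms unfolding k_def by linarith+
  have "p (x + real j * real n) = P ! ((k + j * n) mod n) + (x - real k) *\<^sub>R edge (k + j * n)"
    using p_affine[of "k + j * n" "x + real j * real n"] k by simp
  also have "edge (k + j * n) = edge k"
    unfolding edge_def by (metis add_Suc mod_mult_self1)
  finally show ?thesis using p_affine[OF k] by simp
qed

lemma p_same:
  assumes "same x y" "x \<ge> 0" "y \<ge> 0"
  shows "p x = p y"
proof -
  obtain k :: int where k: "y = x + of_int k * real n" using assms(1) by (auto simp: same_def)
  show ?thesis
  proof (cases "k \<ge> 0")
    case True
    then show ?thesis using p_shift_nat[of x "nat k"] assms k by simp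
  next
    case False
    then have "x = y + real (nat (-k)) * real n" using k by simp
    then show ?thesis using p_shift_nat[of y "nat (-k)"] assms by simp
  qed
qed

lemma same_sym: "same x y \<Longrightarrow> same y x"
  unfolding same_def
  by (metis add.commute add_minus_cancel minus_mult_left mult_minus_left of_int_minus)

lemma same_trans: "same x y \<Longrightarrow> same y z \<Longrightarrow> same x z"
  unfolding same_def by (metis add.assoc distrib_right of_int_add)

lemma same_add_n: "same x (x + real n)"
  unfolding same_def by (rule exI[of _ 1]) simp

lemma same_close:
  assumes "same x y" "\<bar>x - y\<bar> < real n"
  shows "x = y"
proof -
  obtain k :: int where k: "y = x + of_int k * real n" using assms(1) by (auto simp: same_def)
  have "\<bar>of_int k\<bar> * real n < 1 * real n" using assms(2) k by (simp add: abs_mult)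
  then have "\<bar>real_of_int k\<bar> < 1" using n_pos mult_less_cancel_right_pos by blast
  then have "k = 0" by linarith
  then show ?thesis using k by simp
qed

lemma same_in_window:
  obtains y where "same x y" "a \<le> y" "y < a + real n"
proof -
  define k where "k = \<lfloor>(x - a) / real n\<rfloor>"
  have 1: "of_int k * real n \<le> x - a"
    unfolding k_def by (metis floor_divide_lower n_pos)
  have 2: "x - a < (of_int k + 1) * real n"
    unfolding k_def by (metis floor_divide_upper n_pos)
  have "same x (x - of_int k * real n)"
    unfolding same_def by (rule exI[of _ "-k"]) simp
  then show ?thesis using that 1 2 by (simp add: algebra_simps)
qed

lemma continuous_on_p_upto: "continuous_on {0..real N} p"
proof (induction N)
  case 0
  then show ?case by simp
next
  case (Suc N)
  have "continuous_on {real N..real N + 1} (\<lambda>x. P ! (N mod n) + (x - real N) *\<^sub>R edge N)"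
    by (intro continuous_intros)
  then have "continuous_on {real N..real N + 1} p"
    by (rule continuous_on_eq) (auto simp: p_affine[of N])
  then have "continuous_on ({0..real N} \<union> {real N..real N + 1}) p"
    using Suc by (intro continuous_on_closed_Un) auto
  moreover have "{0..real N} \<union> {real N..real N + 1} = {0..real (Suc N)}" by auto
  ultimately show ?case by simp
qed

lemma continuous_on_p: "S \<subseteq> {0..} \<Longrightarrow> continuous_on S p"
proof -
  have "continuous_on {0..} p"
    unfolding continuous_on_eq_continuous_within
  proof
    fix x :: real assume x: "x \<in> {0..}"
    obtain N :: nat where N: "x < real N" using reals_Archimedean2 by blast
    have "at x within {0..} = at x within {0..real N}"
      by (rule at_within_nhd[of _ "{..<real N}"]) (use N in auto)
    moreover have "continuous (at x within {0..real N}) p"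
      using continuous_on_p_upto x N by (auto simp: continuous_on_eq_continuous_within)
    ultimately show "continuous (at x within {0..}) p"
      by (simp add: continuous_within)
  qed
  then show "S \<subseteq> {0..} \<Longrightarrow> continuous_on S p" by (rule continuous_on_subset)
qed

lemma curve_image_eq: "curve_image P = p ` {0..}"
proof
  show "curve_image P \<subseteq> p ` {0..}" unfolding curve_image_def by auto
  show "p ` {0..} \<subseteq> curve_image P"
  proof
    fix z assume "z \<in> p ` {0..}"
    then obtain w where "0 \<le> w" and z: "z = p w" by auto
    obtain y where y: "same w y" "0 \<le> y" "y < 0 + real n" by (rule same_in_window)
    then have "p w = p y" using p_same \<open>0 \<le> w\<close> by blast
    then show "z \<in> curve_image P" unfolding curve_image_def z using y by auto
  qed
qed

lemma compact_curve_image: "compact (curve_image P)"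
  unfolding curve_image_def by (intro compact_continuous_image continuous_on_p) auto

lemma in_preimages: "x \<in> preimages P y \<longleftrightarrow> 0 \<le> x \<and> x < real n \<and> p x = y"
  by (simp add: preimages_def)

lemma preimages_finite: "finite (preimages P y)" and preimages_card: "card (preimages P y) \<le> 2"
  using generic unfolding generic_curve_def by blast+

text \<open>Incongruent parameters have distinct representatives in the first period, hence give at
  least two preimages; genericity allows no more, so the point would be a crossing.\<close>

lemma same_if_not_crossing:
  assumes "p w = p w'" "w \<ge> 0" "w' \<ge> 0" "p w \<notin> crossings P"
  shows "same w w'"
proof -
  obtain y where y: "same w y" "0 \<le> y" "y < 0 + real n" by (rule same_in_window)
  obtain y' where y': "same w' y'" "0 \<le> y'" "y' < 0 + real n" by (rule same_in_window)
  have "{y, y'} \<subseteq> preimages P (p w)"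
    using y y' p_same[of w y] p_same[of w' y'] assms by (auto simp: in_preimages)
  then have "card {y, y'} \<le> card (preimages P (p w))"
    by (rule card_mono[OF preimages_finite])
  moreover have "card (preimages P (p w)) \<noteq> 2" using assms(4) by (simp add: crossings_def)
  ultimately have "card {y, y'} < 2" using preimages_card[of "p w"] by linarith
  then have "y = y'" by (cases "y = y'") auto
  then show ?thesis using y(1) y'(1) same_sym same_trans by blast
qed

text \<open>Unlike \<open>preimages\<close>, the pair is not tied to the first period. Both passages
  may be shifted by periods, so that a base point can come before both of them and the arc from
  \<open>t\<close> to \<open>u\<close> avoids it.\<close>

definition double_at :: "real \<Rightarrow> real \<Rightarrow> point2 \<Rightarrow> bool" where
  "double_at t u x \<longleftrightarrow> 0 < t \<and> t < u \<and> u < t + real n \<and> p t = x \<and> p u = x \<and>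
     t \<notin> \<int> \<and> u \<notin> \<int> \<and> cross2 (seg_dir P t) (seg_dir P u) \<noteq> 0 \<and>
     (\<forall>w\<ge>0. p w = x \<longrightarrow> same t w \<or> same u w)"

lemma cross2_commute: "cross2 v w = - cross2 w v"
  by (simp add: cross2_def)

lemma nonint_iff: "t \<noteq> of_int \<lfloor>t\<rfloor> \<longleftrightarrow> t \<notin> \<int>"
  by (metis Ints_of_int floor_of_int Ints_cases)

lemma same_Ints: "same t w \<Longrightarrow> w \<in> \<int> \<longleftrightarrow> t \<in> \<int>"
  unfolding same_def
  by (metis Ints_add Ints_diff Ints_mult Ints_of_int Ints_of_nat add_diff_cancel_right')

lemma seg_dir_same:
  assumes "same t w" "t \<ge> 0" "w \<ge> 0"
  shows "seg_dir P t = seg_dir P w"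
proof -
  have shift: "seg_dir P (x + real j * real n) = seg_dir P x" if "x \<ge> 0" for x j
  proof -
    define k where "k = nat \<lfloor>x\<rfloor>"
    have k: "real k \<le> x" "x < real k + 1" using that unfolding k_def by linarith+
    have "seg_dir P (x + real j * real n) = edge (k + j * n)"
      using k by (intro seg_dir_edge) auto
    also have "\<dots> = edge k" unfolding edge_def by (metis add_Suc mod_mult_self1)
    also have "\<dots> = seg_dir P x" using seg_dir_edge[OF k] by simp
    finally show ?thesis .
  qed
  obtain k :: int where k: "w = t + of_int k * real n" using assms(1) by (auto simp: same_def)
  show ?thesis
  proof (cases "k \<ge> 0")
    case True
    then show ?thesis using shift[of t "nat k"] assms k by simp
  next
    case False
    then have "t = w + real (nat (-k)) * real n" using k by simp
    then show ?thesis using shift[of w "nat (-k)"] assms by simp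
  qed
qed

lemma crossing_preimages:
  assumes "x \<in> crossings P"
  obtains t u where "preimages P x = {t, u}" "0 < t" "t < u" "u < real n"
    "t \<notin> \<int>" "u \<notin> \<int>" "cross2 (seg_dir P t) (seg_dir P u) \<noteq> 0"
proof -
  have c2: "card (preimages P x) = 2" using assms by (simp add: crossings_def)
  then obtain a b where ab: "preimages P x = {a, b}" "a \<noteq> b" by (auto simp: card_2_iff)
  have nonint: "\<And>t. t \<in> preimages P x \<Longrightarrow> t \<notin> \<int>"
    using generic c2 nonint_iff unfolding generic_curve_def by blast
  have cr: "cross2 (seg_dir P t) (seg_dir P u) \<noteq> 0"
    if "t \<in> preimages P x" "u \<in> preimages P x" "t \<noteq> u" for t u
    using generic c2 that unfolding generic_curve_def cross2_def by blast
  define t where "t = min a b"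
  define u where "u = max a b"
  have pre: "preimages P x = {t, u}" using ab unfolding t_def u_def by (auto simp: min_def max_def)
  have lt: "t < u" using ab unfolding t_def u_def by auto
  have mem: "t \<in> preimages P x" "u \<in> preimages P x" using pre by auto
  have "t \<noteq> 0" using nonint[OF mem(1)] by auto
  then have "0 < t" "u < real n" using mem by (auto simp: in_preimages)
  then show ?thesis using that[of t u] pre lt nonint mem cr[OF mem] by auto
qed

text \<open>The representatives in the period starting at \<open>\<tau>\<close> cannot fall on
  \<open>\<tau>\<close> itself, because the base point is no crossing. Exchanging the two strands
  only changes the sign of \<open>cross2\<close>.\<close>

lemma crossing_double_at:
  assumes x: "x \<in> crossings P" and \<tau>: "0 \<le> \<tau>" "p \<tau> \<notin> crossings P"
  obtains t u where "double_at t u x" "\<tau> < t" "u < \<tau> + real n"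
proof -
  obtain a b where ab: "preimages P x = {a, b}" "0 < a" "a < b" "b < real n"
    "a \<notin> \<int>" "b \<notin> \<int>" "cross2 (seg_dir P a) (seg_dir P b) \<noteq> 0"
    using crossing_preimages[OF x] .
  have pab: "p a = x" "p b = x" using ab(1) by (auto simp: in_preimages set_eq_iff)
  obtain a' where a': "same a a'" "\<tau> \<le> a'" "a' < \<tau> + real n" by (rule same_in_window)
  obtain b' where b': "same b b'" "\<tau> \<le> b'" "b' < \<tau> + real n" by (rule same_in_window)
  have p': "p a' = x" "p b' = x" using p_same[OF a'(1)] p_same[OF b'(1)] pab a' b' ab \<tau> by auto
  then have "a' \<noteq> \<tau>" "b' \<noteq> \<tau>" using x \<tau> by auto
  then have gt: "\<tau> < a'" "\<tau> < b'" using a' b' by auto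
  have "a' \<noteq> b'"
  proof
    assume "a' = b'"
    then have "same a b" using a' b' same_sym same_trans by blast
    then have "a = b" by (rule same_close) (use ab in auto)
    then show False using ab by simp
  qed
  have nonint: "a' \<notin> \<int>" "b' \<notin> \<int>" using same_Ints[OF a'(1)] same_Ints[OF b'(1)] ab by auto
  have dirs: "seg_dir P a' = seg_dir P a" "seg_dir P b' = seg_dir P b"
    using seg_dir_same[OF a'(1)] seg_dir_same[OF b'(1)] ab gt \<tau> by auto
  have all: "same a' w \<or> same b' w" if "w \<ge> 0" "p w = x" for w
  proof -
    obtain y where y: "same w y" "0 \<le> y" "y < 0 + real n" by (rule same_in_window)
    have "y \<in> preimages P x" using y p_same[OF y(1)] that by (auto simp: in_preimages)
    then have "y = a \<or> y = b" using ab by auto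
    then show ?thesis using y(1) a'(1) b'(1) same_sym same_trans by blast
  qed
  show ?thesis
  proof (cases "a' < b'")
    case True
    then have "double_at a' b' x"
      unfolding double_at_def using gt a' b' p' nonint dirs ab all \<tau> by auto
    then show ?thesis using that gt b' by blast
  next
    case False
    then have "double_at b' a' x"
      unfolding double_at_def
      using gt a' b' p' nonint dirs ab all \<tau> \<open>a' \<noteq> b'\<close> cross2_commute[of "seg_dir P b"] by auto
    then show ?thesis using that gt a' by blast
  qed
qed

text \<open>A crossing is determined by the two edges carrying its strands: two crossings on the
  same pair would differ by a vector along both directions, which are independent.\<close>

lemma finite_crossings: "finite (crossings P)"
proof -
  define e where "e x = (nat \<lfloor>Min (preimages P x)\<rfloor>, nat \<lfloor>Max (preimages P x)\<rfloor>)" for x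
  have "inj_on e (crossings P)"
  proof
    fix x y assume xy: "x \<in> crossings P" "y \<in> crossings P" "e x = e y"
    obtain t u where x: "preimages P x = {t, u}" "0 < t" "t < u" "u < real n"
      "cross2 (seg_dir P t) (seg_dir P u) \<noteq> 0"
      using crossing_preimages[OF xy(1)] .
    obtain s v where y: "preimages P y = {s, v}" "0 < s" "s < v" "v < real n"
      using crossing_preimages[OF xy(2)] .
    have k: "nat \<lfloor>t\<rfloor> = nat \<lfloor>s\<rfloor>" "nat \<lfloor>u\<rfloor> = nat \<lfloor>v\<rfloor>"
      using xy(3) x y by (auto simp: e_def)
    have ps: "p t = x" "p u = x" "p s = y" "p v = y"
      using x(1) y(1) by (auto simp: in_preimages set_eq_iff)
    have ft: "real (nat \<lfloor>t\<rfloor>) \<le> t" "t < real (nat \<lfloor>t\<rfloor>) + 1" using x by linarith+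
    have fs: "real (nat \<lfloor>s\<rfloor>) \<le> s" "s < real (nat \<lfloor>s\<rfloor>) + 1" using y by linarith+
    have fu: "real (nat \<lfloor>u\<rfloor>) \<le> u" "u < real (nat \<lfloor>u\<rfloor>) + 1" using x by linarith+
    have fv: "real (nat \<lfloor>v\<rfloor>) \<le> v" "v < real (nat \<lfloor>v\<rfloor>) + 1" using y by linarith+
    have e1: "y = x + (s - t) *\<^sub>R seg_dir P t"
      using p_within_edge[OF ft, of s] fs k ps by auto
    have e2: "y = x + (v - u) *\<^sub>R seg_dir P u"
      using p_within_edge[OF fu, of v] fv k ps by auto
    have eq: "(s - t) *\<^sub>R seg_dir P t = (v - u) *\<^sub>R seg_dir P u" using e1 e2 by simp
    have "(s - t) * cross2 (seg_dir P t) (seg_dir P u) = cross2 ((s - t) *\<^sub>R seg_dir P t) (seg_dir P u)"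
      by (simp add: cross2_def algebra_simps)
    also have "\<dots> = 0" unfolding eq by (simp add: cross2_def)
    finally have "s = t" using x by simp
    then show "x = y" using ps by simp
  qed
  moreover have "e ` crossings P \<subseteq> {..<n} \<times> {..<n}"
  proof
    fix z assume "z \<in> e ` crossings P"
    then obtain x where xz: "x \<in> crossings P" "z = e x" by blast
    obtain t u where x: "preimages P x = {t, u}" "0 < t" "t < u" "u < real n"
      using crossing_preimages[OF xz(1)] .
    have "nat \<lfloor>t\<rfloor> < n" "nat \<lfloor>u\<rfloor> < n" using x by linarith+
    then show "z \<in> {..<n} \<times> {..<n}" using x xz by (auto simp: e_def)
  qed
  ultimately show ?thesis by (meson finite_SigmaI finite_lessThan finite_subset inj_on_finite)
qed

end

section \<open>Winding numbers of cycles made of arcs\<close>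

definition cx :: "point2 \<Rightarrow> complex" where
  "cx v = Complex (fst v) (snd v)"

lemma cx_simps: "cx (v + w) = cx v + cx w" "cx (v - w) = cx v - cx w" "cx (a *\<^sub>R v) = a *\<^sub>R cx v"
  by (simp_all add: cx_def complex_eq_iff)

lemma cx_eq_iff [simp]: "cx v = cx w \<longleftrightarrow> v = w"
  by (simp add: cx_def prod_eq_iff)

lemma cx_eq_0 [simp]: "cx v = 0 \<longleftrightarrow> v = 0"
  by (simp add: cx_def complex_eq_iff prod_eq_iff)

lemma continuous_on_cx [continuous_intros]: "continuous_on S f \<Longrightarrow> continuous_on S (\<lambda>x. cx (f x))"
  unfolding cx_def Complex_eq by (intro continuous_intros)

lemma isCont_cx [continuous_intros]: "isCont f z \<Longrightarrow> isCont (\<lambda>x. cx (f x)) z"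
  unfolding cx_def Complex_eq by (intro continuous_intros)

section \<open>The angle under which a segment is seen\<close>

definition ang :: "point2 \<Rightarrow> point2 \<Rightarrow> point2 \<Rightarrow> real" where
  "ang q r z = Im (Ln (cx (r - z) / cx (q - z)))"

text \<open>A nonpositive ratio means that \<open>q\<close> and \<open>r\<close> are seen in
  opposite directions, so the cut of \<open>Ln\<close> does no harm off the segment. The case
  \<open>z = q\<close> falls under it through division by zero.\<close>

lemma ang_ratio_nonpos:
  assumes "cx (r - z) / cx (q - z) \<in> \<real>\<^sub>\<le>\<^sub>0"
  shows "z \<in> closed_segment q r"
proof (cases "q = z")
  case True
  then show ?thesis by simp
next
  case False
  then have nz: "cx (q - z) \<noteq> 0" by simp
  obtain l where l: "cx (r - z) / cx (q - z) = of_real l" "l \<le> 0"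
    using assms by (auto elim: nonpos_Reals_cases)
  have "cx (r - z) = of_real l * cx (q - z)"
    using l(1) nz by (simp add: field_simps)
  also have "\<dots> = cx (l *\<^sub>R (q - z))" by (simp add: cx_simps(3) scaleR_conv_of_real)
  finally have rz: "r - z = l *\<^sub>R (q - z)" by simp
  have r: "r = z + l *\<^sub>R (q - z)" using rz by (metis add.commute diff_add_cancel)
  \<comment> \<open>Solves \<open>(1 - u) + u * l = 0\<close>, the condition for the combination of
    \<open>q - z\<close> and \<open>r - z = l *\<^sub>R (q - z)\<close> to vanish.\<close>
  define u where "u = 1 / (1 - l)"
  have u: "0 \<le> u" "u \<le> 1" "u * (1 - l) = 1" using l by (auto simp: u_def)
  have "(1 - u) *\<^sub>R q + u *\<^sub>R r = (1 - u) *\<^sub>R q + u *\<^sub>R (z + l *\<^sub>R (q - z))"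
    by (subst r) (rule refl)
  also have "\<dots> = (1 - u * (1 - l)) *\<^sub>R q + (u * (1 - l)) *\<^sub>R z"
    by (simp add: algebra_simps)
  also have "\<dots> = z" using u by simp
  finally show ?thesis using u by (auto simp: closed_segment_def intro!: exI[of _ u])
qed

lemma isCont_ang:
  assumes "z \<notin> closed_segment q r"
  shows "isCont (ang q r) z"
proof -
  have nz: "cx (q - z) \<noteq> 0" using assms by (auto simp: closed_segment_def)
  have np: "cx (r - z) / cx (q - z) \<notin> \<real>\<^sub>\<le>\<^sub>0" using assms ang_ratio_nonpos by blast
  have "isCont (\<lambda>z. cx (r - z) / cx (q - z)) z"
    using nz by (intro continuous_intros)
  then have "isCont (\<lambda>z. Ln (cx (r - z) / cx (q - z))) z"
    using np by (rule isCont_Ln')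
  then have "isCont (\<lambda>z. Im (Ln (cx (r - z) / cx (q - z)))) z" by (rule continuous_Im)
  moreover have "ang q r = (\<lambda>z. Im (Ln (cx (r - z) / cx (q - z))))"
    by (simp add: ang_def fun_eq_iff)
  ultimately show ?thesis by simp
qed

lemma cis_ang:
  assumes "z \<noteq> q" "z \<noteq> r"
  shows "cis (ang q r z) = sgn (cx (r - z)) / sgn (cx (q - z))"
proof -
  have nz: "cx (r - z) / cx (q - z) \<noteq> 0" using assms by auto
  have "cis (ang q r z) = sgn (cx (r - z) / cx (q - z))"
    unfolding ang_def using cis_Arg[OF nz] Arg_eq_Im_Ln[OF nz] by simp
  then show ?thesis by (simp add: sgn_divide)
qed

text \<open>In coordinates where the segment has direction 1, the ratio in \<open>ang\<close> is
  \<open>- f \<epsilon>\<close> with \<open>f\<close> close to the positive number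
  \<open>(1 - m) / m\<close>. So \<open>Ln (f \<epsilon>)\<close> is continuous, and negation adds
  or subtracts \<open>pi\<close> according to the side; \<open>\<sigma>\<close> records to which
  side of the segment \<open>v\<close> points.\<close>

lemma ang_jump:
  assumes m: "0 < m" "m < 1" and y: "y = (1 - m) *\<^sub>R q + m *\<^sub>R r"
    and v: "cross2 (r - q) v \<noteq> 0"
  obtains \<sigma> g where "\<bar>\<sigma>\<bar> = 1" "isCont g (0::real)"
    "\<forall>\<^sub>F \<epsilon> in at 0. ang q r (y + \<epsilon> *\<^sub>R v) = g \<epsilon> + \<sigma> * pi * sgn \<epsilon>"
proof -
  define D where "D = cx (r - q)"
  define \<omega> where "\<omega> = cx v / D"
  have D: "D \<noteq> 0" using v by (auto simp: D_def cross2_def)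
  have Im\<omega>: "Im \<omega> = cross2 (r - q) v / (cmod D)\<^sup>2"
    unfolding \<omega>_def Im_divide by (simp add: D_def cx_def cross2_def mult.commute cmod_def)
  have Im\<omega>0: "Im \<omega> \<noteq> 0" using v D by (simp add: Im\<omega>)
  define f where "f \<epsilon> = (of_real (1 - m) - of_real \<epsilon> * \<omega>) / (of_real m + of_real \<epsilon> * \<omega>)" for \<epsilon> :: real
  have ratio: "cx (r - (y + \<epsilon> *\<^sub>R v)) / cx (q - (y + \<epsilon> *\<^sub>R v)) = - f \<epsilon>" for \<epsilon>
  proof -
    have e: "r - (y + \<epsilon> *\<^sub>R v) = (1 - m) *\<^sub>R (r - q) - \<epsilon> *\<^sub>R v"
      unfolding y by (simp add: algebra_simps)
    have a: "cx (r - (y + \<epsilon> *\<^sub>R v)) = D * (of_real (1 - m) - of_real \<epsilon> * \<omega>)"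
      using D unfolding e cx_simps(2)[of "(1 - m) *\<^sub>R (r - q)"] cx_simps(3) D_def[symmetric]
      by (simp add: \<omega>_def scaleR_conv_of_real algebra_simps)
    have "q - (y + \<epsilon> *\<^sub>R v) = - (m *\<^sub>R (r - q) + \<epsilon> *\<^sub>R v)"
      unfolding y by (simp add: algebra_simps)
    then have "cx (q - (y + \<epsilon> *\<^sub>R v)) = cx ((-1) *\<^sub>R (m *\<^sub>R (r - q) + \<epsilon> *\<^sub>R v))" by simp
    also have "\<dots> = - (D * (of_real m + of_real \<epsilon> * \<omega>))"
      using D unfolding cx_simps(1,3) D_def[symmetric]
      by (simp add: \<omega>_def scaleR_conv_of_real distrib_left)
    finally show ?thesis using a D by (simp add: f_def)
  qed
  have nz0: "of_real m + of_real 0 * \<omega> \<noteq> 0" using m by simp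
  have f0: "f 0 = of_real ((1 - m) / m)" by (simp add: f_def)
  have cf: "isCont f 0" unfolding f_def using nz0 by (intro continuous_intros)
  have "f 0 \<notin> \<real>\<^sub>\<le>\<^sub>0" unfolding f0 using m by (simp add: complex_nonpos_Reals_iff not_le)
  then have "isCont (\<lambda>\<epsilon>. Ln (f \<epsilon>)) 0" using cf isCont_Ln' by blast
  then have g: "isCont (\<lambda>\<epsilon>. Im (Ln (f \<epsilon>))) 0" by (rule continuous_Im)
  have "((\<lambda>\<epsilon>. Re (f \<epsilon>)) \<longlongrightarrow> Re (f 0)) (at 0)"
    using cf by (intro tendsto_intros) (simp add: isCont_def)
  moreover have "Re (f 0) > 0" unfolding f0 using m by simp
  ultimately have ev1: "\<forall>\<^sub>F \<epsilon> in at 0. Re (f \<epsilon>) > 0" by (rule order_tendstoD(1))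
  have ev2: "\<forall>\<^sub>F \<epsilon>::real in at 0. \<epsilon> \<noteq> 0" by (simp add: eventually_at_filter)
  have ev: "\<forall>\<^sub>F \<epsilon> in at 0. ang q r (y + \<epsilon> *\<^sub>R v) = Im (Ln (f \<epsilon>)) + sgn (Im \<omega>) * pi * sgn \<epsilon>"
    using ev1 ev2
  proof eventually_elim
    case (elim \<epsilon>)
    have fnz: "f \<epsilon> \<noteq> 0" using elim by auto
    then have dnz: "of_real m + of_real \<epsilon> * \<omega> \<noteq> 0" by (auto simp: f_def)
    have Imf: "Im (f \<epsilon>) = - (\<epsilon> * Im \<omega>) / (cmod (of_real m + of_real \<epsilon> * \<omega>))\<^sup>2"
      unfolding f_def Im_divide by (simp add: cmod_def algebra_simps)
    have "Im (f \<epsilon>) < 0 \<longleftrightarrow> \<epsilon> * Im \<omega> > 0"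
      unfolding Imf using dnz by (simp add: field_simps zero_less_mult_iff)
    moreover have "\<epsilon> * Im \<omega> \<noteq> 0" "Im (f \<epsilon>) \<noteq> 0" using elim Im\<omega>0 dnz by (auto simp: Imf)
    ultimately have "Im (Ln (- f \<epsilon>)) = Im (Ln (f \<epsilon>)) + sgn (\<epsilon> * Im \<omega>) * pi"
      using Ln_minus[OF fnz] elim by (auto simp: sgn_if)
    then show ?case unfolding ang_def ratio by (simp add: sgn_mult mult_ac)
  qed
  show ?thesis
    by (rule that[OF _ g ev]) (use Im\<omega>0 in \<open>simp add: abs_sgn_eq\<close>)
qed

context plane_curve
begin

section \<open>Angle sums along an arc of the curve\<close>

definition clamp :: "real \<Rightarrow> real \<Rightarrow> real \<Rightarrow> real" where
  "clamp s e x = max s (min e x)"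

text \<open>Clamping to the arc makes the edges outside it degenerate; they contribute the angle 0.\<close>

definition arc_angle :: "real \<Rightarrow> real \<Rightarrow> point2 \<Rightarrow> real" where
  "arc_angle s e z = (\<Sum>k<nat \<lceil>e\<rceil>. ang (p (clamp s e (real k))) (p (clamp s e (real k + 1))) z)"

lemma segment_subset_arc:
  assumes "real k \<le> a" "a \<le> b" "b \<le> real k + 1"
  shows "closed_segment (p a) (p b) \<subseteq> p ` {a..b}"
proof
  fix z assume "z \<in> closed_segment (p a) (p b)"
  then obtain u where u: "0 \<le> u" "u \<le> 1" "z = (1 - u) *\<^sub>R p a + u *\<^sub>R p b"
    by (auto simp: closed_segment_def)
  define c where "c = a + u * (b - a)"
  have "u * (b - a) \<le> 1 * (b - a)" using u assms by (intro mult_right_mono) auto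
  then have c: "a \<le> c" "c \<le> b" using u assms by (auto simp: c_def)
  have pa: "p a = P ! (k mod n) + (a - real k) *\<^sub>R edge k"
    and pb: "p b = P ! (k mod n) + (b - real k) *\<^sub>R edge k"
    and pc: "p c = P ! (k mod n) + (c - real k) *\<^sub>R edge k"
    using assms c by (auto intro!: p_affine)
  have "p c = z" unfolding u(3) pa pb pc by (simp add: c_def algebra_simps)
  then show "z \<in> p ` {a..b}" using c by auto
qed

lemma clamp_cases:
  assumes "s \<le> e"
  obtains "clamp s e (real k) = clamp s e (real k + 1)"
  | "real k \<le> clamp s e (real k)" "clamp s e (real k) \<le> clamp s e (real k + 1)"
    "clamp s e (real k + 1) \<le> real k + 1"
proof -
  have "clamp s e (real k) = clamp s e (real k + 1) \<or>
    real k \<le> clamp s e (real k) \<and> clamp s e (real k) \<le> clamp s e (real k + 1) \<and>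
    clamp s e (real k + 1) \<le> real k + 1"
    using assms unfolding clamp_def min_def max_def by auto
  then show ?thesis using that by blast
qed

lemma clamp_bounds: "s \<le> e \<Longrightarrow> s \<le> clamp s e x" "s \<le> e \<Longrightarrow> clamp s e x \<le> e"
  by (auto simp: clamp_def)

lemma clamp_segment_subset:
  assumes "s \<le> e"
  shows "closed_segment (p (clamp s e (real k))) (p (clamp s e (real k + 1)))
           \<subseteq> p ` {clamp s e (real k)..clamp s e (real k + 1)}"
  using assms
proof (cases rule: clamp_cases[of s e k, consumes 1])
  case 1
  then show ?thesis by simp
next
  case 2
  then show ?thesis by (rule segment_subset_arc)
qed

lemma isCont_arc_angle:
  assumes "s \<le> e" "z \<notin> p ` {s..e}"
  shows "isCont (arc_angle s e) z"
proof -
  have "isCont (\<lambda>z. ang (p (clamp s e (real k))) (p (clamp s e (real k + 1))) z) z" for k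
  proof (rule isCont_ang)
    have "p ` {clamp s e (real k)..clamp s e (real k + 1)} \<subseteq> p ` {s..e}"
      using clamp_bounds[OF assms(1)] by (intro image_mono) (meson atLeastatMost_subset_iff)
    then show "z \<notin> closed_segment (p (clamp s e (real k))) (p (clamp s e (real k + 1)))"
      using clamp_segment_subset[OF assms(1), of k] assms(2) by blast
  qed
  then show ?thesis unfolding arc_angle_def by (intro continuous_intros)
qed

text \<open>The quotients of unit vectors telescope over the vertices. Clamping turns the first one
  into \<open>s\<close> and, as \<open>nat \<lceil>e\<rceil>\<close> edges are summed, the last one
  into \<open>e\<close>.\<close>

lemma cis_arc_angle:
  assumes "0 \<le> s" "s \<le> e" "z \<notin> p ` {s..e}"
  shows "cis (arc_angle s e z) = sgn (cx (p e - z)) / sgn (cx (p s - z))"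
proof -
  have nz: "z \<noteq> p (clamp s e x)" for x
    using assms clamp_bounds[OF assms(2)] by (metis atLeastAtMost_iff image_eqI)
  have "cis (\<Sum>k<N. ang (p (clamp s e (real k))) (p (clamp s e (real k + 1))) z) =
     sgn (cx (p (clamp s e (real N)) - z)) / sgn (cx (p (clamp s e 0) - z))" for N
  proof (induction N)
    case 0
    show ?case using nz[of 0] by (simp add: sgn_zero_iff)
  next
    case (Suc N)
    show ?case
      using Suc nz[of "real N"] nz[of "real N + 1"]
      by (simp add: cis_mult[symmetric] cis_ang sgn_zero_iff add.commute)
  qed
  moreover have "clamp s e 0 = s" using assms by (simp add: clamp_def)
  moreover have "clamp s e (real (nat \<lceil>e\<rceil>)) = e"
    using assms real_nat_ceiling_ge[of e] by (simp add: clamp_def)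
  ultimately show ?thesis unfolding arc_angle_def by simp
qed

text \<open>Only the edge through \<open>p r\<close> can jump: \<open>r\<close> is not a vertex, and
  the remaining pieces of the arc miss the point, so their angles are continuous there and are
  absorbed into \<open>g\<close>.\<close>

lemma arc_angle_jump:
  assumes se: "0 \<le> s" "s < r" "r < e" and r: "r \<notin> \<int>"
    and once: "p r \<notin> p ` ({s..e} - {r})" and v: "cross2 (seg_dir P r) v \<noteq> 0"
  obtains \<sigma> g where "\<bar>\<sigma>\<bar> = 1" "isCont g (0::real)"
    "\<forall>\<^sub>F \<epsilon> in at 0. arc_angle s e (p r + \<epsilon> *\<^sub>R v) = g \<epsilon> + \<sigma> * pi * sgn \<epsilon>"
proof -
  define k0 where "k0 = nat \<lfloor>r\<rfloor>"
  have k0: "real k0 \<le> r" "r < real k0 + 1" using se unfolding k0_def by linarith+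
  have "real k0 \<noteq> r" using r by (metis Ints_of_nat)
  then have k0': "real k0 < r" using k0 by simp
  define a where "a = clamp s e (real k0)"
  define b where "b = clamp s e (real k0 + 1)"
  have ab: "real k0 \<le> a" "a < r" "r < b" "b \<le> real k0 + 1"
    using se k0 k0' unfolding a_def b_def clamp_def by auto
  have k0N: "k0 < nat \<lceil>e\<rceil>"
    using k0 se by linarith
  define h where "h k z = ang (p (clamp s e (real k))) (p (clamp s e (real k + 1))) z" for k z
  have cont: "isCont (h k) (p r)" if "k \<noteq> k0" for k
    unfolding h_def
  proof (rule isCont_ang)
    have "r \<notin> {clamp s e (real k)..clamp s e (real k + 1)}"
    proof
      assume *: "r \<in> {clamp s e (real k)..clamp s e (real k + 1)}"
      have "s \<le> e" using se by simp
      then show False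
      proof (cases rule: clamp_cases[of s e k, consumes 1])
        case 1
        then have "r = clamp s e (real k)" using * by simp
        then have "r = real k" using se by (auto simp: clamp_def max_def min_def split: if_splits)
        then show False using r by (metis Ints_of_nat)
      next
        case 2
        then have "real k \<le> r" "r \<le> real k + 1" using * by auto
        moreover have "r \<noteq> real k + 1" using r by (metis Ints_1 Ints_add Ints_of_nat)
        ultimately have "k = k0" using k0 by linarith
        then show False using that by simp
      qed
    qed
    moreover have "{clamp s e (real k)..clamp s e (real k + 1)} \<subseteq> {s..e}"
      using clamp_bounds[of s e] se by auto
    ultimately have "p r \<notin> p ` {clamp s e (real k)..clamp s e (real k + 1)}"
      using once by blast
    then show "p r \<notin> closed_segment (p (clamp s e (real k))) (p (clamp s e (real k + 1)))"
      using clamp_segment_subset[of s e k] se by auto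
  qed
  define m where "m = (r - a) / (b - a)"
  have m: "0 < m" "m < 1" using ab by (auto simp: m_def)
  have mr: "m * (b - a) = r - a" using ab by (simp add: m_def)
  have pa: "p a = P ! (k0 mod n) + (a - real k0) *\<^sub>R edge k0"
    and pb: "p b = P ! (k0 mod n) + (b - real k0) *\<^sub>R edge k0"
    and pr': "p r = P ! (k0 mod n) + (r - real k0) *\<^sub>R edge k0"
    using ab by (auto intro!: p_affine)
  have pab: "p b - p a = (b - a) *\<^sub>R seg_dir P r"
    unfolding pa pb seg_dir_edge[OF k0] by (simp add: algebra_simps)
  have "p r = p a + (r - a) *\<^sub>R seg_dir P r"
    unfolding pa pr' seg_dir_edge[OF k0] by (simp add: algebra_simps)
  also have "\<dots> = p a + m *\<^sub>R (p b - p a)" by (simp add: pab mr)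
  finally have pr: "p r = (1 - m) *\<^sub>R p a + m *\<^sub>R p b" by (simp add: algebra_simps)
  have v': "cross2 (p b - p a) v \<noteq> 0"
    using v ab unfolding pab by (simp add: cross2_def flip: right_diff_distrib mult.assoc)
  obtain \<sigma> g where g: "\<bar>\<sigma>\<bar> = 1" "isCont g (0::real)"
    "\<forall>\<^sub>F \<epsilon> in at 0. ang (p a) (p b) (p r + \<epsilon> *\<^sub>R v) = g \<epsilon> + \<sigma> * pi * sgn \<epsilon>"
    using ang_jump[OF m pr v'] .
  define G where "G \<epsilon> = g \<epsilon> + (\<Sum>k\<in>{..<nat \<lceil>e\<rceil>} - {k0}. h k (p r + \<epsilon> *\<^sub>R v))" for \<epsilon>
  have "isCont (\<lambda>\<epsilon>. h k (p r + \<epsilon> *\<^sub>R v)) 0" if "k \<noteq> k0" for k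
    by (rule isCont_o2[where g = "h k"]) (use cont[OF that] in \<open>auto intro!: continuous_intros\<close>)
  then have "isCont G 0" unfolding G_def using g(2) by (intro continuous_intros) auto
  moreover have "\<forall>\<^sub>F \<epsilon> in at 0. arc_angle s e (p r + \<epsilon> *\<^sub>R v) = G \<epsilon> + \<sigma> * pi * sgn \<epsilon>"
    using g(3)
  proof eventually_elim
    case (elim \<epsilon>)
    have "arc_angle s e (p r + \<epsilon> *\<^sub>R v) = (\<Sum>k<nat \<lceil>e\<rceil>. h k (p r + \<epsilon> *\<^sub>R v))"
      by (simp add: arc_angle_def h_def)
    also have "\<dots> = h k0 (p r + \<epsilon> *\<^sub>R v) + (\<Sum>k\<in>{..<nat \<lceil>e\<rceil>} - {k0}. h k (p r + \<epsilon> *\<^sub>R v))"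
      using k0N by (intro sum.remove) auto
    finally show ?case using elim by (simp add: G_def h_def a_def b_def)
  qed
  ultimately show ?thesis using that g(1) by blast
qed

section \<open>Winding numbers: integrality, local constancy and jumps\<close>

definition cycle :: "real \<Rightarrow> real \<Rightarrow> real \<Rightarrow> real \<Rightarrow> bool" where
  "cycle s e s' e' \<longleftrightarrow> 0 \<le> s \<and> s \<le> e \<and> 0 \<le> s' \<and> s' \<le> e' \<and> p s = p s' \<and> p e = p e'"

text \<open>
  The cycle runs along the arc from s to e and returns along the second arc, from e' to s'.
  Taking s' = e' = s gives the closed curve traced from s to e.
\<close>

definition wind :: "real \<Rightarrow> real \<Rightarrow> real \<Rightarrow> real \<Rightarrow> point2 \<Rightarrow> real" where
  "wind s e s' e' z = (arc_angle s e z - arc_angle s' e' z) / (2 * pi)"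

definition arcs :: "real \<Rightarrow> real \<Rightarrow> real \<Rightarrow> real \<Rightarrow> point2 set" where
  "arcs s e s' e' = p ` {s..e} \<union> p ` {s'..e'}"

text \<open>Both arcs have the same ends, so \<open>cis\<close> sees the same quotient of end
  directions twice and the angle sums differ by a multiple of \<open>2 * pi\<close>.\<close>

lemma wind_Ints:
  assumes "cycle s e s' e'" "z \<notin> arcs s e s' e'"
  shows "wind s e s' e' z \<in> \<int>"
proof -
  have nz: "p s - z \<noteq> 0" "p e - z \<noteq> 0"
    using assms by (force simp: cycle_def arcs_def)+
  have "cis (arc_angle s e z - arc_angle s' e' z) = cis (arc_angle s e z) / cis (arc_angle s' e' z)"
    by (simp add: cis_divide)
  also have "\<dots> = 1"
    using assms nz by (simp add: cis_arc_angle cycle_def arcs_def sgn_zero_iff)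
  finally have "exp (\<i> * of_real (arc_angle s e z - arc_angle s' e' z)) = 1"
    by (simp add: cis_conv_exp)
  then obtain m :: int where "arc_angle s e z - arc_angle s' e' z = of_int (2 * m) * pi"
    by (auto simp: exp_eq_1)
  then have "wind s e s' e' z = of_int m" by (simp add: wind_def)
  then show ?thesis by simp
qed

lemma isCont_wind:
  assumes "cycle s e s' e'" "z \<notin> arcs s e s' e'"
  shows "isCont (wind s e s' e') z"
  unfolding wind_def using assms
  by (intro continuous_intros isCont_arc_angle) (auto simp: cycle_def arcs_def)

lemma Ints_eq_if_close: "(a::real) \<in> \<int> \<Longrightarrow> b \<in> \<int> \<Longrightarrow> \<bar>a - b\<bar> < 1 \<Longrightarrow> a = b"
  by (auto elim!: Ints_cases)

text \<open>Distinct integers are at least 1 apart, so a continuous integer-valued function on a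
  connected set is constant. The set only has to avoid the cycle and may meet the rest of the
  curve.\<close>

lemma wind_const:
  assumes "cycle s e s' e'" "connected S" "S \<inter> arcs s e s' e' = {}" "a \<in> S" "b \<in> S"
  shows "wind s e s' e' a = wind s e s' e' b"
proof -
  have "wind s e s' e' constant_on S"
  proof (rule continuous_discrete_range_constant[OF assms(2)])
    show "continuous_on S (wind s e s' e')"
      using isCont_wind[OF assms(1)] assms(3) by (intro continuous_at_imp_continuous_on) auto
    fix x assume "x \<in> S"
    then show "\<exists>e''>0. \<forall>y. y \<in> S \<and> wind s e s' e' y \<noteq> wind s e s' e' x \<longrightarrow>
        e'' \<le> norm (wind s e s' e' y - wind s e s' e' x)"
      using wind_Ints[OF assms(1)] assms(3) Ints_eq_if_close
      by (intro exI[of _ 1]) (metis disjoint_iff linorder_not_le real_norm_def zero_less_one)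
  qed
  then show ?thesis using assms unfolding constant_on_def by metis
qed

text \<open>Between \<open>- \<epsilon>\<close> and \<open>\<epsilon>\<close> the angle sum changes
  by \<open>2 * pi\<close>, up to sign and up to the error
  \<open>G \<epsilon> - G (- \<epsilon>)\<close>, which tends to 0. As winding numbers are integers,
  the error is exactly 0 for small \<open>\<epsilon>\<close>.\<close>

lemma wind_jump:
  assumes cyc: "cycle s e s' e'" and r: "s < r" "r < e" "r \<notin> \<int>"
    and once: "p r \<notin> p ` ({s..e} - {r})" "p r \<notin> p ` {s'..e'}"
    and v: "cross2 (seg_dir P r) v \<noteq> 0"
    and off: "\<forall>\<^sub>F \<epsilon> in at 0. p r + \<epsilon> *\<^sub>R v \<notin> arcs s e s' e'"
  shows "\<forall>\<^sub>F \<epsilon> in at 0. \<bar>wind s e s' e' (p r + \<epsilon> *\<^sub>R v) - wind s e s' e' (p r - \<epsilon> *\<^sub>R v)\<bar> = 1"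
proof -
  let ?W = "wind s e s' e'"
  have s0: "0 \<le> s" using cyc by (simp add: cycle_def)
  obtain \<sigma> g where g: "\<bar>\<sigma>\<bar> = 1" "isCont g (0::real)"
    "\<forall>\<^sub>F \<epsilon> in at 0. arc_angle s e (p r + \<epsilon> *\<^sub>R v) = g \<epsilon> + \<sigma> * pi * sgn \<epsilon>"
    using arc_angle_jump[OF s0 r once(1) v] .
  define G where "G \<epsilon> = g \<epsilon> - arc_angle s' e' (p r + \<epsilon> *\<^sub>R v)" for \<epsilon>
  have "isCont (\<lambda>\<epsilon>. arc_angle s' e' (p r + \<epsilon> *\<^sub>R v)) 0"
    by (rule isCont_o2[where g = "arc_angle s' e'"])
      (use isCont_arc_angle[of s' e' "p r"] cyc once in
        \<open>auto intro!: continuous_intros simp: cycle_def\<close>)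
  then have G: "isCont G 0" unfolding G_def using g(2) by (intro continuous_intros)
  have neg: "\<forall>\<^sub>F \<epsilon> in at 0. Q (- \<epsilon>)" if "\<forall>\<^sub>F \<epsilon> in at (0::real). Q \<epsilon>" for Q
    using that by (metis eventually_filtermap filtermap_at_minus minus_zero)
  have W: "\<forall>\<^sub>F \<epsilon> in at 0. ?W (p r + \<epsilon> *\<^sub>R v) = (G \<epsilon> + \<sigma> * pi * sgn \<epsilon>) / (2 * pi)"
    using g(3) by eventually_elim (simp add: wind_def G_def)
  have I: "\<forall>\<^sub>F \<epsilon> in at 0. ?W (p r + \<epsilon> *\<^sub>R v) \<in> \<int>"
    using off by eventually_elim (rule wind_Ints[OF cyc])
  have "isCont (\<lambda>\<epsilon>. G \<epsilon> - G (- \<epsilon>)) 0"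
    using G isCont_o2[where g = G and f = uminus and a = "0::real"] by (intro continuous_intros) auto
  then have "((\<lambda>\<epsilon>. G \<epsilon> - G (- \<epsilon>)) \<longlongrightarrow> 0) (at 0)" by (simp add: isCont_def)
  then have "\<forall>\<^sub>F \<epsilon> in at 0. dist (G \<epsilon> - G (- \<epsilon>)) 0 < pi" by (rule tendstoD) simp
  moreover have "\<forall>\<^sub>F \<epsilon>::real in at 0. \<epsilon> \<noteq> 0" by (simp add: eventually_at_filter)
  ultimately show ?thesis using W I neg[OF W] neg[OF I]
  proof eventually_elim
    case (elim \<epsilon>)
    define d where "d = ?W (p r + \<epsilon> *\<^sub>R v) - ?W (p r - \<epsilon> *\<^sub>R v)"
    have dI: "d \<in> \<int>" using elim by (simp add: d_def)
    have d: "d = (G \<epsilon> - G (- \<epsilon>)) / (2 * pi) + \<sigma> * sgn \<epsilon>"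
      using elim by (simp add: d_def sgn_minus field_simps)
    have "\<bar>(G \<epsilon> - G (- \<epsilon>)) / (2 * pi)\<bar> < 1" using elim by (simp add: abs_divide field_simps)
    moreover have s: "\<sigma> * sgn \<epsilon> = 1 \<or> \<sigma> * sgn \<epsilon> = -1"
      using g(1) elim by (auto simp: sgn_if abs_if split: if_splits)
    ultimately have "d = \<sigma> * sgn \<epsilon>"
      using dI d by (intro Ints_eq_if_close) (auto)
    then show ?case using s by (auto simp: d_def[symmetric])
  qed
qed

lemma wind_locally_const:
  assumes cyc: "cycle s e s' e'" and "z \<notin> arcs s e s' e'"
  shows "\<forall>\<^sub>F y in nhds z. wind s e s' e' y = wind s e s' e' z"
proof -
  have "closed (arcs s e s' e')"
    unfolding arcs_def using cyc
    by (intro closed_Un compact_imp_closed compact_continuous_image continuous_on_p)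
      (auto simp: cycle_def)
  then have "open (- arcs s e s' e')" by (rule open_Compl)
  then obtain \<delta> where d: "\<delta> > 0" "ball z \<delta> \<subseteq> - arcs s e s' e'"
    using assms(2) openE by blast
  have "wind s e s' e' y = wind s e s' e' z" if "y \<in> ball z \<delta>" for y
    by (rule wind_const[OF cyc, of "ball z \<delta>"]) (use d that in auto)
  then show ?thesis unfolding eventually_nhds by (metis centre_in_ball d(1) open_ball)
qed

end

section \<open>Corners at a crossing\<close>

lemma cross2_independent:
  assumes "cross2 v w \<noteq> 0" "a *\<^sub>R v + b *\<^sub>R w = c *\<^sub>R v + d *\<^sub>R w"
  shows "a = c \<and> b = d"
proof -
  have "(a - c) *\<^sub>R v = (d - b) *\<^sub>R w" using assms(2) by (simp add: algebra_simps)
  then have e: "(a - c) * fst v = (d - b) * fst w" "(a - c) * snd v = (d - b) * snd w"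
    by (simp_all add: prod_eq_iff)
  have "(a - c) * cross2 v w = ((a - c) * fst v) * snd w - ((a - c) * snd v) * fst w"
    by (simp add: cross2_def algebra_simps)
  also have "\<dots> = 0" unfolding e by simp
  finally have 1: "a = c" using assms by simp
  have "(d - b) * cross2 v w = fst v * ((d - b) * snd w) - snd v * ((d - b) * fst w)"
    by (simp add: cross2_def algebra_simps)
  also have "\<dots> = 0" unfolding e[symmetric] by simp
  finally show ?thesis using 1 assms by simp
qed

lemma cross2_expand:
  assumes "cross2 v w \<noteq> 0"
  shows "z = (cross2 z w / cross2 v w) *\<^sub>R v + (cross2 v z / cross2 v w) *\<^sub>R w"
proof -
  have "cross2 v w *\<^sub>R z = cross2 z w *\<^sub>R v + cross2 v z *\<^sub>R w"
    by (simp add: cross2_def prod_eq_iff algebra_simps)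
  then have "(1 / cross2 v w) *\<^sub>R (cross2 v w *\<^sub>R z)
     = (1 / cross2 v w) *\<^sub>R (cross2 z w *\<^sub>R v + cross2 v z *\<^sub>R w)" by simp
  then show ?thesis using assms by (simp add: scaleR_add_right)
qed

context plane_curve
begin

section \<open>Local affine coordinates at a crossing\<close>

definition simple_at :: "real \<Rightarrow> bool" where
  "simple_at r \<longleftrightarrow> 0 \<le> r \<and> r \<notin> \<int> \<and> (\<forall>w\<ge>0. p w = p r \<longrightarrow> same r w)"

text \<open>In affine coordinates along the two strand directions, the open square of half-width
  \<open>\<delta>\<close> around the crossing meets the curve exactly in the two axes, and the
  strands run along them at unit parameter speed.\<close>

definition good_radius :: "real \<Rightarrow> real \<Rightarrow> real \<Rightarrow> bool" where
  "good_radius t u \<delta> \<longleftrightarrow> \<delta> > 0 \<and>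
     (\<forall>a. \<bar>a\<bar> < \<delta> \<longrightarrow> 0 < t + a \<and> 0 < u + a \<and>
        p (t + a) = p t + a *\<^sub>R seg_dir P t \<and> p (u + a) = p t + a *\<^sub>R seg_dir P u \<and>
        seg_dir P (t + a) = seg_dir P t \<and> seg_dir P (u + a) = seg_dir P u \<and>
        t + a \<notin> \<int> \<and> u + a \<notin> \<int>) \<and>
     (\<forall>w a b. 0 \<le> w \<longrightarrow> \<bar>a\<bar> < \<delta> \<longrightarrow> \<bar>b\<bar> < \<delta> \<longrightarrow>
        p w = p t + a *\<^sub>R seg_dir P t + b *\<^sub>R seg_dir P u \<longrightarrow>
        b = 0 \<and> same (t + a) w \<or> a = 0 \<and> same (u + b) w)"

text \<open>Around \<open>x\<close> the two edges are straight, and the rest of one period is a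
  compact set of parameters whose image misses \<open>x\<close>; a small square therefore meets no
  further strand.\<close>

lemma good_radius_exists:
  assumes D: "double_at t u x"
  shows "\<exists>\<delta>. good_radius t u \<delta>"
proof -
  have tu: "0 < t" "t < u" "u < t + real n" "p t = x" "p u = x" "t \<notin> \<int>" "u \<notin> \<int>"
    "cross2 (seg_dir P t) (seg_dir P u) \<noteq> 0" "\<And>w. w \<ge> 0 \<Longrightarrow> p w = x \<Longrightarrow> same t w \<or> same u w"
    using D by (auto simp: double_at_def)
  define k where "k = nat \<lfloor>t\<rfloor>"
  define l where "l = nat \<lfloor>u\<rfloor>"
  have k0: "real k \<le> t" "t < real k + 1" using tu unfolding k_def by linarith+
  have l0: "real l \<le> u" "u < real l + 1" using tu unfolding l_def by linarith+
  have "real k \<noteq> t" "real l \<noteq> u" using tu by (metis Ints_of_nat)+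
  then have k: "real k < t" "t < real k + 1" and l: "real l < u" "u < real l + 1"
    using k0 l0 by auto
  \<comment> \<open>The first four bounds keep both strands inside their edges; the two halves keep
    the windows around \<open>t\<close>, \<open>u\<close> and \<open>t + real n\<close> from
    overlapping.\<close>
  define gaps where "gaps = {t - real k, real k + 1 - t, u - real l, real l + 1 - u, (u - t) / 2, (t + real n - u) / 2}"
  define \<delta>1 where "\<delta>1 = Min gaps"
  have gaps: "finite gaps" "gaps \<noteq> {}" by (simp_all add: gaps_def)
  have "0 < g" if "g \<in> gaps" for g
    using that k l tu unfolding gaps_def by auto
  then have d0: "0 < \<delta>1" unfolding \<delta>1_def using gaps by simp
  have "\<delta>1 \<le> g" if "g \<in> gaps" for g
    unfolding \<delta>1_def using gaps that by simp
  then have d1: "0 < \<delta>1" "\<delta>1 \<le> t - real k" "\<delta>1 \<le> real k + 1 - t" "\<delta>1 \<le> u - real l" "\<delta>1 \<le> real l + 1 - u"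
    "\<delta>1 \<le> (u - t) / 2" "\<delta>1 \<le> (t + real n - u) / 2"
    using d0 unfolding gaps_def by blast+
  have pt: "p (t + a) = x + a *\<^sub>R seg_dir P t" if "\<bar>a\<bar> \<le> \<delta>1" for a
    using p_within_edge[of k t "t + a"] k d1 that tu by (auto simp: abs_le_iff)
  have pu: "p (u + a) = x + a *\<^sub>R seg_dir P u" if "\<bar>a\<bar> \<le> \<delta>1" for a
    using p_within_edge[of l u "u + a"] l d1 that tu by (auto simp: abs_le_iff)
  define I where "I = {t + \<delta>1..u - \<delta>1} \<union> {u + \<delta>1..t + real n - \<delta>1}"
  have "compact (p ` I)"
    unfolding I_def using tu d1
    by (intro compact_continuous_image continuous_on_p compact_Un) auto
  then have "open (- (p ` I))" by (intro open_Compl compact_imp_closed)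
  moreover have "x \<in> - (p ` I)"
  proof -
    have False if w: "w \<in> I" "p w = x" for w
    proof -
      have b: "t < w" "w < t + real n" "w \<noteq> u" "\<bar>u - w\<bar> < real n"
        using w(1) d1 tu unfolding I_def by auto
      have "same t w \<or> same u w" using tu(9)[OF _ w(2)] b tu by auto
      then show False using same_close[of t w] same_close[of u w] b by auto
    qed
    then show ?thesis by auto
  qed
  ultimately obtain e where e: "e > 0" "ball x e \<subseteq> - (p ` I)" using openE by blast
  \<comment> \<open>Turns coordinates into distance: points of the square lie within
    \<open>\<delta> * N\<close> of \<open>x\<close>. The summand 1 makes this bound strict and
    \<open>N\<close> positive.\<close>
  define N where "N = norm (seg_dir P t) + norm (seg_dir P u) + 1"
  have N: "N > 0" by (simp add: N_def add_nonneg_pos)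
  define \<delta> where "\<delta> = min \<delta>1 (e / N)"
  have d: "0 < \<delta>" "\<delta> \<le> \<delta>1" "\<delta> * N \<le> e"
    using d1 e N by (auto simp: \<delta>_def min_def field_simps)
  have nonint: "t + a \<notin> \<int>" "u + a \<notin> \<int>" if "\<bar>a\<bar> < \<delta>" for a
  proof -
    have 1: "real k < t + a" "t + a < real k + 1" "real l < u + a" "u + a < real l + 1"
      using that d d1 by auto
    have no: "y \<notin> \<int>" if "real j < y" "y < real j + 1" for y j
    proof
      assume "y \<in> \<int>"
      then obtain m :: int where "y = of_int m" by (auto elim: Ints_cases)
      then have "of_int (int j) < (of_int m :: real)" "of_int m < (of_int (int j + 1) :: real)"
        using that by auto
      then show False unfolding of_int_less_iff by linarith
    qed
    show "t + a \<notin> \<int>" "u + a \<notin> \<int>" using no 1 by blast+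
  qed
  have part1: "0 < t + a \<and> 0 < u + a \<and>
        p (t + a) = p t + a *\<^sub>R seg_dir P t \<and> p (u + a) = p t + a *\<^sub>R seg_dir P u \<and>
        seg_dir P (t + a) = seg_dir P t \<and> seg_dir P (u + a) = seg_dir P u \<and>
        t + a \<notin> \<int> \<and> u + a \<notin> \<int>" if "\<bar>a\<bar> < \<delta>" for a
  proof -
    have b: "\<bar>a\<bar> < \<delta>1" using that d by simp
    have "seg_dir P (t + a) = edge k" "seg_dir P t = edge k"
      "seg_dir P (u + a) = edge l" "seg_dir P u = edge l"
      using b d1 k l by (auto intro!: seg_dir_edge)
    moreover have "0 < t + a" "0 < u + a" using b d1 tu k l by linarith+
    ultimately show ?thesis using pt[of a] pu[of a] b tu(4) nonint[OF that] by auto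
  qed
  have part2: "b = 0 \<and> same (t + a) w \<or> a = 0 \<and> same (u + b) w"
    if w: "0 \<le> w" and ab: "\<bar>a\<bar> < \<delta>" "\<bar>b\<bar> < \<delta>"
      and pw: "p w = p t + a *\<^sub>R seg_dir P t + b *\<^sub>R seg_dir P u" for w a b
  proof -
    have "norm (a *\<^sub>R seg_dir P t + b *\<^sub>R seg_dir P u) \<le> \<bar>a\<bar> * norm (seg_dir P t) + \<bar>b\<bar> * norm (seg_dir P u)"
      by (metis norm_scaleR norm_triangle_ineq)
    also have "\<dots> \<le> \<delta> * norm (seg_dir P t) + \<delta> * norm (seg_dir P u)"
      using ab by (intro add_mono mult_right_mono) auto
    also have "\<dots> < \<delta> * N" using d by (simp add: N_def algebra_simps)
    also have "\<dots> \<le> e" by (rule d)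
    finally have "norm (a *\<^sub>R seg_dir P t + b *\<^sub>R seg_dir P u) < e" .
    moreover have "p w - x = a *\<^sub>R seg_dir P t + b *\<^sub>R seg_dir P u"
      by (simp add: pw tu(4))
    ultimately have "p w \<in> ball x e" by (metis dist_commute dist_norm mem_ball)
    then have out: "p w \<notin> p ` I" using e by blast
    \<comment> \<open>A period starting at \<open>t - \<delta>1\<close> is covered by the window
      around \<open>t\<close>, the window around \<open>u\<close> and the two intervals of
      \<open>I\<close>.\<close>
    obtain w' where w': "same w w'" "t - \<delta>1 \<le> w'" "w' < t - \<delta>1 + real n"
      by (rule same_in_window)
    have w'0: "w' \<ge> 0" using w' d1 k by linarith
    have pw': "p w' = p w" using p_same[OF w'(1) w w'0] by simp
    then have "w' \<notin> I" using out by (metis imageI)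
    then consider "\<bar>w' - t\<bar> \<le> \<delta>1" | "\<bar>w' - u\<bar> \<le> \<delta>1"
      using w' unfolding I_def by fastforce
    then show ?thesis
    proof cases
      case 1
      have "p w' = x + (w' - t) *\<^sub>R seg_dir P t" using pt[of "w' - t"] 1 by simp
      then have "a *\<^sub>R seg_dir P t + b *\<^sub>R seg_dir P u = (w' - t) *\<^sub>R seg_dir P t + 0 *\<^sub>R seg_dir P u"
        using pw pw' tu(4) by (simp add: add.assoc)
      then have "a = w' - t \<and> b = 0" by (rule cross2_independent[OF tu(8)])
      then show ?thesis using same_sym[OF w'(1)] by simp
    next
      case 2
      have "p w' = x + (w' - u) *\<^sub>R seg_dir P u" using pu[of "w' - u"] 2 by simp
      then have "a *\<^sub>R seg_dir P t + b *\<^sub>R seg_dir P u = 0 *\<^sub>R seg_dir P t + (w' - u) *\<^sub>R seg_dir P u"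
        using pw pw' tu(4) by (simp add: add.assoc)
      then have "a = 0 \<and> b = w' - u" by (rule cross2_independent[OF tu(8)])
      then show ?thesis using same_sym[OF w'(1)] by simp
    qed
  qed
  have "good_radius t u \<delta>" unfolding good_radius_def using d(1) part1 part2 by blast
  then show ?thesis ..
qed

definition radius :: "real \<Rightarrow> real \<Rightarrow> real" where
  "radius t u = (SOME \<delta>. good_radius t u \<delta>)"

lemma good_radius_radius: "double_at t u x \<Longrightarrow> good_radius t u (radius t u)"
  unfolding radius_def using good_radius_exists someI_ex by metis

definition near :: "real \<Rightarrow> real \<Rightarrow> real \<Rightarrow> real \<Rightarrow> point2" where
  "near t u a b = p t + a *\<^sub>R seg_dir P t + b *\<^sub>R seg_dir P u"

lemma radius_pos: "double_at t u x \<Longrightarrow> radius t u > 0"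
  using good_radius_radius by (simp add: good_radius_def)

lemma near_off_curve:
  assumes D: "double_at t u x" and "\<bar>a\<bar> < radius t u" "\<bar>b\<bar> < radius t u" "a \<noteq> 0" "b \<noteq> 0"
  shows "near t u a b \<notin> curve_image P"
proof
  assume "near t u a b \<in> curve_image P"
  then obtain w where "w \<ge> 0" "p w = p t + a *\<^sub>R seg_dir P t + b *\<^sub>R seg_dir P u"
    unfolding curve_image_eq near_def by auto
  then have "b = 0 \<and> same (t + a) w \<or> a = 0 \<and> same (u + b) w"
    using good_radius_radius[OF D] assms unfolding good_radius_def by blast
  then show False using assms by simp
qed

lemma near_strand:
  assumes D: "double_at t u x" and a: "\<bar>a\<bar> < radius t u"
  shows "p (t + a) = near t u a 0" "p (u + a) = near t u 0 a"
    "seg_dir P (t + a) = seg_dir P t" "seg_dir P (u + a) = seg_dir P u" "0 < t + a" "0 < u + a"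
  using good_radius_radius[OF D] a unfolding good_radius_def near_def by auto

lemma simple_near:
  assumes D: "double_at t u x" and a: "\<bar>a\<bar> < radius t u" "a \<noteq> 0"
  shows "simple_at (t + a)" "simple_at (u + a)"
proof -
  note g = good_radius_radius[OF D]
  have r: "\<bar>0\<bar> < radius t u" using a by simp
  have "same (t + a) w" if "w \<ge> 0" "p w = p (t + a)" for w
  proof -
    have "p w = p t + a *\<^sub>R seg_dir P t + 0 *\<^sub>R seg_dir P u"
      using that near_strand(1)[OF D a(1)] by (simp add: near_def)
    then show ?thesis using g that a r unfolding good_radius_def by blast
  qed
  moreover have "same (u + a) w" if "w \<ge> 0" "p w = p (u + a)" for w
  proof -
    have "p w = p t + 0 *\<^sub>R seg_dir P t + a *\<^sub>R seg_dir P u"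
      using that near_strand(2)[OF D a(1)] by (simp add: near_def)
    then show ?thesis using g that a r unfolding good_radius_def by blast
  qed
  moreover have "0 < t + a \<and> 0 < u + a \<and> t + a \<notin> \<int> \<and> u + a \<notin> \<int>"
    using g a(1) unfolding good_radius_def by blast
  ultimately show "simple_at (t + a)" "simple_at (u + a)" unfolding simple_at_def by auto
qed

text \<open>The sample point only selects the component containing the open quadrant with these
  signs. Different quadrants may belong to the same region.\<close>

definition corner :: "real \<Rightarrow> real \<Rightarrow> real \<Rightarrow> real \<Rightarrow> point2 set" where
  "corner t u \<sigma> \<tau> = connected_component_set (- curve_image P)
     (near t u (\<sigma> * (radius t u / 2)) (\<tau> * (radius t u / 2)))"

definition signs :: "real set" where "signs = {1, -1}"

lemma near_in_corner:
  assumes D: "double_at t u x" and s: "\<sigma> \<in> signs" "\<tau> \<in> signs"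
    and a: "0 < \<sigma> * a" "\<sigma> * a < radius t u" and b: "0 < \<tau> * b" "\<tau> * b < radius t u"
  shows "near t u a b \<in> corner t u \<sigma> \<tau>"
proof -
  define \<rho> where "\<rho> = radius t u"
  define B where "B = {0<..<\<rho>} \<times> {0<..<\<rho>}"
  define f where "f = (\<lambda>(a, b). near t u (\<sigma> * a) (\<tau> * b))"
  have r: "\<rho> > 0" using radius_pos[OF D] by (simp add: \<rho>_def)
  have "connected B" unfolding B_def by (intro connected_Times) auto
  moreover have "continuous_on B f"
    unfolding f_def near_def case_prod_beta by (intro continuous_intros)
  ultimately have "connected (f ` B)" by (rule connected_continuous_image[rotated])
  moreover have "f ` B \<subseteq> - curve_image P"
  proof
    fix z assume "z \<in> f ` B"
    then obtain a b where z: "z = near t u (\<sigma> * a) (\<tau> * b)" "0 < a" "a < \<rho>" "0 < b" "b < \<rho>"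
      unfolding f_def B_def by auto
    then show "z \<in> - curve_image P"
      using near_off_curve[OF D, of "\<sigma> * a" "\<tau> * b"] s by (auto simp: signs_def \<rho>_def)
  qed
  moreover have "near t u (\<sigma> * (\<rho> / 2)) (\<tau> * (\<rho> / 2)) \<in> f ` B"
    unfolding f_def B_def using r by (auto intro!: image_eqI[of _ _ "(\<rho> / 2, \<rho> / 2)"])
  ultimately have sub: "f ` B \<subseteq> corner t u \<sigma> \<tau>"
    unfolding corner_def \<rho>_def[symmetric] by (intro connected_component_maximal)
  have "near t u a b = f (\<sigma> * a, \<tau> * b)" using s by (auto simp: f_def signs_def)
  then show ?thesis using sub a b by (auto simp: B_def \<rho>_def)
qed

lemma corner_component:
  assumes D: "double_at t u x" and s: "\<sigma> \<in> signs" "\<tau> \<in> signs"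
  shows "corner t u \<sigma> \<tau> \<in> components (- curve_image P)"
  unfolding corner_def using near_off_curve[OF D, of "\<sigma> * (radius t u / 2)" "\<tau> * (radius t u / 2)"]
    radius_pos[OF D] s by (intro componentsI) (auto simp: signs_def)

lemma open_region: "R \<in> components (- curve_image P) \<Longrightarrow> open R"
  by (meson compact_curve_image compact_imp_closed open_Compl open_components)

lemma region_eq_corner:
  assumes "double_at t u x" "\<sigma> \<in> signs" "\<tau> \<in> signs"
    "R \<in> components (- curve_image P)" "z \<in> R" "z \<in> corner t u \<sigma> \<tau>"
  shows "R = corner t u \<sigma> \<tau>"
  using assms corner_component components_eq by blast

text \<open>Near \<open>x\<close> everything off the curve lies in one of the four open quadrants,
  so a region that accumulates at \<open>x\<close> contains a point of some quadrant. Conversely,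
  the diagonal of a quadrant tends to \<open>x\<close>.\<close>

lemma frontier_corners:
  assumes D: "double_at t u x" and R: "R \<in> components (- curve_image P)"
  shows "x \<in> frontier R \<longleftrightarrow> (\<exists>\<sigma>\<in>signs. \<exists>\<tau>\<in>signs. R = corner t u \<sigma> \<tau>)"
proof
  have xt: "p t = x" and cr: "cross2 (seg_dir P t) (seg_dir P u) \<noteq> 0"
    using D by (auto simp: double_at_def)
  define \<rho> where "\<rho> = radius t u"
  have r: "\<rho> > 0" using radius_pos[OF D] by (simp add: \<rho>_def)
  assume "x \<in> frontier R"
  then have xc: "x \<in> closure R" by (simp add: frontier_def)
  \<comment> \<open>Cramer coordinates of \<open>z - x\<close> with respect to the two strand
    directions.\<close>
  define A where "A z = cross2 (z - x) (seg_dir P u) / cross2 (seg_dir P t) (seg_dir P u)" for z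
  define B where "B z = cross2 (seg_dir P t) (z - x) / cross2 (seg_dir P t) (seg_dir P u)" for z
  have "continuous_on UNIV A" "continuous_on UNIV B"
    unfolding A_def B_def cross2_def by (intro continuous_intros; use cr in \<open>simp add: cross2_def\<close>)+
  then have "open {z. \<bar>A z\<bar> < \<rho> \<and> \<bar>B z\<bar> < \<rho>}"
    by (intro open_Collect_conj open_Collect_less continuous_intros)
  moreover have "x \<in> {z. \<bar>A z\<bar> < \<rho> \<and> \<bar>B z\<bar> < \<rho>}" using r by (simp add: A_def B_def cross2_def)
  ultimately have "{z. \<bar>A z\<bar> < \<rho> \<and> \<bar>B z\<bar> < \<rho>} \<inter> R \<noteq> {}"
    using xc open_Int_closure_eq_empty by blast
  then obtain z where z: "z \<in> R" "\<bar>A z\<bar> < \<rho>" "\<bar>B z\<bar> < \<rho>" by blast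
  have zn: "z = near t u (A z) (B z)"
    using cross2_expand[OF cr, of "z - x"] by (simp add: near_def A_def B_def xt algebra_simps)
  have zoff: "z \<notin> curve_image P" using z(1) R in_components_subset by blast
  have nz: "A z \<noteq> 0" "B z \<noteq> 0"
  proof -
    have on: "p w \<in> curve_image P" if "0 < w" for w
      using that by (auto simp: curve_image_eq)
    have "near t u (A z) 0 \<in> curve_image P" "near t u 0 (B z) \<in> curve_image P"
      using near_strand[OF D, of "A z"] near_strand[OF D, of "B z"] z
        on[of "t + A z"] on[of "u + B z"] by (auto simp: \<rho>_def)
    then show "A z \<noteq> 0" "B z \<noteq> 0" using zn zoff by metis+
  qed
  define \<sigma> where "\<sigma> = sgn (A z)"
  define \<tau> where "\<tau> = sgn (B z)"
  have s: "\<sigma> \<in> signs" "\<tau> \<in> signs" using nz by (auto simp: signs_def \<sigma>_def \<tau>_def sgn_if)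
  have "z \<in> corner t u \<sigma> \<tau>"
    by (subst zn, rule near_in_corner[OF D s])
      (use z nz in \<open>auto simp: \<sigma>_def \<tau>_def \<rho>_def sgn_if\<close>)
  then show "\<exists>\<sigma>\<in>signs. \<exists>\<tau>\<in>signs. R = corner t u \<sigma> \<tau>"
    using region_eq_corner[OF D s R z(1)] s by blast
next
  have xt: "p t = x" using D by (auto simp: double_at_def)
  define \<rho> where "\<rho> = radius t u"
  have r: "\<rho> > 0" using radius_pos[OF D] by (simp add: \<rho>_def)
  assume "\<exists>\<sigma>\<in>signs. \<exists>\<tau>\<in>signs. R = corner t u \<sigma> \<tau>"
  then obtain \<sigma> \<tau> where s: "\<sigma> \<in> signs" "\<tau> \<in> signs" and RR: "R = corner t u \<sigma> \<tau>" by blast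
  have "((\<lambda>\<epsilon>. near t u (\<sigma> * \<epsilon>) (\<tau> * \<epsilon>)) \<longlongrightarrow> near t u (\<sigma> * 0) (\<tau> * 0)) (at_right 0)"
    unfolding near_def by (intro tendsto_intros)
  then have lim: "((\<lambda>\<epsilon>. near t u (\<sigma> * \<epsilon>) (\<tau> * \<epsilon>)) \<longlongrightarrow> x) (at_right 0)"
    by (simp add: near_def xt)
  have "\<forall>\<^sub>F \<epsilon> in at_right 0. \<epsilon> \<in> {0<..<\<rho>}" using r by (rule eventually_at_right_real)
  then have "\<forall>\<^sub>F \<epsilon> in at_right 0. near t u (\<sigma> * \<epsilon>) (\<tau> * \<epsilon>) \<in> closure R"
  proof eventually_elim
    case (elim \<epsilon>)
    then have "near t u (\<sigma> * \<epsilon>) (\<tau> * \<epsilon>) \<in> corner t u \<sigma> \<tau>"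
      using s by (intro near_in_corner[OF D s]) (auto simp: signs_def \<rho>_def)
    then show ?case using RR closure_subset by blast
  qed
  then have "x \<in> closure R"
    by (rule Lim_in_closed_set[OF closed_closure _ _ lim]) simp
  moreover have "x \<notin> R"
    using in_components_subset[OF R] D by (auto simp: double_at_def curve_image_eq)
  ultimately show "x \<in> frontier R" using open_region[OF R] by (simp add: frontier_def interior_open)
qed

section \<open>Winding numbers of regions and their change around a crossing\<close>

definition region_wind :: "real \<Rightarrow> real \<Rightarrow> real \<Rightarrow> real \<Rightarrow> point2 set \<Rightarrow> real" where
  "region_wind s e s' e' R = wind s e s' e' (SOME z. z \<in> R)"

lemma arcs_subset: "cycle s e s' e' \<Longrightarrow> arcs s e s' e' \<subseteq> curve_image P"
  unfolding arcs_def curve_image_eq cycle_def by auto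

lemma region_wind_eq:
  assumes "cycle s e s' e'" "R \<in> components (- curve_image P)" "z \<in> R"
  shows "region_wind s e s' e' R = wind s e s' e' z"
  unfolding region_wind_def
proof (rule wind_const[OF assms(1)])
  show "connected R" using assms(2) in_components_connected by blast
  show "R \<inter> arcs s e s' e' = {}"
    using in_components_subset[OF assms(2)] arcs_subset[OF assms(1)] by blast
  show "z \<in> R" by (rule assms)
  then show "(SOME z. z \<in> R) \<in> R" by (rule someI)
qed

lemma region_wind_Ints:
  assumes "cycle s e s' e'" "R \<in> components (- curve_image P)"
  shows "region_wind s e s' e' R \<in> \<int>"
proof -
  obtain z where z: "z \<in> R" using in_components_nonempty[OF assms(2)] by blast
  then have "z \<notin> arcs s e s' e'"
    using in_components_subset[OF assms(2)] arcs_subset[OF assms(1)] by blast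
  then show ?thesis using region_wind_eq[OF assms z] wind_Ints[OF assms(1)] by simp
qed

text \<open>An arc of length at most one period has no second parameter congruent to an interior
  \<open>r\<close>. The bound admits the whole curve as an arc.\<close>

definition meets_once :: "real \<Rightarrow> real \<Rightarrow> real \<Rightarrow> real \<Rightarrow> real \<Rightarrow> bool" where
  "meets_once s e s' e' r \<longleftrightarrow> e \<le> s + real n \<and> s < r \<and> r < e \<and> (\<forall>w\<in>{s'..e'}. \<not> same r w)"

definition avoids :: "real \<Rightarrow> real \<Rightarrow> real \<Rightarrow> real \<Rightarrow> real \<Rightarrow> bool" where
  "avoids s e s' e' r \<longleftrightarrow> (\<forall>w\<in>{s..e}. \<not> same r w) \<and> (\<forall>w\<in>{s'..e'}. \<not> same r w)"

lemma simple_at_not_in_arc: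
  assumes "simple_at r" "0 \<le> s" "\<forall>w\<in>{s..e}. \<not> same r w"
  shows "p r \<notin> p ` {s..e}"
proof
  assume "p r \<in> p ` {s..e}"
  then obtain w where "p r = p w" "w \<in> {s..e}" by (rule imageE)
  moreover from this have "same r w" using assms(1,2) by (auto simp: simple_at_def)
  ultimately show False using assms(3) by blast
qed

lemma avoids_arcs:
  assumes "simple_at r" "avoids s e s' e' r" "cycle s e s' e'"
  shows "p r \<notin> arcs s e s' e'"
  using assms simple_at_not_in_arc unfolding arcs_def avoids_def cycle_def by blast

lemma region_wind_jump:
  assumes cyc: "cycle s e s' e'" and r: "simple_at r" "meets_once s e s' e' r"
    and v: "cross2 (seg_dir P r) v \<noteq> 0" and \<rho>: "\<rho> > 0"
    and R: "R1 \<in> components (- curve_image P)" "R2 \<in> components (- curve_image P)"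
    and sides: "\<And>\<epsilon>. 0 < \<epsilon> \<Longrightarrow> \<epsilon> < \<rho> \<Longrightarrow> p r + \<epsilon> *\<^sub>R v \<in> R1"
      "\<And>\<epsilon>. 0 < \<epsilon> \<Longrightarrow> \<epsilon> < \<rho> \<Longrightarrow> p r - \<epsilon> *\<^sub>R v \<in> R2"
  shows "\<bar>region_wind s e s' e' R1 - region_wind s e s' e' R2\<bar> = 1"
proof -
  have s0: "0 \<le> s" "0 \<le> s'" using cyc by (auto simp: cycle_def)
  have off: "p r + \<epsilon> *\<^sub>R v \<notin> arcs s e s' e'" if "\<epsilon> \<noteq> 0" "\<bar>\<epsilon>\<bar> < \<rho>" for \<epsilon>
  proof (cases "\<epsilon> > 0")
    case True
    then show ?thesis
      using sides(1)[of \<epsilon>] that in_components_subset[OF R(1)] arcs_subset[OF cyc] by auto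
  next
    case False
    then show ?thesis
      using sides(2)[of "- \<epsilon>"] that in_components_subset[OF R(2)] arcs_subset[OF cyc] by auto
  qed
  have "\<forall>\<^sub>F \<epsilon> in at 0. p r + \<epsilon> *\<^sub>R v \<notin> arcs s e s' e'"
    unfolding eventually_at using \<rho> off by (intro exI[of _ \<rho>]) auto
  moreover have "p r \<notin> p ` ({s..e} - {r})"
  proof
    assume "p r \<in> p ` ({s..e} - {r})"
    then obtain w where "p r = p w" "w \<in> {s..e} - {r}" by (rule imageE)
    then have w: "w \<in> {s..e}" "w \<noteq> r" "p w = p r" by auto
    then have "same r w" using r(1) s0 by (auto simp: simple_at_def)
    moreover have "\<bar>r - w\<bar> < real n" using w(1) r(2) by (auto simp: meets_once_def abs_less_iff)
    ultimately show False using same_close[of r w] w(2) by blast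
  qed
  moreover have "p r \<notin> p ` {s'..e'}"
    using r s0 by (intro simple_at_not_in_arc) (auto simp: meets_once_def)
  ultimately have "\<forall>\<^sub>F \<epsilon> in at 0. \<bar>wind s e s' e' (p r + \<epsilon> *\<^sub>R v) - wind s e s' e' (p r - \<epsilon> *\<^sub>R v)\<bar> = 1"
    using r v by (intro wind_jump[OF cyc]) (auto simp: meets_once_def simple_at_def)
  then have "\<forall>\<^sub>F \<epsilon> in at_right 0. \<bar>wind s e s' e' (p r + \<epsilon> *\<^sub>R v) - wind s e s' e' (p r - \<epsilon> *\<^sub>R v)\<bar> = 1"
    by (simp add: eventually_at_split)
  moreover have "\<forall>\<^sub>F \<epsilon> in at_right 0. \<epsilon> \<in> {0<..<\<rho>}" using \<rho> by (rule eventually_at_right_real)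
  ultimately have "\<forall>\<^sub>F \<epsilon>::real in at_right 0. \<bar>region_wind s e s' e' R1 - region_wind s e s' e' R2\<bar> = 1"
  proof eventually_elim
    case (elim \<epsilon>)
    then show ?case
      using region_wind_eq[OF cyc R(1) sides(1)[of \<epsilon>]] region_wind_eq[OF cyc R(2) sides(2)[of \<epsilon>]]
      by simp
  qed
  then show ?thesis by simp
qed

text \<open>\<open>z\<close> may lie on the curve as long as the cycle misses it: winding numbers
  are locally constant there, so every region touching \<open>z\<close> inherits its value. Regions
  can thus be evaluated at points of strands outside the cycle.\<close>

lemma region_wind_flat:
  assumes cyc: "cycle s e s' e'" and z: "z \<notin> arcs s e s' e'"
    and R: "R \<in> components (- curve_image P)" "z \<in> closure R"
  shows "region_wind s e s' e' R = wind s e s' e' z"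
proof -
  obtain S where S: "open S" "z \<in> S" "\<forall>y\<in>S. wind s e s' e' y = wind s e s' e' z"
    using wind_locally_const[OF cyc z] unfolding eventually_nhds by blast
  then obtain y where "y \<in> S" "y \<in> R"
    using R(2) open_Int_closure_eq_empty by blast
  then show ?thesis using region_wind_eq[OF cyc R(1)] S by metis
qed

lemma corner_sides:
  assumes D: "double_at t u x" and a: "0 < \<bar>a\<bar>" "\<bar>a\<bar> < radius t u"
    and s: "\<tau> \<in> signs" and \<epsilon>: "0 < \<epsilon>" "\<epsilon> < radius t u"
  shows "p (t + a) + (\<tau> * \<epsilon>) *\<^sub>R seg_dir P u \<in> corner t u (sgn a) \<tau>"
    "p (u + a) + (\<tau> * \<epsilon>) *\<^sub>R seg_dir P t \<in> corner t u \<tau> (sgn a)"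
proof -
  have sa: "sgn a \<in> signs" "0 < sgn a * a" "sgn a * a < radius t u"
    using a by (auto simp: signs_def sgn_if)
  have st: "0 < \<tau> * (\<tau> * \<epsilon>)" "\<tau> * (\<tau> * \<epsilon>) < radius t u" using s \<epsilon> by (auto simp: signs_def)
  have "p (t + a) + (\<tau> * \<epsilon>) *\<^sub>R seg_dir P u = near t u a (\<tau> * \<epsilon>)"
    using near_strand(1)[OF D a(2)] by (simp add: near_def)
  then show "p (t + a) + (\<tau> * \<epsilon>) *\<^sub>R seg_dir P u \<in> corner t u (sgn a) \<tau>"
    using near_in_corner[OF D sa(1) s sa(2,3) st] by simp
  have "p (u + a) + (\<tau> * \<epsilon>) *\<^sub>R seg_dir P t = near t u (\<tau> * \<epsilon>) a"
    using near_strand(2)[OF D a(2)] by (simp add: near_def)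
  then show "p (u + a) + (\<tau> * \<epsilon>) *\<^sub>R seg_dir P t \<in> corner t u \<tau> (sgn a)"
    using near_in_corner[OF D s sa(1) st sa(2,3)] by simp
qed

lemma strand_in_closure_corner:
  assumes D: "double_at t u x" and a: "0 < \<bar>a\<bar>" "\<bar>a\<bar> < radius t u" and s: "\<tau> \<in> signs"
  shows "p (t + a) \<in> closure (corner t u (sgn a) \<tau>)" "p (u + a) \<in> closure (corner t u \<tau> (sgn a))"
proof -
  have lim: "((\<lambda>\<epsilon>. z + (\<tau> * \<epsilon>) *\<^sub>R v) \<longlongrightarrow> z + (\<tau> * 0) *\<^sub>R v) (at_right 0)" for z v :: point2
    by (intro tendsto_intros)
  have ev: "\<forall>\<^sub>F \<epsilon> in at_right 0. \<epsilon> \<in> {0<..<radius t u}"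
    using radius_pos[OF D] by (rule eventually_at_right_real)
  have clo: "z \<in> closure R" if "\<And>\<epsilon>. 0 < \<epsilon> \<Longrightarrow> \<epsilon> < radius t u \<Longrightarrow> z + (\<tau> * \<epsilon>) *\<^sub>R v \<in> R" for z v :: point2 and R
  proof -
    have "\<forall>\<^sub>F \<epsilon> in at_right 0. z + (\<tau> * \<epsilon>) *\<^sub>R v \<in> closure R"
      using ev by eventually_elim (use that closure_subset in force)
    then have "z + (\<tau> * 0) *\<^sub>R v \<in> closure R"
      by (rule Lim_in_closed_set[OF closed_closure _ _ lim[of z v]]) simp
    then show ?thesis by simp
  qed
  show "p (t + a) \<in> closure (corner t u (sgn a) \<tau>)" "p (u + a) \<in> closure (corner t u \<tau> (sgn a))"
    using clo corner_sides[OF D a s] by blast+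
qed

text \<open>The half-strand given by the sign of \<open>a\<close> separates two corners, and the
  cycle runs along it exactly once. The first claim crosses the strand at \<open>t\<close>, the
  second the strand at \<open>u\<close>.\<close>

lemma corner_jump:
  assumes D: "double_at t u x" and cyc: "cycle s e s' e'"
    and a: "0 < \<bar>a\<bar>" "\<bar>a\<bar> < radius t u"
  shows "meets_once s e s' e' (t + a) \<Longrightarrow>
      \<bar>region_wind s e s' e' (corner t u (sgn a) 1) - region_wind s e s' e' (corner t u (sgn a) (-1))\<bar> = 1"
    and "meets_once s e s' e' (u + a) \<Longrightarrow>
      \<bar>region_wind s e s' e' (corner t u 1 (sgn a)) - region_wind s e s' e' (corner t u (-1) (sgn a))\<bar> = 1"
proof -
  have sg: "1 \<in> signs" "-1 \<in> signs" "sgn a \<in> signs" using a by (auto simp: signs_def sgn_if)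
  have cr: "cross2 (seg_dir P t) (seg_dir P u) \<noteq> 0" "cross2 (seg_dir P u) (seg_dir P t) \<noteq> 0"
    using D cross2_commute[of "seg_dir P t"] by (auto simp: double_at_def)
  note comp = corner_component[OF D]
  have a0: "a \<noteq> 0" using a by simp
  show "\<bar>region_wind s e s' e' (corner t u (sgn a) 1) - region_wind s e s' e' (corner t u (sgn a) (-1))\<bar> = 1"
    if "meets_once s e s' e' (t + a)"
    by (rule region_wind_jump[OF cyc simple_near(1)[OF D a(2) a0] that, of "seg_dir P u" "radius t u"])
      (use radius_pos[OF D] comp sg near_strand[OF D a(2)] cr corner_sides(1)[OF D a sg(1)]
         corner_sides(1)[OF D a sg(2)] in auto)
  show "\<bar>region_wind s e s' e' (corner t u 1 (sgn a)) - region_wind s e s' e' (corner t u (-1) (sgn a))\<bar> = 1"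
    if "meets_once s e s' e' (u + a)"
    by (rule region_wind_jump[OF cyc simple_near(2)[OF D a(2) a0] that, of "seg_dir P t" "radius t u"])
      (use radius_pos[OF D] comp sg near_strand[OF D a(2)] cr corner_sides(2)[OF D a sg(1)]
         corner_sides(2)[OF D a sg(2)] in auto)
qed

lemma corner_flat:
  assumes D: "double_at t u x" and cyc: "cycle s e s' e'"
    and a: "0 < \<bar>a\<bar>" "\<bar>a\<bar> < radius t u" and \<tau>: "\<tau> \<in> signs"
  shows "avoids s e s' e' (t + a) \<Longrightarrow>
      region_wind s e s' e' (corner t u (sgn a) \<tau>) = wind s e s' e' (p (t + a))"
    and "avoids s e s' e' (u + a) \<Longrightarrow>
      region_wind s e s' e' (corner t u \<tau> (sgn a)) = wind s e s' e' (p (u + a))"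
proof -
  have sg: "sgn a \<in> signs" using a by (auto simp: signs_def sgn_if)
  have a0: "a \<noteq> 0" using a by simp
  show "region_wind s e s' e' (corner t u (sgn a) \<tau>) = wind s e s' e' (p (t + a))"
    if "avoids s e s' e' (t + a)"
    by (rule region_wind_flat[OF cyc avoids_arcs[OF simple_near(1)[OF D a(2) a0] that cyc]
          corner_component[OF D sg \<tau>] strand_in_closure_corner(1)[OF D a \<tau>]])
  show "region_wind s e s' e' (corner t u \<tau> (sgn a)) = wind s e s' e' (p (u + a))"
    if "avoids s e s' e' (u + a)"
    by (rule region_wind_flat[OF cyc avoids_arcs[OF simple_near(2)[OF D a(2) a0] that cyc]
          corner_component[OF D \<tau> sg] strand_in_closure_corner(2)[OF D a \<tau>]])
qed

end

section \<open>Region changes modulo two\<close>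

text \<open>Symmetric difference with \<open>k\<close> is an involution of the solutions that
  toggles membership of \<open>R\<close>; \<open>k\<close> may depend on \<open>R\<close>. Summing
  the weights in both orders then gives an average of half the total.\<close>

lemma exists_below_average:
  fixes w :: "'a \<Rightarrow> nat"
  assumes V: "finite V" and Sol: "Sol \<subseteq> Pow V" "Sol \<noteq> {}"
    and toggle: "\<And>R. R \<in> V \<Longrightarrow> \<exists>k. R \<in> k \<and> (\<forall>Z\<in>Sol. sym_diff Z k \<in> Sol)"
  shows "\<exists>Z\<in>Sol. 2 * (\<Sum>R\<in>Z. w R) \<le> (\<Sum>R\<in>V. w R)"
proof (rule ccontr)
  assume contra: "\<not> ?thesis"
  have fS: "finite Sol" using V Sol finite_subset by blast
  have half: "2 * card {Z\<in>Sol. R \<in> Z} = card Sol" if R: "R \<in> V" for R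
  proof -
    obtain k where k: "R \<in> k" "\<And>Z. Z \<in> Sol \<Longrightarrow> sym_diff Z k \<in> Sol" using toggle[OF R] by blast
    have "bij_betw (\<lambda>Z. sym_diff Z k) {Z\<in>Sol. R \<in> Z} {Z\<in>Sol. R \<notin> Z}"
      by (rule bij_betwI[where g = "\<lambda>Z. sym_diff Z k"]) (use k in auto)
    then have "card {Z\<in>Sol. R \<in> Z} = card {Z\<in>Sol. R \<notin> Z}" by (rule bij_betw_same_card)
    moreover have "card Sol = card {Z\<in>Sol. R \<in> Z} + card {Z\<in>Sol. R \<notin> Z}"
      using fS by (subst card_Un_disjoint[symmetric]) (auto intro!: arg_cong[where f = card])
    ultimately show ?thesis by simp
  qed
  have "(\<Sum>Z\<in>Sol. \<Sum>R\<in>Z. w R) = (\<Sum>Z\<in>Sol. \<Sum>R\<in>V. if R \<in> Z then w R else 0)"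
  proof (rule sum.cong[OF refl])
    fix Z assume "Z \<in> Sol"
    then have "V \<inter> Z = Z" using Sol by auto
    then show "(\<Sum>R\<in>Z. w R) = (\<Sum>R\<in>V. if R \<in> Z then w R else 0)"
      using sum.inter_restrict[OF V, of w Z] by simp
  qed
  also have "\<dots> = (\<Sum>R\<in>V. \<Sum>Z\<in>Sol. if R \<in> Z then w R else 0)" by (rule sum.swap)
  also have "\<dots> = (\<Sum>R\<in>V. w R * card {Z\<in>Sol. R \<in> Z})"
    using fS by (intro sum.cong) (simp_all add: sum.inter_filter[symmetric])
  finally have "2 * (\<Sum>Z\<in>Sol. \<Sum>R\<in>Z. w R) = (\<Sum>R\<in>V. w R * (2 * card {Z\<in>Sol. R \<in> Z}))"
    by (simp add: sum_distrib_left mult_ac)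
  also have "\<dots> = (\<Sum>R\<in>V. w R * card Sol)"
    by (intro sum.cong) (simp_all add: half)
  also have "\<dots> = (\<Sum>Z\<in>Sol. \<Sum>R\<in>V. w R)" by (simp add: sum_distrib_left mult.commute)
  also have "\<dots> < (\<Sum>Z\<in>Sol. 2 * (\<Sum>R\<in>Z. w R))"
    using contra fS Sol(2) by (intro sum_strict_mono) auto
  finally show False by (simp add: sum_distrib_left)
qed

text \<open>Supplies one offset along a strand that respects finitely many strict bounds at
  once.\<close>

lemma positive_below_finite:
  assumes "finite B" "\<forall>b\<in>B. (0::real) < b"
  obtains a where "0 < a" "\<forall>b\<in>B. a < b"
proof -
  have "\<exists>a>0. \<forall>b\<in>B. a < b" using assms
  proof (induction B)
    case empty
    show ?case by (rule exI[of _ 1]) simp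
  next
    case (insert b B)
    then obtain a where a: "a > 0" "\<forall>b\<in>B. a < b" by auto
    show ?case by (rule exI[of _ "min a (b / 2)"]) (use a insert in \<open>auto simp: min_less_iff_disj\<close>)
  qed
  then show ?thesis using that by blast
qed

lemma odd_card_sym_diff:
  assumes "finite A" "finite B"
  shows "odd (card (sym_diff A B)) \<longleftrightarrow> odd (card A) \<noteq> odd (card B)"
proof -
  have "card (sym_diff A B) = card (A - B) + card (B - A)"
    using assms by (intro card_Un_disjoint) auto
  moreover have "card A = card (A - B) + card (A \<inter> B)"
    using assms by (subst card_Un_disjoint[symmetric]) (auto intro!: arg_cong[where f = card])
  moreover have "card B = card (B - A) + card (A \<inter> B)"
    using assms by (subst card_Un_disjoint[symmetric]) (auto intro!: arg_cong[where f = card])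
  ultimately show ?thesis by auto
qed

text \<open>The grouping fits corners in cyclic order: each of the two pairs is separated by one
  half of the same strand.\<close>

lemma odd_card_Int_4:
  assumes "distinct [a, b, c, d]"
  shows "odd (card (Z \<inter> {a, b, c, d})) \<longleftrightarrow> ((a \<in> Z) \<noteq> (b \<in> Z)) \<noteq> ((c \<in> Z) \<noteq> (d \<in> Z))"
  using assms by (auto simp: Int_insert_right)

context plane_curve
begin

text \<open>Other regions change no crossing and cost nothing. Discarding them leaves a finite set,
  with at most four regions per crossing.\<close>

definition crossing_regions :: "point2 set set" where
  "crossing_regions = {R \<in> components (- curve_image P). \<exists>x\<in>crossings P. x \<in> frontier R}"

definition flipped :: "point2 set set \<Rightarrow> point2 set" where
  "flipped Z = {x \<in> crossings P. odd (card {R \<in> Z. x \<in> frontier R})}"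

lemma flipped_sym_diff:
  assumes "finite Z" "finite Z'"
  shows "flipped (sym_diff Z Z') = sym_diff (flipped Z) (flipped Z')"
proof -
  have "odd (card {R \<in> sym_diff Z Z'. x \<in> frontier R}) \<longleftrightarrow>
    odd (card {R \<in> Z. x \<in> frontier R}) \<noteq> odd (card {R \<in> Z'. x \<in> frontier R})" for x
  proof -
    have eq: "{R \<in> sym_diff Z Z'. x \<in> frontier R} = sym_diff {R \<in> Z. x \<in> frontier R} {R \<in> Z'. x \<in> frontier R}"
      by auto
    show ?thesis unfolding eq by (rule odd_card_sym_diff) (use assms in auto)
  qed
  then show ?thesis unfolding flipped_def by blast
qed

text \<open>Makes parameter 0 available as base point when no particular one is asked for.\<close>

lemma vertex_not_crossing: "p 0 \<notin> crossings P"
proof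
  assume "p 0 \<in> crossings P"
  then obtain t u where *: "preimages P (p 0) = {t, u}" "0 < t" "t < u"
    using crossing_preimages by metis
  have "0 \<in> preimages P (p 0)" using n_pos by (simp add: in_preimages)
  then show False using * by auto
qed

lemma simple_not_crossing:
  assumes "simple_at r"
  shows "p r \<notin> crossings P"
proof
  assume "p r \<in> crossings P"
  then obtain t u where *: "preimages P (p r) = {t, u}" "0 < t" "t < u" "u < real n"
    using crossing_preimages by metis
  have "p t = p r" "p u = p r" using *(1) by (auto simp: in_preimages set_eq_iff)
  then have "same r t" "same r u" using assms * by (auto simp: simple_at_def)
  then have "same t u" using same_sym same_trans by blast
  then show False using same_close[of t u] * by auto
qed

lemma frontier_corners_list:
  assumes "double_at t u x" "R \<in> components (- curve_image P)"
  shows "x \<in> frontier R \<longleftrightarrow>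
    R \<in> {corner t u 1 (-1), corner t u 1 1, corner t u (-1) 1, corner t u (-1) (-1)}"
  using frontier_corners[OF assms] by (auto simp: signs_def)

lemma finite_regions_at:
  assumes "x \<in> crossings P"
  shows "finite {R \<in> components (- curve_image P). x \<in> frontier R}"
    and "card {R \<in> components (- curve_image P). x \<in> frontier R} \<le> 4"
proof -
  obtain t u where D: "double_at t u x"
    using crossing_double_at[OF assms order.refl vertex_not_crossing] by blast
  let ?L = "[corner t u 1 (-1), corner t u 1 1, corner t u (-1) 1, corner t u (-1) (-1)]"
  have sub: "{R \<in> components (- curve_image P). x \<in> frontier R} \<subseteq> set ?L"
    using frontier_corners_list[OF D] by auto
  then show "finite {R \<in> components (- curve_image P). x \<in> frontier R}"
    by (rule finite_subset) simp
  have "card {R \<in> components (- curve_image P). x \<in> frontier R} \<le> card (set ?L)"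
    using sub by (intro card_mono) simp_all
  also have "\<dots> \<le> length ?L" by (rule card_length)
  finally show "card {R \<in> components (- curve_image P). x \<in> frontier R} \<le> 4" by simp
qed

lemma finite_crossing_regions: "finite crossing_regions"
proof -
  have "crossing_regions = (\<Union>x\<in>crossings P. {R \<in> components (- curve_image P). x \<in> frontier R})"
    unfolding crossing_regions_def by auto
  then show ?thesis using finite_crossings finite_regions_at by auto
qed

end

text \<open>Region and base point are tied together: parities measured relative to the base point
  vanish on a region having it in its closure, so the sets built from them leave out
  \<open>R0\<close>.\<close>

locale based_curve = plane_curve +
  fixes \<tau> :: real and R0 :: "point2 set"
  assumes \<tau>_nonneg: "0 \<le> \<tau>"
    and base_simple: "pos P \<tau> \<notin> crossings P"
    and base_region: "R0 \<in> components (- curve_image P)" "pos P \<tau> \<in> closure R0"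
begin

section \<open>Loops at crossings, relative to the base point\<close>

definition params :: "point2 \<Rightarrow> real \<times> real" where
  "params x = (SOME (t, u). double_at t u x \<and> \<tau> < t \<and> u < \<tau> + real n)"

definition lo :: "point2 \<Rightarrow> real" where "lo x = fst (params x)"

definition hi :: "point2 \<Rightarrow> real" where "hi x = snd (params x)"

lemma lo_hi:
  assumes "x \<in> crossings P"
  shows "double_at (lo x) (hi x) x" "\<tau> < lo x" "hi x < \<tau> + real n"
proof -
  obtain t u where "double_at t u x" "\<tau> < t" "u < \<tau> + real n"
    using crossing_double_at[OF assms \<tau>_nonneg base_simple] .
  then have "\<exists>tu. case tu of (t, u) \<Rightarrow> double_at t u x \<and> \<tau> < t \<and> u < \<tau> + real n"
    by (intro exI[of _ "(t, u)"]) simp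
  then have "case params x of (t, u) \<Rightarrow> double_at t u x \<and> \<tau> < t \<and> u < \<tau> + real n"
    unfolding params_def by (rule someI_ex)
  then show "double_at (lo x) (hi x) x" "\<tau> < lo x" "hi x < \<tau> + real n"
    by (auto simp: lo_def hi_def split: prod.splits)
qed

lemma lo_hi_order:
  assumes "x \<in> crossings P"
  shows "0 < lo x" "lo x < hi x" "hi x < lo x + real n" "p (lo x) = x" "p (hi x) = x"
  using lo_hi(1)[OF assms] by (auto simp: double_at_def)

lemma loop_cycle:
  assumes "x \<in> crossings P"
  shows "cycle (lo x) (hi x) (lo x) (lo x)"
  using lo_hi_order[OF assms] by (simp add: cycle_def)

definition loop_wind :: "point2 \<Rightarrow> point2 set \<Rightarrow> real" where
  "loop_wind x R = region_wind (lo x) (hi x) (lo x) (lo x) R"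

definition base_wind :: "point2 \<Rightarrow> real" where
  "base_wind x = wind (lo x) (hi x) (lo x) (lo x) (p \<tau>)"

text \<open>The reference value is taken at the base point and not at infinity, so that the odd
  class never contains \<open>R0\<close>, wherever the base point lies relative to the loop.\<close>

definition in_loop :: "point2 \<Rightarrow> point2 set \<Rightarrow> bool" where
  "in_loop x R \<longleftrightarrow> (\<exists>k::int. loop_wind x R - base_wind x = of_int (2 * k + 1))"

lemma base_not_in_loop_arc:
  assumes "x \<in> crossings P"
  shows "p \<tau> \<notin> arcs (lo x) (hi x) (lo x) (lo x)"
proof
  assume "p \<tau> \<in> arcs (lo x) (hi x) (lo x) (lo x)"
  then obtain w where w: "lo x \<le> w" "w \<le> hi x" "p \<tau> = p w"
    using lo_hi_order(2)[OF assms] unfolding arcs_def by fastforce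
  then have "same \<tau> w"
    using same_if_not_crossing[of \<tau> w] \<tau>_nonneg base_simple lo_hi_order(1)[OF assms] by simp
  then show False using same_close[of \<tau> w] w lo_hi[OF assms] by auto
qed

lemma in_loop_if_jump:
  assumes x: "x \<in> crossings P" and R: "R \<in> components (- curve_image P)" "R' \<in> components (- curve_image P)"
    and "\<bar>loop_wind x R - loop_wind x R'\<bar> = 1"
  shows "in_loop x R \<noteq> in_loop x R'"
proof -
  have "loop_wind x R - base_wind x \<in> \<int>" "loop_wind x R' - base_wind x \<in> \<int>"
    using region_wind_Ints[OF loop_cycle[OF x]] R wind_Ints[OF loop_cycle[OF x] base_not_in_loop_arc[OF x]]
    unfolding loop_wind_def base_wind_def by auto
  then obtain i j :: int where ij: "loop_wind x R - base_wind x = of_int i" "loop_wind x R' - base_wind x = of_int j"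
    by (auto elim!: Ints_cases)
  have "\<bar>of_int (i - j)\<bar> = (1::real)" using assms(4) ij by (simp add: algebra_simps)
  then have "i - j = 1 \<or> i - j = -1" by linarith
  then show ?thesis unfolding in_loop_def ij of_int_eq_iff by presburger
qed

lemma in_loop_if_eq: "loop_wind x R = loop_wind x R' \<Longrightarrow> in_loop x R = in_loop x R'"
  by (simp add: in_loop_def)

lemma not_in_loop_if_base:
  assumes "loop_wind x R = base_wind x"
  shows "\<not> in_loop x R"
proof
  assume "in_loop x R"
  then obtain k :: int where "(0::real) = of_int (2 * k + 1)" using assms by (auto simp: in_loop_def)
  then have "0 = 2 * k + 1" by (metis of_int_0 of_int_eq_iff)
  then show False by presburger
qed

lemma base_region_not_in_loop: "x \<in> crossings P \<Longrightarrow> \<not> in_loop x R0"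
  using region_wind_flat[OF loop_cycle base_not_in_loop_arc base_region]
  by (intro not_in_loop_if_base) (simp add: loop_wind_def base_wind_def)

text \<open>
  The corners around x in cyclic order. The loop leaves x in the first direction and comes back against
  the second, so that q1 is the corner between its two ends.
\<close>

abbreviation q1 where "q1 x \<equiv> corner (lo x) (hi x) 1 (-1)"
abbreviation q2 where "q2 x \<equiv> corner (lo x) (hi x) 1 1"
abbreviation q3 where "q3 x \<equiv> corner (lo x) (hi x) (-1) 1"
abbreviation q4 where "q4 x \<equiv> corner (lo x) (hi x) (-1) (-1)"

lemma signs_mem: "1 \<in> signs" "-1 \<in> signs"
  by (simp_all add: signs_def)

lemma q_components:
  assumes "x \<in> crossings P"
  shows "q1 x \<in> components (- curve_image P)" "q2 x \<in> components (- curve_image P)"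
    "q3 x \<in> components (- curve_image P)" "q4 x \<in> components (- curve_image P)"
  using corner_component[OF lo_hi(1)[OF assms]] signs_mem by blast+

lemma not_same: "x \<noteq> y \<Longrightarrow> \<bar>x - y\<bar> < real n \<Longrightarrow> \<not> same x y"
  using same_close by blast

lemma meets_once_loop:
  assumes "x \<in> crossings P" "lo x < r" "r < hi x"
  shows "meets_once (lo x) (hi x) (lo x) (lo x) r"
  using assms lo_hi_order[OF assms(1)] not_same[of r "lo x"] by (auto simp: meets_once_def)

lemma avoids_loop:
  assumes "x \<in> crossings P" "\<tau> < r" "r < \<tau> + real n" "r < lo x \<or> hi x < r"
  shows "avoids (lo x) (hi x) (lo x) (lo x) r"
proof -
  have "\<not> same r w" if "lo x \<le> w" "w \<le> hi x" for w
    using that assms lo_hi[OF assms(1)] by (intro not_same) auto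
  then show ?thesis using lo_hi_order(2)[OF assms(1)] by (auto simp: avoids_def)
qed

lemma loop_jump:
  assumes y: "y \<in> crossings P" and x: "x \<in> crossings P"
    and a: "0 < \<bar>a\<bar>" "\<bar>a\<bar> < radius (lo y) (hi y)"
  shows "lo x < lo y + a \<Longrightarrow> lo y + a < hi x \<Longrightarrow>
      in_loop x (corner (lo y) (hi y) (sgn a) 1) \<noteq> in_loop x (corner (lo y) (hi y) (sgn a) (-1))"
    and "lo x < hi y + a \<Longrightarrow> hi y + a < hi x \<Longrightarrow>
      in_loop x (corner (lo y) (hi y) 1 (sgn a)) \<noteq> in_loop x (corner (lo y) (hi y) (-1) (sgn a))"
proof -
  note D = lo_hi(1)[OF y]
  have sg: "sgn a \<in> signs" using a by (auto simp: signs_def sgn_if)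
  note comp = corner_component[OF D sg signs_mem(1)] corner_component[OF D sg signs_mem(2)]
    corner_component[OF D signs_mem(1) sg] corner_component[OF D signs_mem(2) sg]
  show "in_loop x (corner (lo y) (hi y) (sgn a) 1) \<noteq> in_loop x (corner (lo y) (hi y) (sgn a) (-1))"
    if "lo x < lo y + a" "lo y + a < hi x"
    using corner_jump(1)[OF D loop_cycle[OF x] a meets_once_loop[OF x that]] comp
    by (intro in_loop_if_jump[OF x]) (auto simp: loop_wind_def)
  show "in_loop x (corner (lo y) (hi y) 1 (sgn a)) \<noteq> in_loop x (corner (lo y) (hi y) (-1) (sgn a))"
    if "lo x < hi y + a" "hi y + a < hi x"
    using corner_jump(2)[OF D loop_cycle[OF x] a meets_once_loop[OF x that]] comp
    by (intro in_loop_if_jump[OF x]) (auto simp: loop_wind_def)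
qed

lemma loop_flat:
  assumes y: "y \<in> crossings P" and x: "x \<in> crossings P"
    and a: "0 < \<bar>a\<bar>" "\<bar>a\<bar> < radius (lo y) (hi y)"
  shows "\<tau> < lo y + a \<Longrightarrow> lo y + a < \<tau> + real n \<Longrightarrow> lo y + a < lo x \<or> hi x < lo y + a \<Longrightarrow>
      in_loop x (corner (lo y) (hi y) (sgn a) 1) = in_loop x (corner (lo y) (hi y) (sgn a) (-1))"
    and "\<tau> < hi y + a \<Longrightarrow> hi y + a < \<tau> + real n \<Longrightarrow> hi y + a < lo x \<or> hi x < hi y + a \<Longrightarrow>
      in_loop x (corner (lo y) (hi y) 1 (sgn a)) = in_loop x (corner (lo y) (hi y) (-1) (sgn a))"
proof -
  note D = lo_hi(1)[OF y]
  show "in_loop x (corner (lo y) (hi y) (sgn a) 1) = in_loop x (corner (lo y) (hi y) (sgn a) (-1))"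
    if "\<tau> < lo y + a" "lo y + a < \<tau> + real n" "lo y + a < lo x \<or> hi x < lo y + a"
    using corner_flat(1)[OF D loop_cycle[OF x] a _ avoids_loop[OF x that]] signs_mem
    by (intro in_loop_if_eq) (simp add: loop_wind_def)
  show "in_loop x (corner (lo y) (hi y) 1 (sgn a)) = in_loop x (corner (lo y) (hi y) (-1) (sgn a))"
    if "\<tau> < hi y + a" "hi y + a < \<tau> + real n" "hi y + a < lo x \<or> hi x < hi y + a"
    using corner_flat(2)[OF D loop_cycle[OF x] a _ avoids_loop[OF x that]] signs_mem
    by (intro in_loop_if_eq) (simp add: loop_wind_def)
qed

lemma loop_at_own_crossing:
  assumes x: "x \<in> crossings P"
  shows "in_loop x (q1 x) \<noteq> in_loop x (q2 x)" "in_loop x (q2 x) = in_loop x (q3 x)"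
    "in_loop x (q3 x) = in_loop x (q4 x)"
proof -
  note o = lo_hi_order[OF x] and l = lo_hi[OF x]
  obtain a where a: "0 < a" "\<forall>b\<in>{radius (lo x) (hi x), hi x - lo x, lo x - \<tau>, \<tau> + real n - hi x}. a < b"
    by (rule positive_below_finite[of "{radius (lo x) (hi x), hi x - lo x, lo x - \<tau>, \<tau> + real n - hi x}"])
      (use o l radius_pos[OF l(1)] in auto)
  then have ab: "a < radius (lo x) (hi x)" "a < hi x - lo x" "a < lo x - \<tau>" "a < \<tau> + real n - hi x"
    by auto
  have a': "0 < \<bar>a\<bar>" "\<bar>a\<bar> < radius (lo x) (hi x)" "0 < \<bar>-a\<bar>" "\<bar>-a\<bar> < radius (lo x) (hi x)"
    using a(1) ab by auto
  show "in_loop x (q1 x) \<noteq> in_loop x (q2 x)"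
    using loop_jump(1)[OF x x a'(1,2)] a(1) ab by auto
  show "in_loop x (q2 x) = in_loop x (q3 x)"
    using loop_flat(2)[OF x x a'(1,2)] a(1) ab o l by auto
  show "in_loop x (q3 x) = in_loop x (q4 x)"
    using loop_flat(1)[OF x x a'(3,4)] a(1) ab o l by auto
qed

text \<open>The passage at \<open>lo y\<close> runs straight through \<open>y\<close>, so both of
  its halves lie on the loop or both lie off it. One separates \<open>q1\<close> from
  \<open>q2\<close>, the other \<open>q3\<close> from \<open>q4\<close>.\<close>

lemma loop_at_other_crossing:
  assumes x: "x \<in> crossings P" and y: "y \<in> crossings P" and "x \<noteq> y"
  shows "(in_loop x (q1 y) \<noteq> in_loop x (q2 y)) = (in_loop x (q3 y) \<noteq> in_loop x (q4 y))"
proof -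
  note o = lo_hi_order[OF x] and l = lo_hi[OF x] and o' = lo_hi_order[OF y] and l' = lo_hi[OF y]
  have ne: "lo y \<noteq> lo x" "lo y \<noteq> hi x" using o o' \<open>x \<noteq> y\<close> by metis+
  define B where "B = {radius (lo y) (hi y), lo y - \<tau>, \<tau> + real n - lo y, \<bar>lo y - lo x\<bar>, \<bar>lo y - hi x\<bar>}"
  obtain a where a: "0 < a" "\<forall>b\<in>B. a < b"
    by (rule positive_below_finite[of B]) (use o' l' radius_pos[OF l'(1)] ne in \<open>auto simp: B_def\<close>)
  then have ab: "a < radius (lo y) (hi y)" "a < lo y - \<tau>" "a < \<tau> + real n - lo y"
    "a < \<bar>lo y - lo x\<bar>" "a < \<bar>lo y - hi x\<bar>"
    by (auto simp: B_def)
  have a': "0 < \<bar>a\<bar>" "\<bar>a\<bar> < radius (lo y) (hi y)" "0 < \<bar>-a\<bar>" "\<bar>-a\<bar> < radius (lo y) (hi y)"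
    using a(1) ab by auto
  have sg: "sgn a = 1" "sgn (- a) = -1" using a by auto
  show ?thesis
  proof (cases "lo x < lo y \<and> lo y < hi x")
    case True
    then have "lo x < lo y + a" "lo y + a < hi x" "lo x < lo y + - a" "lo y + - a < hi x"
      using a(1) ab by auto
    then have "in_loop x (q2 y) \<noteq> in_loop x (q1 y)" "in_loop x (q3 y) \<noteq> in_loop x (q4 y)"
      using loop_jump(1)[OF y x a'(1,2), unfolded sg] loop_jump(1)[OF y x a'(3,4), unfolded sg]
      by blast+
    then show ?thesis by blast
  next
    case False
    then have "\<tau> < lo y + a" "lo y + a < \<tau> + real n" "lo y + a < lo x \<or> hi x < lo y + a"
      "\<tau> < lo y + - a" "lo y + - a < \<tau> + real n" "lo y + - a < lo x \<or> hi x < lo y + - a"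
      using a(1) ab ne by auto
    then have "in_loop x (q2 y) = in_loop x (q1 y)" "in_loop x (q3 y) = in_loop x (q4 y)"
      using loop_flat(1)[OF y x a'(1,2), unfolded sg] loop_flat(1)[OF y x a'(3,4), unfolded sg]
      by blast+
    then show ?thesis by blast
  qed
qed

text \<open>\<open>q1\<close> is singled out by the loop parity at \<open>x\<close>. The other two
  inequalities use the whole curve as a cycle, which traverses every half-strand exactly once. Only
  \<open>q2\<close> and \<open>q4\<close> may still coincide.\<close>

lemma adjacent_corners_distinct:
  assumes x: "x \<in> crossings P"
  shows "q1 x \<noteq> q2 x" "q1 x \<noteq> q3 x" "q1 x \<noteq> q4 x" "q2 x \<noteq> q3 x" "q3 x \<noteq> q4 x"
proof -
  note o = lo_hi_order[OF x] and l = lo_hi[OF x]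
  show "q1 x \<noteq> q2 x" "q1 x \<noteq> q3 x" "q1 x \<noteq> q4 x"
    using loop_at_own_crossing[OF x] by metis+
  have cyc: "cycle \<tau> (\<tau> + real n) \<tau> \<tau>"
    using \<tau>_nonneg p_same[OF same_add_n[of \<tau>]] by (auto simp: cycle_def)
  have once: "meets_once \<tau> (\<tau> + real n) \<tau> \<tau> r" if "\<tau> < r" "r < \<tau> + real n" for r
    using that not_same[of r \<tau>] by (auto simp: meets_once_def)
  define B where "B = {radius (lo x) (hi x), lo x - \<tau>, \<tau> + real n - hi x}"
  obtain a where a: "0 < a" "\<forall>b\<in>B. a < b"
    by (rule positive_below_finite[of B]) (use o l radius_pos[OF l(1)] in \<open>auto simp: B_def\<close>)
  then have ab: "a < radius (lo x) (hi x)" "a < lo x - \<tau>" "a < \<tau> + real n - hi x"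
    by (auto simp: B_def)
  have a': "0 < \<bar>a\<bar>" "\<bar>a\<bar> < radius (lo x) (hi x)" "0 < \<bar>-a\<bar>" "\<bar>-a\<bar> < radius (lo x) (hi x)"
    using a(1) ab by auto
  have sg: "sgn a = 1" "sgn (- a) = -1" using a by auto
  show "q2 x \<noteq> q3 x"
    using corner_jump(2)[OF l(1) cyc a'(1,2) once, unfolded sg] a ab o l by auto
  show "q3 x \<noteq> q4 x"
    using corner_jump(1)[OF l(1) cyc a'(3,4) once, unfolded sg] a ab o l by auto
qed

text \<open>The one coincidence left open by \<open>adjacent_corners_distinct\<close>. It is the
  classical notion: a closed curve through \<open>x\<close> that otherwise stays in this region
  meets the diagram only in \<open>x\<close>.\<close>

definition nugatory :: "point2 \<Rightarrow> bool" where
  "nugatory x \<longleftrightarrow> q2 x = q4 x"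

text \<open>
  A second common point of the two loops would give a cycle which runs along one loop from x to
  that point and back along the other; exactly one of its ends at x separates q2 from q4.
\<close>

lemma nugatory_loops_disjoint:
  assumes x: "x \<in> crossings P" and nug: "nugatory x"
    and r: "lo x < r" "r < hi x" and r': "hi x < r'" "r' < lo x + real n"
  shows "p r \<noteq> p r'"
proof
  assume eq: "p r = p r'"
  note o = lo_hi_order[OF x] and l = lo_hi[OF x]
  have cyc: "cycle (lo x) r (hi x) r'"
    using o r r' eq by (auto simp: cycle_def)
  define B where "B = {radius (lo x) (hi x), r - lo x, hi x - r}"
  obtain a where a: "0 < a" "\<forall>b\<in>B. a < b"
    by (rule positive_below_finite[of B]) (use o l r radius_pos[OF l(1)] in \<open>auto simp: B_def\<close>)
  then have ab: "a < radius (lo x) (hi x)" "a < r - lo x" "a < hi x - r"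
    by (auto simp: B_def)
  have a': "0 < \<bar>a\<bar>" "\<bar>a\<bar> < radius (lo x) (hi x)" "0 < \<bar>-a\<bar>" "\<bar>-a\<bar> < radius (lo x) (hi x)"
    using a(1) ab by auto
  have sg: "sgn a = 1" "sgn (- a) = -1" using a by auto
  let ?W = "region_wind (lo x) r (hi x) r'"
  have "\<not> same (lo x + a) w" if "w \<in> {hi x..r'}" for w
    using that a ab o r r' by (intro not_same) auto
  then have "meets_once (lo x) r (hi x) r' (lo x + a)"
    using a ab o r by (auto simp: meets_once_def)
  then have 1: "\<bar>?W (q2 x) - ?W (q1 x)\<bar> = 1"
    using corner_jump(1)[OF l(1) cyc a'(1,2), unfolded sg] by blast
  have "\<not> same (hi x + - a) w" if "w \<in> {lo x..r} \<or> w \<in> {hi x..r'}" for w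
    using that a ab o r r' by (intro not_same) auto
  then have "avoids (lo x) r (hi x) r' (hi x + - a)" by (auto simp: avoids_def)
  then have "?W (q1 x) = ?W (q4 x)"
    using corner_flat(2)[OF l(1) cyc a'(3,4), unfolded sg] signs_mem by metis
  then show False using 1 nug by (simp add: nugatory_def)
qed

text \<open>The rest of the curve, strictly between \<open>hi x\<close> and
  \<open>lo x + real n\<close>, is connected, misses the loop and passes the base point as
  \<open>\<tau> + real n\<close>; the winding number is therefore constant along it.\<close>

lemma nugatory_outside_wind:
  assumes x: "x \<in> crossings P" and nug: "nugatory x"
    and w: "hi x < w" "w < lo x + real n"
  shows "p w \<notin> arcs (lo x) (hi x) (lo x) (lo x)"
    "wind (lo x) (hi x) (lo x) (lo x) (p w) = base_wind x"
proof -
  note o = lo_hi_order[OF x] and l = lo_hi[OF x]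
  have disj: "p w \<notin> arcs (lo x) (hi x) (lo x) (lo x)" if w: "hi x < w" "w < lo x + real n" for w
  proof
    assume "p w \<in> arcs (lo x) (hi x) (lo x) (lo x)"
    then obtain v where v: "lo x \<le> v" "v \<le> hi x" "p w = p v"
      using o(2) unfolding arcs_def by fastforce
    have "v = lo x \<or> v = hi x"
      using nugatory_loops_disjoint[OF x nug _ _ w, of v] v by force
    then have "p w = x" using v o by auto
    then have "same (lo x) w \<or> same (hi x) w"
      using l(1) w o by (auto simp: double_at_def)
    then show False using w o same_close[of "lo x" w] same_close[of "hi x" w] by auto
  qed
  show "p w \<notin> arcs (lo x) (hi x) (lo x) (lo x)" using disj w .
  let ?B = "p ` {hi x<..<lo x + real n}"
  have "connected ?B"
    using o by (intro connected_continuous_image continuous_on_p) auto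
  moreover have "?B \<inter> arcs (lo x) (hi x) (lo x) (lo x) = {}" using disj by auto
  moreover have "p w \<in> ?B" using w by auto
  moreover have "p (\<tau> + real n) \<in> ?B" using l by auto
  ultimately have "wind (lo x) (hi x) (lo x) (lo x) (p w) = wind (lo x) (hi x) (lo x) (lo x) (p (\<tau> + real n))"
    using wind_const[OF loop_cycle[OF x]] by blast
  also have "p (\<tau> + real n) = p \<tau>" using p_same[OF same_add_n[of \<tau>]] \<tau>_nonneg by simp
  finally show "wind (lo x) (hi x) (lo x) (lo x) (p w) = base_wind x" by (simp add: base_wind_def)
qed

text \<open>A crossing not nested strictly inside the loop has a passage on the complementary arc,
  possibly only after adding one period. So \<open>y\<close> is off the loop, and all regions
  touching it take the base value.\<close>

lemma nugatory_outside_crossing: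
  assumes x: "x \<in> crossings P" and nug: "nugatory x"
    and y: "y \<in> crossings P" "y \<noteq> x" and out: "\<not> (lo x < lo y \<and> hi y < hi x)"
    and R: "R \<in> components (- curve_image P)" "y \<in> frontier R"
  shows "\<not> in_loop x R"
proof -
  note o = lo_hi_order[OF x] and l = lo_hi[OF x] and o' = lo_hi_order[OF y(1)] and l' = lo_hi[OF y(1)]
  have "\<exists>w. hi x < w \<and> w < lo x + real n \<and> p w = y"
  proof (cases "lo x < lo y")
    case True
    then have "hi x \<le> hi y" using out by auto
    moreover have "hi x \<noteq> hi y" using o o' y(2) by metis
    ultimately show ?thesis using l l' o' by (intro exI[of _ "hi y"]) auto
  next
    case False
    moreover have "lo x \<noteq> lo y" using o o' y(2) by metis
    ultimately have "lo y < lo x" by auto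
    moreover have "p (lo y + real n) = p (lo y)"
      using p_same[OF same_add_n[of "lo y"]] o' by simp
    ultimately show ?thesis using l l' o' by (intro exI[of _ "lo y + real n"]) auto
  qed
  then obtain w where w: "hi x < w" "w < lo x + real n" "p w = y" by blast
  have "y \<in> closure R" using R(2) by (simp add: frontier_def)
  then have "loop_wind x R = base_wind x"
    using region_wind_flat[OF loop_cycle[OF x] _ R(1), of y] nugatory_outside_wind[OF x nug w(1,2)] w(3)
    by (simp add: loop_wind_def)
  then show ?thesis by (rule not_in_loop_if_base)
qed

lemma nugatory_own_corners:
  assumes x: "x \<in> crossings P" and nug: "nugatory x"
  shows "in_loop x (q1 x)" "\<not> in_loop x (q2 x)" "\<not> in_loop x (q3 x)" "\<not> in_loop x (q4 x)"
proof -
  note o = lo_hi_order[OF x] and l = lo_hi[OF x]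
  define B where "B = {radius (lo x) (hi x), lo x - \<tau>, \<tau> + real n - hi x}"
  obtain a where a: "0 < a" "\<forall>b\<in>B. a < b"
    by (rule positive_below_finite[of B]) (use o l radius_pos[OF l(1)] in \<open>auto simp: B_def\<close>)
  then have ab: "a < radius (lo x) (hi x)" "a < lo x - \<tau>" "a < \<tau> + real n - hi x"
    by (auto simp: B_def)
  have a': "0 < \<bar>a\<bar>" "\<bar>a\<bar> < radius (lo x) (hi x)" using a(1) ab by auto
  have sg: "sgn a = 1" using a by auto
  \<comment> \<open>Just after \<open>hi x\<close> the curve is on the complementary arc, and this
    half-strand borders \<open>q2\<close>.\<close>
  have "avoids (lo x) (hi x) (lo x) (lo x) (hi x + a)"
    using a ab o l by (intro avoids_loop[OF x]) auto
  then have "loop_wind x (q2 x) = wind (lo x) (hi x) (lo x) (lo x) (p (hi x + a))"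
    using corner_flat(2)[OF l(1) loop_cycle[OF x] a', unfolded sg] signs_mem
    by (simp add: loop_wind_def)
  also have "\<dots> = base_wind x"
    using a ab l by (intro nugatory_outside_wind[OF x nug]) auto
  finally show "\<not> in_loop x (q2 x)" by (rule not_in_loop_if_base)
  then show "in_loop x (q1 x)" "\<not> in_loop x (q3 x)" "\<not> in_loop x (q4 x)"
    using loop_at_own_crossing[OF x] by auto
qed

section \<open>Solving for the crossings to be changed\<close>

definition loop_regions :: "point2 \<Rightarrow> point2 set set" where
  "loop_regions x = {R \<in> crossing_regions. in_loop x R}"

lemma regions_at_crossing:
  assumes "x \<in> crossings P" "Z \<subseteq> crossing_regions"
  shows "{R \<in> Z. x \<in> frontier R} = Z \<inter> {q1 x, q2 x, q3 x, q4 x}"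
  using frontier_corners_list[OF lo_hi(1)[OF assms(1)]] assms(2) by (auto simp: crossing_regions_def)

lemma q_crossing_regions:
  assumes "x \<in> crossings P" "R \<in> {q1 x, q2 x, q3 x, q4 x}"
  shows "R \<in> crossing_regions" "x \<in> frontier R"
proof -
  have "R \<in> components (- curve_image P)" using assms(2) q_components[OF assms(1)] by auto
  moreover from this show "x \<in> frontier R"
    using frontier_corners_list[OF lo_hi(1)[OF assms(1)], of R] assms(2) by auto
  ultimately show "R \<in> crossing_regions" using assms(1) unfolding crossing_regions_def by blast
qed

lemma in_loop_regions: "x \<in> crossings P \<Longrightarrow> R \<in> {q1 x, q2 x, q3 x, q4 x} \<Longrightarrow>
    R \<in> loop_regions y \<longleftrightarrow> in_loop y R"
  using q_crossing_regions(1) unfolding loop_regions_def by blast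

lemma distinct_corners:
  assumes "x \<in> crossings P" "\<not> nugatory x"
  shows "distinct [q1 x, q2 x, q3 x, q4 x]"
  using adjacent_corners_distinct[OF assms(1)] assms(2) by (simp add: nugatory_def)

lemma loop_regions_subset: "loop_regions x \<subseteq> crossing_regions"
  by (auto simp: loop_regions_def)

text \<open>At four distinct corners the parity is the sum of the changes across the two halves of
  one strand. These agree by \<open>loop_at_other_crossing\<close> and cancel modulo 2.\<close>

lemma flipped_loop_others:
  assumes x: "x \<in> crossings P" and y: "y \<in> flipped (loop_regions x)" "y \<noteq> x"
  shows "nugatory y"
proof (rule ccontr)
  assume nn: "\<not> nugatory y"
  have yc: "y \<in> crossings P" using y(1) by (simp add: flipped_def)
  have "odd (card (loop_regions x \<inter> {q1 y, q2 y, q3 y, q4 y}))"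
    using y(1) regions_at_crossing[OF yc loop_regions_subset] by (simp add: flipped_def)
  then show False
    using loop_at_other_crossing[OF x yc] y(2) in_loop_regions[OF yc]
    unfolding odd_card_Int_4[OF distinct_corners[OF yc nn]] by auto
qed

text \<open>Of four distinct corners exactly one or three are selected. At a nugatory crossing
  \<open>q1\<close> alone is, since the doubled region \<open>q2 x = q4 x\<close> stays out together
  with \<open>q3\<close>.\<close>

lemma flipped_loop_self:
  assumes x: "x \<in> crossings P"
  shows "x \<in> flipped (loop_regions x)"
proof (cases "nugatory x")
  case True
  have "loop_regions x \<inter> {q1 x, q2 x, q3 x, q4 x} = {q1 x}"
    using nugatory_own_corners[OF x True] in_loop_regions[OF x] by auto
  then show ?thesis
    using x regions_at_crossing[OF x loop_regions_subset[of x]] by (simp add: flipped_def)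
next
  case False
  have "odd (card (loop_regions x \<inter> {q1 x, q2 x, q3 x, q4 x}))"
    using loop_at_own_crossing[OF x] in_loop_regions[OF x]
    unfolding odd_card_Int_4[OF distinct_corners[OF x False]] by auto
  then show ?thesis
    using x regions_at_crossing[OF x loop_regions_subset[of x]] by (simp add: flipped_def)
qed

lemma flipped_nugatory_loop:
  assumes x: "x \<in> crossings P" and nug: "nugatory x" and y: "y \<in> flipped (loop_regions x)" "y \<noteq> x"
  shows "lo x < lo y \<and> hi y < hi x"
proof (rule ccontr)
  assume out: "\<not> (lo x < lo y \<and> hi y < hi x)"
  have yc: "y \<in> crossings P" using y(1) by (simp add: flipped_def)
  have none: "{R \<in> loop_regions x. y \<in> frontier R} = {}"
    using nugatory_outside_crossing[OF x nug yc y(2) out]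
    by (auto simp: loop_regions_def crossing_regions_def)
  have "y \<notin> flipped (loop_regions x)" unfolding flipped_def mem_Collect_eq none by simp
  then show False using y(1) by contradiction
qed

definition achievable :: "point2 set \<Rightarrow> bool" where
  "achievable b \<longleftrightarrow> (\<exists>Z \<subseteq> crossing_regions. R0 \<notin> Z \<and> flipped Z = b)"

lemma achievable_sym_diff:
  assumes "achievable b" "achievable c"
  shows "achievable (sym_diff b c)"
proof -
  obtain Z Z' where Z: "Z \<subseteq> crossing_regions" "R0 \<notin> Z" "flipped Z = b"
    and Z': "Z' \<subseteq> crossing_regions" "R0 \<notin> Z'" "flipped Z' = c"
    using assms by (auto simp: achievable_def)
  have "flipped (sym_diff Z Z') = sym_diff b c"
    using flipped_sym_diff[of Z Z'] Z Z' finite_crossing_regions finite_subset by metis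
  moreover have "sym_diff Z Z' \<subseteq> crossing_regions" "R0 \<notin> sym_diff Z Z'" using Z Z' by auto
  ultimately show ?thesis unfolding achievable_def by blast
qed

lemma achievable_empty: "achievable {}"
  unfolding achievable_def by (rule exI[of _ "{}"]) (simp add: flipped_def)

lemma achievable_union:
  assumes "finite b" "\<And>y. y \<in> b \<Longrightarrow> achievable {y}"
  shows "achievable b"
  using assms
proof (induction b)
  case empty
  show ?case by (rule achievable_empty)
next
  case (insert y b)
  then have "achievable (sym_diff {y} b)" by (intro achievable_sym_diff) auto
  moreover have "sym_diff {y} b = insert y b" using insert by auto
  ultimately show ?case by simp
qed

lemma achievable_loop: "x \<in> crossings P \<Longrightarrow> achievable (flipped (loop_regions x))"
  unfolding achievable_def using loop_regions_subset base_region_not_in_loop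
  by (intro exI[of _ "loop_regions x"]) (auto simp: loop_regions_def)

text \<open>One elimination step: the loop pattern contains \<open>x\<close>, and every other
  crossing in it is corrected by a set already known.\<close>

lemma achievable_from_loop:
  assumes x: "x \<in> crossings P" and rest: "\<And>y. y \<in> flipped (loop_regions x) \<Longrightarrow> y \<noteq> x \<Longrightarrow> achievable {y}"
  shows "achievable {x}"
proof -
  have "finite (flipped (loop_regions x) - {x})"
    using finite_crossings by (auto simp: flipped_def)
  then have "achievable (flipped (loop_regions x) - {x})"
    by (rule achievable_union) (use rest in blast)
  then have "achievable (sym_diff (flipped (loop_regions x)) (flipped (loop_regions x) - {x}))"
    by (intro achievable_sym_diff achievable_loop x)
  moreover have "sym_diff (flipped (loop_regions x)) (flipped (loop_regions x) - {x}) = {x}"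
    using flipped_loop_self[OF x] by auto
  ultimately show ?thesis by simp
qed

text \<open>Unwanted flips lie strictly inside the loop of \<open>x\<close> and are nugatory again,
  so their loops are nested in it. The measure drops because \<open>y\<close> itself is counted for
  \<open>x\<close> but not for \<open>y\<close>.\<close>

lemma achievable_nugatory:
  assumes "x \<in> crossings P" "nugatory x"
  shows "achievable {x}"
  using assms
proof (induction "card {y \<in> crossings P. lo x < lo y \<and> hi y < hi x}" arbitrary: x rule: less_induct)
  case less
  show ?case
  proof (rule achievable_from_loop[OF less.prems(1)])
    fix y assume y: "y \<in> flipped (loop_regions x)" "y \<noteq> x"
    have yc: "y \<in> crossings P" using y(1) by (simp add: flipped_def)
    have nest: "lo x < lo y" "hi y < hi x" using flipped_nugatory_loop[OF less.prems y] by auto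
    have "{z \<in> crossings P. lo y < lo z \<and> hi z < hi y} \<subset> {z \<in> crossings P. lo x < lo z \<and> hi z < hi x}"
      using nest yc by auto
    then have "card {z \<in> crossings P. lo y < lo z \<and> hi z < hi y} < card {z \<in> crossings P. lo x < lo z \<and> hi z < hi x}"
      using finite_crossings by (intro psubset_card_mono) auto
    then show "achievable {y}"
      using less.hyps yc flipped_loop_others[OF less.prems(1) y] by blast
  qed
qed

lemma achievable_all:
  assumes "b \<subseteq> crossings P"
  shows "achievable b"
proof (rule achievable_union)
  show "finite b" using assms finite_crossings finite_subset by blast
  fix x assume "x \<in> b"
  then have x: "x \<in> crossings P" using assms by auto
  \<comment> \<open>Apart from \<open>x\<close>, the pattern of any loop contains only nugatory
    crossings, which are already settled.\<close>
  show "achievable {x}"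
    using achievable_from_loop[OF x] achievable_nugatory flipped_loop_others[OF x]
    by (auto simp: flipped_def)
qed

text \<open>The effect of all regions together is reproduced by a set without \<open>R0\<close>; the
  symmetric difference of the two has no effect and contains \<open>R0\<close>.\<close>

lemma kernel_element:
  assumes "R0 \<in> crossing_regions"
  obtains k where "k \<subseteq> crossing_regions" "R0 \<in> k" "flipped k = {}"
proof -
  obtain Z where Z: "Z \<subseteq> crossing_regions" "R0 \<notin> Z" "flipped Z = flipped crossing_regions"
    using achievable_all[of "flipped crossing_regions"] by (auto simp: achievable_def flipped_def)
  have "flipped (sym_diff crossing_regions Z) = {}"
    using flipped_sym_diff[of crossing_regions Z] Z finite_crossing_regions finite_subset by blast
  then show ?thesis using that[of "sym_diff crossing_regions Z"] Z assms by blast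
qed

end

context plane_curve
begin

text \<open>Such a region has a corner at some crossing, and a point a little way along the
  half-strand bounding that corner is no crossing and lies in the closure of the region.\<close>

lemma region_has_base:
  assumes "R \<in> crossing_regions"
  obtains \<tau> where "based_curve P \<tau> R"
proof -
  obtain x where x: "x \<in> crossings P" "x \<in> frontier R" and R: "R \<in> components (- curve_image P)"
    using assms by (auto simp: crossing_regions_def)
  obtain t u where D: "double_at t u x"
    using crossing_double_at[OF x(1) order.refl vertex_not_crossing] by blast
  obtain \<sigma> s where s: "\<sigma> \<in> signs" "s \<in> signs" "R = corner t u \<sigma> s"
    using frontier_corners[OF D R] x by blast
  define a where "a = \<sigma> * (radius t u / 2)"
  have a: "0 < \<bar>a\<bar>" "\<bar>a\<bar> < radius t u" "sgn a = \<sigma>"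
    using radius_pos[OF D] s by (auto simp: a_def signs_def)
  have "p (t + a) \<in> closure R" using strand_in_closure_corner(1)[OF D a(1,2) s(2)] s(3) a(3) by simp
  moreover have "p (t + a) \<notin> crossings P"
    using simple_near(1)[OF D a(2)] a(1) by (intro simple_not_crossing) auto
  moreover have "0 \<le> t + a" using near_strand(5)[OF D a(2)] by simp
  ultimately have "based_curve P (t + a) R" using R by unfold_locales auto
  then show ?thesis by (rule that)
qed

lemma sum_region_crossings:
  "(\<Sum>R\<in>crossing_regions. card {x \<in> crossings P. x \<in> frontier R}) \<le> 4 * card (crossings P)"
proof -
  have "(\<Sum>R\<in>crossing_regions. card {x \<in> crossings P. x \<in> frontier R})
      = (\<Sum>x\<in>crossings P. card {R \<in> crossing_regions. x \<in> frontier R})"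
    using finite_crossing_regions finite_crossings by (intro sum_multicount_gen) auto
  also have "\<dots> \<le> (\<Sum>x\<in>crossings P. 4)"
  proof (rule sum_mono)
    fix x assume x: "x \<in> crossings P"
    have "card {R \<in> crossing_regions. x \<in> frontier R} \<le> card {R \<in> components (- curve_image P). x \<in> frontier R}"
      using finite_regions_at[OF x] by (intro card_mono) (auto simp: crossing_regions_def)
    then show "card {R \<in> crossing_regions. x \<in> frontier R} \<le> 4"
      using finite_regions_at(2)[OF x] by simp
  qed
  finally show ?thesis by simp
qed

lemma cheap_region_set:
  assumes b: "b \<subseteq> crossings P"
  obtains Z where "Z \<subseteq> components (- curve_image P)" "finite Z" "flipped Z = b"
    "(\<Sum>R\<in>Z. card {x \<in> crossings P. x \<in> frontier R}) \<le> 2 * card (crossings P)"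
proof -
  define Sol where "Sol = {Z. Z \<subseteq> crossing_regions \<and> flipped Z = b}"
  have fin: "finite Z" if "Z \<subseteq> crossing_regions" for Z
    using that finite_crossing_regions finite_subset by blast
  have toggle: "\<exists>k. R \<in> k \<and> (\<forall>Z\<in>Sol. sym_diff Z k \<in> Sol)" if R: "R \<in> crossing_regions" for R
  proof -
    \<comment> \<open>Each region is toggled with a base point of its own; \<open>Sol\<close> itself
      does not depend on the base point.\<close>
    obtain \<tau> where "based_curve P \<tau> R" using region_has_base[OF R] .
    then interpret based_curve P \<tau> R .
    obtain k where k: "k \<subseteq> crossing_regions" "R \<in> k" "flipped k = {}" using kernel_element[OF R] .
    have "sym_diff Z k \<in> Sol" if "Z \<in> Sol" for Z
      using that k flipped_sym_diff[OF fin fin, of Z k] by (auto simp: Sol_def)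
    then show ?thesis using k by blast
  qed
  have "Sol \<noteq> {}"
  proof (cases "crossings P = {}")
    \<comment> \<open>Without crossings there is no corner from which to take a base point, but the
      empty set already solves the system.\<close>
    case True
    then have "{} \<in> Sol" using b by (auto simp: Sol_def flipped_def)
    then show ?thesis by auto
  next
    case False
    then obtain x where x: "x \<in> crossings P" by auto
    obtain t u where D: "double_at t u x"
      using crossing_double_at[OF x order.refl vertex_not_crossing] by blast
    have "corner t u 1 1 \<in> components (- curve_image P)"
      using corner_component[OF D] by (auto simp: signs_def)
    then have R: "corner t u 1 1 \<in> crossing_regions"
      using frontier_corners_list[OF D, of "corner t u 1 1"] x by (auto simp: crossing_regions_def)
    obtain \<tau> where "based_curve P \<tau> (corner t u 1 1)" using region_has_base[OF R] .
    then interpret based_curve P \<tau> "corner t u 1 1" .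
    show ?thesis using achievable_all[OF b] by (auto simp: achievable_def Sol_def)
  qed
  moreover have "Sol \<subseteq> Pow crossing_regions" by (auto simp: Sol_def)
  ultimately obtain Z where Z: "Z \<in> Sol"
    "2 * (\<Sum>R\<in>Z. card {x \<in> crossings P. x \<in> frontier R}) \<le> (\<Sum>R\<in>crossing_regions. card {x \<in> crossings P. x \<in> frontier R})"
    using exists_below_average[OF finite_crossing_regions _ _ toggle,
        where w = "\<lambda>R. card {x \<in> crossings P. x \<in> frontier R}"] by blast
  show ?thesis
  proof (rule that[of Z])
    show "Z \<subseteq> components (- curve_image P)" "finite Z" "flipped Z = b"
      using Z(1) fin by (auto simp: Sol_def crossing_regions_def)
    show "(\<Sum>R\<in>Z. card {x \<in> crossings P. x \<in> frontier R}) \<le> 2 * card (crossings P)"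
      using Z(2) sum_region_crossings by linarith
  qed
qed

end

section \<open>Descending diagrams are unknotted\<close>

text \<open>On each level a complex affine map, moving the centre \<open>M\<close> to 0 and dividing
  by the number with logarithm \<open>E\<close>. Scaling the logarithm by \<open>s\<close> keeps the
  map invertible at every time and gives the identity at \<open>s = 0\<close>.\<close>

definition twist :: "(real \<Rightarrow> complex) \<Rightarrow> (real \<Rightarrow> complex) \<Rightarrow> real \<Rightarrow> point3 \<Rightarrow> complex" where
  "twist M E s x = exp (- of_real s * E (snd x)) * (cx (fst x) - of_real s * M (snd x))"

definition untwist :: "(real \<Rightarrow> complex) \<Rightarrow> (real \<Rightarrow> complex) \<Rightarrow> real \<Rightarrow> complex \<Rightarrow> real \<Rightarrow> complex" where
  "untwist M E s c z = exp (of_real s * E z) * c + of_real s * M z"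

text \<open>The tilt by \<open>s * pi / 2\<close> about the first axis carries the vertical plane of
  the straightened circle into the horizontal plane of \<open>standard_unknot\<close>.\<close>

definition level_move :: "(real \<Rightarrow> complex) \<Rightarrow> (real \<Rightarrow> complex) \<Rightarrow> real \<Rightarrow> point3 \<Rightarrow> point3" where
  "level_move M E s x =
     ((Re (twist M E s x), Im (twist M E s x) * cos (s * pi / 2) - snd x * sin (s * pi / 2)),
      Im (twist M E s x) * sin (s * pi / 2) + snd x * cos (s * pi / 2))"

definition level_unmove :: "(real \<Rightarrow> complex) \<Rightarrow> (real \<Rightarrow> complex) \<Rightarrow> real \<Rightarrow> point3 \<Rightarrow> point3" where
  "level_unmove M E s y =
     (let X = fst (fst y);
          Y = snd (fst y) * cos (s * pi / 2) + snd y * sin (s * pi / 2);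
          z = snd y * cos (s * pi / 2) - snd (fst y) * sin (s * pi / 2);
          c = untwist M E s (Complex X Y) z
      in ((Re c, Im c), z))"

lemma rotation_inverse:
  fixes Y z \<phi> :: real
  shows "(Y * cos \<phi> - z * sin \<phi>) * cos \<phi> + (Y * sin \<phi> + z * cos \<phi>) * sin \<phi> = Y"
    "(Y * sin \<phi> + z * cos \<phi>) * cos \<phi> - (Y * cos \<phi> - z * sin \<phi>) * sin \<phi> = z"
    "(Y * cos \<phi> + z * sin \<phi>) * cos \<phi> - (z * cos \<phi> - Y * sin \<phi>) * sin \<phi> = Y"
    "(Y * cos \<phi> + z * sin \<phi>) * sin \<phi> + (z * cos \<phi> - Y * sin \<phi>) * cos \<phi> = z"
proof -
  have sc: "sin \<phi> * sin \<phi> = 1 - cos \<phi> * cos \<phi>"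
    using sin_cos_squared_add[of \<phi>] by (simp add: power2_eq_square)
  show "(Y * cos \<phi> - z * sin \<phi>) * cos \<phi> + (Y * sin \<phi> + z * cos \<phi>) * sin \<phi> = Y"
    "(Y * sin \<phi> + z * cos \<phi>) * cos \<phi> - (Y * cos \<phi> - z * sin \<phi>) * sin \<phi> = z"
    "(Y * cos \<phi> + z * sin \<phi>) * cos \<phi> - (z * cos \<phi> - Y * sin \<phi>) * sin \<phi> = Y"
    "(Y * cos \<phi> + z * sin \<phi>) * sin \<phi> + (z * cos \<phi> - Y * sin \<phi>) * cos \<phi> = z"
    by (simp_all add: algebra_simps sc)
qed

lemma level_unmove_move: "level_unmove M E s (level_move M E s x) = x"
proof -
  have "untwist M E s (twist M E s x) (snd x) = cx (fst x)"
    by (simp add: untwist_def twist_def mult.assoc[symmetric] exp_add[symmetric])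
  then show ?thesis
    by (simp add: level_unmove_def level_move_def Let_def rotation_inverse cx_def prod_eq_iff)
qed

lemma level_move_unmove: "level_move M E s (level_unmove M E s y) = y"
proof -
  have "twist M E s ((Re c, Im c), z) = exp (- of_real s * E z) * (c - of_real s * M z)" for c z
    by (simp add: twist_def cx_def)
  moreover have "exp (- of_real s * E z) * (untwist M E s c z - of_real s * M z) = c" for c z
    by (simp add: untwist_def mult.assoc[symmetric] exp_add[symmetric])
  ultimately show ?thesis
    by (simp add: level_unmove_def level_move_def Let_def rotation_inverse prod_eq_iff)
qed

lemma ambient_isotopic_level_move:
  assumes M: "continuous_on UNIV M" and E: "continuous_on UNIV E"
  shows "ambient_isotopic K (level_move M E 1 ` K)"
proof -
  have cM': "continuous_on S (\<lambda>x. M (f x))" if "continuous_on S f" for S :: "(real \<times> point3) set" and f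
    using continuous_on_compose2[OF M that] by simp
  have cE': "continuous_on S (\<lambda>x. E (f x))" if "continuous_on S f" for S :: "(real \<times> point3) set" and f
    using continuous_on_compose2[OF E that] by simp
  have joint: "continuous_on S (\<lambda>(t, x). level_move M E t x)" for S
    unfolding level_move_def twist_def case_prod_beta by (intro continuous_intros cM' cE') auto
  have cM3: "continuous_on S (\<lambda>x. M (f x))" if "continuous_on S f" for S :: "point3 set" and f
    using continuous_on_compose2[OF M that] by simp
  have cE3: "continuous_on S (\<lambda>x. E (f x))" if "continuous_on S f" for S :: "point3 set" and f
    using continuous_on_compose2[OF E that] by simp
  have "continuous_on UNIV (level_move M E t)" for t
    unfolding level_move_def twist_def by (intro continuous_intros cM3 cE3) auto
  moreover have "continuous_on UNIV (level_unmove M E t)" for t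
    unfolding level_unmove_def untwist_def Let_def Complex_eq by (intro continuous_intros cM3 cE3) auto
  ultimately have "homeomorphism UNIV UNIV (level_move M E t) (level_unmove M E t)" for t
    by (intro homeomorphismI) (auto simp: level_unmove_move level_move_unmove)
  moreover have "level_move M E 0 = id"
    by (simp add: fun_eq_iff level_move_def twist_def cx_def)
  ultimately show ?thesis
    unfolding ambient_isotopic_def using joint by (intro exI[of _ "level_move M E"]) blast
qed

text \<open>
  Rational parametrisation of the half circle: unlike sine and cosine, the factor s (1 - s) of the
  radius can be cancelled explicitly against the distance between the two strands near the ends.
\<close>

definition circ_denom :: "real \<Rightarrow> real" where "circ_denom s = 1 - 2 * s + 2 * s\<^sup>2"

text \<open>\<open>circ_height\<close> and \<open>circ_radius\<close> are cosine and sine in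
  half-angle form, with \<open>s / (1 - s)\<close> as tangent of half the angle; from 0 to 1,
  \<open>s\<close> runs from the top of the circle to the bottom.\<close>

definition circ_height :: "real \<Rightarrow> real" where "circ_height s = (1 - 2 * s) / circ_denom s"

definition circ_radius :: "real \<Rightarrow> real" where "circ_radius s = 2 * s * (1 - s) / circ_denom s"

text \<open>The inverse of \<open>circ_height\<close>: the two roots are proportional to sine and
  cosine of half the angle. Clamping extends it continuously to all heights, as an isotopy of the
  whole space requires.\<close>

definition circ_param :: "real \<Rightarrow> real" where
  "circ_param z = (let y = max (-1) (min 1 z) in sqrt (1 - y) / (sqrt (1 - y) + sqrt (1 + y)))"

lemma circ_denom_pos: "circ_denom s > 0"
proof -
  have "circ_denom s = (1 - s)\<^sup>2 + s\<^sup>2" by (simp add: circ_denom_def power2_eq_square algebra_simps)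
  moreover have "(1 - s)\<^sup>2 + s\<^sup>2 > 0" by (simp add: sum_power2_gt_zero_iff)
  ultimately show ?thesis by simp
qed

lemma circ_on_circle: "(circ_radius s)\<^sup>2 + (circ_height s)\<^sup>2 = 1"
proof -
  have d: "circ_denom s \<noteq> 0" using circ_denom_pos[of s] by simp
  have "(2 * s * (1 - s))\<^sup>2 + (1 - 2 * s)\<^sup>2 = (circ_denom s)\<^sup>2"
    by (simp add: circ_denom_def power2_eq_square algebra_simps)
  then show ?thesis
    using d by (simp add: circ_radius_def circ_height_def power_divide add_divide_distrib[symmetric])
qed

lemma circ_height_decreasing:
  assumes "0 \<le> s" "s < t" "t \<le> 1"
  shows "circ_height t < circ_height s"
proof -
  \<comment> \<open>The cross-multiplied difference of the two fractions, factored.\<close>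
  have "0 < 2 * (t - s) * (s * (1 - t) + t * (1 - s))"
    using assms by (intro mult_pos_pos add_nonneg_pos mult_nonneg_nonneg) auto
  also have "\<dots> = (1 - 2 * s) * circ_denom t - (1 - 2 * t) * circ_denom s"
    by (simp add: circ_denom_def power2_eq_square algebra_simps)
  finally show ?thesis
    unfolding circ_height_def using circ_denom_pos[of s] circ_denom_pos[of t] by (simp add: field_simps)
qed

lemma circ_param_sum_pos:
  assumes "-1 \<le> y" "y \<le> 1"
  shows "0 < sqrt (1 - y) + sqrt (1 + y)"
proof (cases "y = 1")
  case True
  then show ?thesis by simp
next
  case False
  then show ?thesis using assms by (intro add_pos_nonneg) auto
qed

lemma continuous_circ_param: "continuous_on UNIV circ_param"
proof -
  have "sqrt (1 - y) + sqrt (1 + y) \<noteq> 0" if "y = max (-1) (min 1 z)" for y z :: real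
    using circ_param_sum_pos[of y] that by (simp add: max_def min_def split: if_splits)
  then show ?thesis unfolding circ_param_def[abs_def] Let_def by (intro continuous_intros) blast
qed

lemma circ_param_bounds: "0 \<le> circ_param z" "circ_param z \<le> 1"
proof -
  define y where "y = max (-1) (min 1 z)"
  have y: "-1 \<le> y" "y \<le> 1" by (auto simp: y_def)
  have "circ_param z = sqrt (1 - y) / (sqrt (1 - y) + sqrt (1 + y))" by (simp add: circ_param_def y_def Let_def)
  then show "0 \<le> circ_param z" "circ_param z \<le> 1"
    using circ_param_sum_pos[OF y] y by (auto simp: divide_le_eq_1)
qed

lemma circ_height_bounds: "-1 \<le> circ_height s" "circ_height s \<le> 1"
proof -
  have "(circ_height s)\<^sup>2 \<le> 1" using circ_on_circle[of s] by (metis le_add_same_cancel2 zero_le_power2)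
  then have "\<bar>circ_height s\<bar> \<le> 1" by (simp add: abs_square_le_1)
  then show "-1 \<le> circ_height s" "circ_height s \<le> 1" by auto
qed

lemma circ_param_height:
  assumes "0 \<le> s" "s \<le> 1"
  shows "circ_param (circ_height s) = s"
proof -
  define N where "N = circ_denom s"
  have N: "N > 0" using circ_denom_pos by (simp add: N_def)
  have "1 - circ_height s = (2 / N) * s\<^sup>2" "1 + circ_height s = (2 / N) * (1 - s)\<^sup>2"
    using N by (simp_all add: circ_height_def N_def[symmetric] field_simps)
      (simp_all add: N_def circ_denom_def power2_eq_square algebra_simps)
  then have sq: "sqrt (1 - circ_height s) = sqrt (2 / N) * s" "sqrt (1 + circ_height s) = sqrt (2 / N) * (1 - s)"
    using assms by (simp_all only: real_sqrt_mult real_sqrt_abs abs_of_nonneg diff_ge_0_iff_ge)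
  have "max (-1) (min 1 (circ_height s)) = circ_height s" using circ_height_bounds[of s] by simp
  then have "circ_param (circ_height s) = sqrt (2 / N) * s / (sqrt (2 / N) * s + sqrt (2 / N) * (1 - s))"
    unfolding circ_param_def Let_def by (simp only: sq)
  also have "sqrt (2 / N) * s + sqrt (2 / N) * (1 - s) = sqrt (2 / N)" by (simp add: algebra_simps)
  also have "sqrt (2 / N) * s / sqrt (2 / N) = s" using N by simp
  finally show ?thesis .
qed

lemma circ_height_param:
  assumes "-1 \<le> z" "z \<le> 1"
  shows "circ_height (circ_param z) = z"
proof -
  define A where "A = sqrt (1 - z)"
  define B where "B = sqrt (1 + z)"
  have AB: "A + B > 0" using circ_param_sum_pos[OF assms] by (simp add: A_def B_def)
  have sq: "A\<^sup>2 = 1 - z" "B\<^sup>2 = 1 + z" using assms by (simp_all add: A_def B_def)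
  have cp: "circ_param z = A / (A + B)"
    using assms by (simp add: circ_param_def Let_def A_def B_def)
  have num: "1 - 2 * (A / (A + B)) = (B - A) / (A + B)"
    using AB by (simp add: field_simps)
  have den: "circ_denom (A / (A + B)) = (A\<^sup>2 + B\<^sup>2) / (A + B)\<^sup>2"
    using AB by (simp add: circ_denom_def power_divide divide_simps) (simp add: power2_eq_square algebra_simps)
  have "circ_height (circ_param z) = (B - A) / (A + B) / ((A\<^sup>2 + B\<^sup>2) / (A + B)\<^sup>2)"
    unfolding cp circ_height_def num den ..
  also have "\<dots> = (B - A) * (A + B) / (A\<^sup>2 + B\<^sup>2)"
    using AB by (simp add: power2_eq_square)
  also have "(B - A) * (A + B) = B\<^sup>2 - A\<^sup>2" by (simp add: power2_eq_square algebra_simps)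
  also have "(B\<^sup>2 - A\<^sup>2) / (A\<^sup>2 + B\<^sup>2) = z" by (simp add: sq)
  finally show ?thesis .
qed

lemma circ_radius_nonneg: "0 \<le> s \<Longrightarrow> s \<le> 1 \<Longrightarrow> 0 \<le> circ_radius s"
  using circ_denom_pos[of s] by (simp add: circ_radius_def)

lemma continuous_circ_height [continuous_intros]:
  assumes "continuous_on S f"
  shows "continuous_on S (\<lambda>x. circ_height (f x))"
proof -
  have "continuous_on UNIV circ_height"
    unfolding circ_height_def[abs_def] circ_denom_def
    by (intro continuous_intros) (metis circ_denom_def circ_denom_pos less_irrefl)
  from continuous_on_compose2[OF this assms] show ?thesis by simp
qed

context plane_curve
begin

section \<open>Lifting a curve whose initial piece has no crossings\<close>

context
  fixes a b :: real
  assumes ab: "0 < a" "a < b" "b < 1"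
    and free: "\<And>t. 0 < t \<Longrightarrow> t \<le> b \<Longrightarrow> p t \<notin> crossings P"
begin

definition long_len :: real where "long_len = real n + a - b"

text \<open>Both strands run from \<open>p b\<close> to \<open>p a\<close>, this one forwards
  through all of the curve beyond \<open>b\<close>, the other backwards along the crossing-free
  piece. At equal \<open>s\<close> they are placed at equal height.\<close>

definition long_strand :: "real \<Rightarrow> point2" where "long_strand s = p (b + long_len * s)"

definition short_strand :: "real \<Rightarrow> point2" where "short_strand s = p (b - (b - a) * s)"

text \<open>Descends from \<open>b\<close> through the end of the period to \<open>a\<close>, and
  climbs back on the crossing-free piece from \<open>a\<close> to \<open>b\<close>. Cutting at
  parameter 0 splits the descent into the first and the last case.\<close>

definition profile :: "real \<Rightarrow> real" where
  "profile t = (if t \<le> a then circ_height ((t + real n - b) / long_len)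
     else if t \<le> b then circ_height ((b - t) / (b - a))
     else circ_height ((t - b) / long_len))"

lemma long_len_pos: "long_len > 0"
  using ab n_ge by (simp add: long_len_def)

lemma short_param_bounds:
  assumes "0 \<le> s" "s \<le> 1"
  shows "a \<le> b - (b - a) * s" "b - (b - a) * s \<le> b"
proof -
  have "(b - a) * s \<le> b - a" by (rule mult_left_le) (use assms ab in auto)
  then show "a \<le> b - (b - a) * s" by linarith
  show "b - (b - a) * s \<le> b" using assms ab by simp
qed

lemma profile_parts:
  "0 \<le> t \<Longrightarrow> t \<le> a \<Longrightarrow> profile t = circ_height ((t + real n - b) / long_len)"
  "a \<le> t \<Longrightarrow> t \<le> b \<Longrightarrow> profile t = circ_height ((b - t) / (b - a))"
  "b \<le> t \<Longrightarrow> profile t = circ_height ((t - b) / long_len)"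
proof -
  have 1: "(a + real n - b) / long_len = 1" using long_len_pos by (simp add: long_len_def add.commute)
  show "0 \<le> t \<Longrightarrow> t \<le> a \<Longrightarrow> profile t = circ_height ((t + real n - b) / long_len)"
    by (simp add: profile_def)
  show "a \<le> t \<Longrightarrow> t \<le> b \<Longrightarrow> profile t = circ_height ((b - t) / (b - a))"
    using 1 ab by (cases "t = a") (auto simp: profile_def)
  show "b \<le> t \<Longrightarrow> profile t = circ_height ((t - b) / long_len)"
    using ab by (cases "t = b") (auto simp: profile_def)
qed

lemma continuous_profile: "continuous_on {0..real n} profile"
proof -
  have "continuous_on {0..a} profile"
    by (rule continuous_on_eq[where f = "\<lambda>t. circ_height ((t + real n - b) / long_len)"])
      (use long_len_pos in \<open>auto intro!: continuous_intros simp: profile_parts\<close>)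
  moreover have "continuous_on {a..b} profile"
    by (rule continuous_on_eq[where f = "\<lambda>t. circ_height ((b - t) / (b - a))"])
      (use ab in \<open>auto intro!: continuous_intros simp: profile_parts\<close>)
  moreover have "continuous_on {b..real n} profile"
    by (rule continuous_on_eq[where f = "\<lambda>t. circ_height ((t - b) / long_len)"])
      (use long_len_pos in \<open>auto intro!: continuous_intros simp: profile_parts\<close>)
  ultimately have "continuous_on ({0..a} \<union> {a..b} \<union> {b..real n}) profile"
    by (intro continuous_on_closed_Un closed_Un) auto
  moreover have "{0..a} \<union> {a..b} \<union> {b..real n} = {0..real n}" using ab n_ge by auto
  ultimately show ?thesis by simp
qed

lemma profile_closed: "profile 0 = profile (real n)"
  using profile_parts(1)[of 0] profile_parts(3)[of "real n"] ab n_ge by simp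

lemma profile_decreasing:
  assumes "b \<le> t" "t < u" "u \<le> real n"
  shows "profile u < profile t"
proof -
  have "circ_height ((u - b) / long_len) < circ_height ((t - b) / long_len)"
    using assms long_len_pos ab by (intro circ_height_decreasing) (auto simp: divide_strict_right_mono long_len_def)
  then show ?thesis using assms profile_parts(3) by simp
qed

lemma lift_points:
  "(\<lambda>t. (p t, profile t)) ` {0..real n} =
     (\<lambda>s. (long_strand s, circ_height s)) ` {0..1} \<union> (\<lambda>s. (short_strand s, circ_height s)) ` {0..1}"
    (is "?L = ?A \<union> ?B")
proof
  show "?L \<subseteq> ?A \<union> ?B"
  proof
    fix x assume "x \<in> ?L"
    then obtain t where t: "0 \<le> t" "t \<le> real n" "x = (p t, profile t)" by auto
    consider "t \<le> a" | "a \<le> t" "t \<le> b" | "b \<le> t" by linarith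
    then show "x \<in> ?A \<union> ?B"
    proof cases
      case 1
      define s where "s = (t + real n - b) / long_len"
      have s: "s \<in> {0..1}" using 1 t ab n_ge long_len_pos by (auto simp: s_def long_len_def)
      have "b + long_len * s = t + real n" using long_len_pos by (simp add: s_def)
      then have "long_strand s = p t"
        using p_same[OF same_add_n[of t]] t by (simp add: long_strand_def)
      then have "x = (long_strand s, circ_height s)" using profile_parts(1) 1 t by (simp add: s_def)
      then show ?thesis using s by blast
    next
      case 2
      define s where "s = (b - t) / (b - a)"
      have s: "s \<in> {0..1}" using 2 ab by (auto simp: s_def)
      have "(b - a) * s = b - t" using ab by (simp add: s_def)
      then have "x = (short_strand s, circ_height s)"
        using profile_parts(2) 2 t by (simp add: s_def short_strand_def)
      then show ?thesis using s by blast
    next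
      case 3
      define s where "s = (t - b) / long_len"
      have s: "s \<in> {0..1}" using 3 t ab long_len_pos by (auto simp: s_def long_len_def)
      have "b + long_len * s = t" using long_len_pos by (simp add: s_def)
      then have "x = (long_strand s, circ_height s)"
        using profile_parts(3) 3 t by (simp add: s_def long_strand_def)
      then show ?thesis using s by blast
    qed
  qed
  show "?A \<union> ?B \<subseteq> ?L"
  proof -
    have "(long_strand s, circ_height s) \<in> ?L" if s: "0 \<le> s" "s \<le> 1" for s
    proof -
      define t where "t = b + long_len * s"
      have ts: "(t - b) / long_len = s" using long_len_pos by (simp add: t_def)
      have t1: "b \<le> t" using s long_len_pos by (simp add: t_def)
      have "long_len * s \<le> long_len * 1" using s long_len_pos by (intro mult_left_mono) auto
      then have t2: "t \<le> real n + a" by (simp add: t_def long_len_def)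
      show ?thesis
      proof (cases "t \<le> real n")
        case True
        then have "(long_strand s, circ_height s) = (p t, profile t)"
          using profile_parts(3)[OF t1] ts by (simp add: long_strand_def t_def)
        then show ?thesis using True t1 ab by (intro image_eqI[of _ _ t]) auto
      next
        case False
        define t' where "t' = t - real n"
        have t': "0 \<le> t'" "t' \<le> a" using False t2 by (auto simp: t'_def)
        have "p t' = p t" using p_same[OF same_add_n[of t']] t' by (simp add: t'_def)
        moreover have "profile t' = circ_height s"
          using profile_parts(1)[OF t'] ts by (simp add: t'_def)
        ultimately have "(long_strand s, circ_height s) = (p t', profile t')"
          by (simp add: long_strand_def t_def)
        then show ?thesis using t' ab n_ge by (intro image_eqI[of _ _ t']) auto
      qed
    qed
    moreover have "(short_strand s, circ_height s) \<in> ?L" if s: "0 \<le> s" "s \<le> 1" for s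
    proof -
      define t where "t = b - (b - a) * s"
      have t: "a \<le> t" "t \<le> b" using short_param_bounds[OF s] by (simp_all only: t_def)
      have "(b - t) / (b - a) = s" using ab by (simp add: t_def)
      then have "(short_strand s, circ_height s) = (p t, profile t)"
        using profile_parts(2)[OF t] by (simp add: short_strand_def t_def)
      then show ?thesis using t ab n_ge by (intro image_eqI[of _ _ t]) auto
    qed
    ultimately show ?thesis by auto
  qed
qed

text \<open>A common point would be no crossing, so the two parameters would be congruent; but they
  are distinct and less than one period apart.\<close>

lemma strands_differ:
  assumes "0 < s" "s < 1"
  shows "long_strand s \<noteq> short_strand s"
proof
  assume eq: "long_strand s = short_strand s"
  define t where "t = b - (b - a) * s"
  define u where "u = b + long_len * s"
  have "(b - a) * s < (b - a) * 1" using assms ab by (intro mult_strict_left_mono) auto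
  moreover have "0 < (b - a) * s" using assms ab by simp
  ultimately have t: "a < t" "t < b" by (auto simp: t_def)
  have "long_len * s < long_len * 1" using assms long_len_pos by (intro mult_strict_left_mono) auto
  moreover have "0 < long_len * s" using assms long_len_pos by simp
  ultimately have u: "b < u" "u < real n + a" by (auto simp: u_def long_len_def)
  have "p t = p u" using eq by (simp add: long_strand_def short_strand_def t_def u_def)
  moreover have "p t \<notin> crossings P" using free t ab by simp
  ultimately have "same t u" using same_if_not_crossing[of t u] t u ab by simp
  then show False using same_close[of t u] t u by auto
qed

definition half_diff :: "real \<Rightarrow> complex" where
  "half_diff s = (cx (long_strand s) - cx (short_strand s)) / 2"

text \<open>
  Both strands lie on the first edge near s = 0 and s = 1, which gives the values at the ends.
\<close>

definition direction :: "real \<Rightarrow> complex" where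
  "direction s = (if s = 0 then of_real (real n / 4) * cx (edge 0)
     else if s = 1 then - of_real (real n / 4) * cx (edge 0)
     else half_diff s * of_real (circ_denom s / (2 * s * (1 - s))))"

lemma edge_nonzero: "edge 0 \<noteq> 0"
proof
  assume e: "edge 0 = 0"
  have "p a = P ! 0" "p b = P ! 0"
    using p_affine[of 0 a] p_affine[of 0 b] ab e by simp_all
  then have "p a = p b" by simp
  then have "same a b" using same_if_not_crossing[of a b] free ab by simp
  then show False using same_close[of a b] ab n_ge by simp
qed

lemma short_strand_affine:
  assumes "0 \<le> s" "s \<le> 1"
  shows "short_strand s = P ! 0 + (b - (b - a) * s) *\<^sub>R edge 0"
proof -
  have "real 0 \<le> b - (b - a) * s" "b - (b - a) * s \<le> real 0 + 1"
    using short_param_bounds[OF assms] ab by linarith+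
  from p_affine[OF this] show ?thesis by (simp add: short_strand_def)
qed

text \<open>On the first edge the two parameters differ by
  \<open>(long_len + (b - a)) * s = real n * s\<close>. Dividing the half difference by
  \<open>circ_radius s\<close>, which is \<open>2 * s\<close> to first order, gives the constant
  \<open>real n / 4\<close> in \<open>direction\<close>.\<close>

lemma half_diff_start:
  assumes "0 \<le> s" "s \<le> 1" "b + long_len * s \<le> 1"
  shows "half_diff s = of_real (real n / 2 * s) * cx (edge 0)"
proof -
  have "0 \<le> long_len * s" using assms long_len_pos by simp
  then have l: "long_strand s = P ! 0 + (b + long_len * s) *\<^sub>R edge 0"
    using p_affine[of 0 "b + long_len * s"] ab assms by (simp add: long_strand_def)
  have "long_strand s - short_strand s = (real n * s) *\<^sub>R edge 0"
    unfolding l short_strand_affine[OF assms(1,2)]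
    by (simp add: long_len_def algebra_simps)
  then have "cx (long_strand s) - cx (short_strand s) = (real n * s) *\<^sub>R cx (edge 0)"
    by (metis cx_simps(2,3))
  then show ?thesis by (simp add: half_diff_def scaleR_conv_of_real)
qed

text \<open>Here the long strand has completed a period, which replaces \<open>real n * s\<close> by
  \<open>real n * (s - 1)\<close>.\<close>

lemma half_diff_end:
  assumes "0 \<le> s" "s \<le> 1" "long_len * (1 - s) \<le> a"
  shows "half_diff s = - of_real (real n / 2 * (1 - s)) * cx (edge 0)"
proof -
  define t where "t = a - long_len * (1 - s)"
  have t: "0 \<le> t" "t \<le> a" using assms long_len_pos by (auto simp: t_def)
  have "b + long_len * s = t + real n" by (simp add: t_def long_len_def algebra_simps)
  then have "long_strand s = p t"
    using p_same[OF same_add_n[of t]] t by (simp add: long_strand_def)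
  then have l: "long_strand s = P ! 0 + t *\<^sub>R edge 0"
    using p_affine[of 0 t] ab t by simp
  have "long_strand s - short_strand s = (- real n * (1 - s)) *\<^sub>R edge 0"
    unfolding l short_strand_affine[OF assms(1,2)]
    by (simp add: t_def long_len_def algebra_simps)
  then have "cx (long_strand s) - cx (short_strand s) = (- real n * (1 - s)) *\<^sub>R cx (edge 0)"
    by (metis cx_simps(2,3))
  then show ?thesis by (simp add: half_diff_def scaleR_conv_of_real)
qed

lemma half_diff_direction:
  assumes "0 \<le> s" "s \<le> 1"
  shows "half_diff s = of_real (circ_radius s) * direction s"
proof -
  consider "s = 0" | "s = 1" | "0 < s" "s < 1" using assms by linarith
  then show ?thesis
  proof cases
    case 1
    then show ?thesis using half_diff_start[of 0] ab by (simp add: circ_radius_def)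
  next
    case 2
    then show ?thesis using half_diff_end[of 1] ab by (simp add: circ_radius_def)
  next
    case 3
    have "circ_radius s * (circ_denom s / (2 * s * (1 - s))) = 1"
      using 3 circ_denom_pos[of s] by (simp add: circ_radius_def)
    moreover have "of_real (circ_radius s) * direction s
        = half_diff s * of_real (circ_radius s * (circ_denom s / (2 * s * (1 - s))))"
      using 3 by (simp add: direction_def)
    ultimately show ?thesis by (metis mult.right_neutral of_real_1)
  qed
qed

lemma direction_nonzero:
  assumes "0 \<le> s" "s \<le> 1"
  shows "direction s \<noteq> 0"
proof -
  consider "s = 0" | "s = 1" | "0 < s" "s < 1" using assms by linarith
  then show ?thesis
  proof cases
    case 3
    then have "half_diff s \<noteq> 0" using strands_differ[OF 3] by (simp add: half_diff_def)
    then show ?thesis using half_diff_direction[OF assms] by auto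
  qed (use edge_nonzero n_ge in \<open>auto simp: direction_def\<close>)
qed

lemma continuous_strands: "continuous_on {0..1} long_strand" "continuous_on {0..1} short_strand"
proof -
  have "0 \<le> b - (b - a) * s" if "0 \<le> s" "s \<le> 1" for s
    using short_param_bounds(1)[OF that] ab by linarith
  then have 1: "(\<lambda>s. b - (b - a) * s) ` {0..1} \<subseteq> {0..}"
    unfolding image_subset_iff by (metis atLeastAtMost_iff atLeast_iff)
  have 2: "(\<lambda>s. b + long_len * s) ` {0..1} \<subseteq> {0..}" using ab long_len_pos by auto
  show "continuous_on {0..1} long_strand" "continuous_on {0..1} short_strand"
    unfolding long_strand_def[abs_def] short_strand_def[abs_def]
    by (rule continuous_on_compose2[OF continuous_on_p[OF order.refl] _ 2]
          continuous_on_compose2[OF continuous_on_p[OF order.refl] _ 1]; intro continuous_intros)+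
qed

lemma continuous_direction: "continuous_on {0..1} direction"
proof -
  \<comment> \<open>Within \<open>c\<close> of either end the long strand is on the first edge as
    well: the first bound serves the start after \<open>b\<close>, the second the end before
    \<open>a\<close>. The bound \<open>1 / 2\<close> keeps \<open>c \<le> 1 - c\<close>.\<close>
  define c where "c = min (min ((1 - b) / long_len) (a / long_len)) (1 / 2)"
  have c: "0 < c" "c \<le> (1 - b) / long_len" "c \<le> a / long_len" "c \<le> 1 / 2"
    using ab long_len_pos unfolding c_def by (simp, linarith+)
  have c': "long_len * c \<le> 1 - b" "long_len * c \<le> a"
    using c long_len_pos by (simp_all add: field_simps)
  have le: "long_len * s \<le> long_len * c" if "s \<le> c" for s
    using that long_len_pos by simp
  have d0: "direction s = of_real (real n / 4 * circ_denom s / (1 - s)) * cx (edge 0)" if "0 \<le> s" "s \<le> c" for s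
  proof (cases "s = 0")
    case True
    then show ?thesis by (simp add: direction_def circ_denom_def)
  next
    case False
    have "half_diff s = of_real (real n / 2 * s) * cx (edge 0)"
      using le[of s] that c c' by (intro half_diff_start) auto
    moreover have "direction s = half_diff s * of_real (circ_denom s / (2 * s * (1 - s)))"
      using False that c by (simp add: direction_def)
    ultimately have "direction s = of_real (real n / 2 * s * (circ_denom s / (2 * s * (1 - s)))) * cx (edge 0)"
      by (simp only: of_real_mult mult_ac)
    also have "real n / 2 * s * (circ_denom s / (2 * s * (1 - s))) = real n / 4 * circ_denom s / (1 - s)"
      using False that c by (simp add: field_simps)
    finally show ?thesis .
  qed
  have d1: "direction s = - of_real (real n / 4 * circ_denom s / s) * cx (edge 0)" if "1 - c \<le> s" "s \<le> 1" for s
  proof (cases "s = 1")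
    case True
    then show ?thesis using c by (simp add: direction_def circ_denom_def)
  next
    case False
    have "half_diff s = - of_real (real n / 2 * (1 - s)) * cx (edge 0)"
      using le[of "1 - s"] that c c' by (intro half_diff_end) auto
    moreover have "direction s = half_diff s * of_real (circ_denom s / (2 * s * (1 - s)))"
      using False that c by (simp add: direction_def)
    ultimately have "direction s = - of_real (real n / 2 * (1 - s) * (circ_denom s / (2 * s * (1 - s)))) * cx (edge 0)"
      by (simp only: of_real_mult mult_minus_left mult_minus_right mult_ac)
    also have "real n / 2 * (1 - s) * (circ_denom s / (2 * s * (1 - s))) = real n / 4 * circ_denom s / s"
      using False that c by (simp add: field_simps)
    finally show ?thesis .
  qed
  have "continuous_on {0..c} (\<lambda>s. of_real (real n / 4 * circ_denom s / (1 - s)) * cx (edge 0))"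
    unfolding circ_denom_def using c by (intro continuous_intros) auto
  then have "continuous_on {0..c} direction" by (rule continuous_on_eq) (simp add: d0)
  moreover
  have "continuous_on {1 - c..1} (\<lambda>s. - of_real (real n / 4 * circ_denom s / s) * cx (edge 0))"
    unfolding circ_denom_def using c by (intro continuous_intros) auto
  then have "continuous_on {1 - c..1} direction" by (rule continuous_on_eq) (simp add: d1)
  moreover
  have "continuous_on {0..1} half_diff"
    unfolding half_diff_def[abs_def] by (intro continuous_intros continuous_strands) auto
  then have "continuous_on {c..1 - c} half_diff" by (rule continuous_on_subset) (use c in auto)
  then have "continuous_on {c..1 - c} (\<lambda>s. half_diff s * of_real (circ_denom s / (2 * s * (1 - s))))"
    unfolding circ_denom_def using c by (intro continuous_intros) auto
  then have "continuous_on {c..1 - c} direction"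
    by (rule continuous_on_eq) (use c in \<open>auto simp: direction_def\<close>)
  ultimately have "continuous_on ({0..c} \<union> {c..1 - c} \<union> {1 - c..1}) direction"
    by (intro continuous_on_closed_Un closed_Un) auto
  moreover have "{0..c} \<union> {c..1 - c} \<union> {1 - c..1} = {0..1::real}" using c by auto
  ultimately show ?thesis by simp
qed

text \<open>Consider the points of both strands at height \<open>circ_height s\<close>. Moving their
  midpoint to 0 and dividing by \<open>direction\<close>, which has a continuous logarithm because
  it is nonzero on an interval, puts them at \<open>circ_radius s\<close> and its negative.\<close>

lemma lift_isotopic_unknot:
  "ambient_isotopic ((\<lambda>t. (p t, profile t)) ` {0..real n}) standard_unknot"
proof -
  obtain l where l: "continuous_on {0..1} l" "\<And>s. s \<in> {0..1} \<Longrightarrow> direction s = exp (l s)"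
    using continuous_logarithm_on_contractible[OF continuous_direction] direction_nonzero
      convex_imp_contractible by (metis atLeastAtMost_iff convex_real_interval(5))
  define m where "m s = (cx (long_strand s) + cx (short_strand s)) / 2" for s
  \<comment> \<open>Read through \<open>circ_param\<close>, midpoint and logarithm become functions
    of the height, defined and continuous at all levels.\<close>
  define M where "M z = m (circ_param z)" for z
  define E where "E z = l (circ_param z)" for z
  have range: "circ_param ` UNIV \<subseteq> {0..1}" using circ_param_bounds by auto
  have "continuous_on {0..1} m" unfolding m_def by (intro continuous_intros continuous_strands) auto
  then have cM: "continuous_on UNIV M"
    unfolding M_def using continuous_on_compose2[OF _ continuous_circ_param range] by blast
  have cE: "continuous_on UNIV E"
    unfolding E_def using continuous_on_compose2[OF l(1) continuous_circ_param range] by blast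
  have tw: "twist M E 1 (x, circ_height s) = exp (- l s) * (cx x - m s)" if "0 \<le> s" "s \<le> 1" for x s
    using that by (simp add: twist_def M_def E_def circ_param_height)
  have half: "exp (- l s) * half_diff s = of_real (circ_radius s)" if "0 \<le> s" "s \<le> 1" for s
    using half_diff_direction[OF that] l(2)[of s] that by (simp add: exp_minus)
  have twl: "twist M E 1 (long_strand s, circ_height s) = of_real (circ_radius s)" if "0 \<le> s" "s \<le> 1" for s
  proof -
    have "cx (long_strand s) - m s = half_diff s" by (simp add: m_def half_diff_def field_simps)
    then show ?thesis using tw[OF that] half[OF that] by simp
  qed
  have tws: "twist M E 1 (short_strand s, circ_height s) = of_real (- circ_radius s)" if "0 \<le> s" "s \<le> 1" for s
  proof -
    have "cx (short_strand s) - m s = - half_diff s" by (simp add: m_def half_diff_def field_simps)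
    then show ?thesis using tw[OF that] half[OF that] by simp
  qed
  have ml: "level_move M E 1 (long_strand s, circ_height s) = ((circ_radius s, - circ_height s), 0)"
    if "0 \<le> s" "s \<le> 1" for s using twl[OF that] by (simp add: level_move_def)
  have ms: "level_move M E 1 (short_strand s, circ_height s) = ((- circ_radius s, - circ_height s), 0)"
    if "0 \<le> s" "s \<le> 1" for s using tws[OF that] by (simp add: level_move_def)
  let ?K = "(\<lambda>t. (p t, profile t)) ` {0..real n}"
  have "level_move M E 1 ` ?K =
      (\<lambda>s. ((circ_radius s, - circ_height s), 0)) ` {0..1} \<union> (\<lambda>s. ((- circ_radius s, - circ_height s), 0)) ` {0..1}"
    unfolding lift_points image_Un image_image using ml ms by (intro arg_cong2[where f = "(\<union>)"] image_cong) auto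
  also have "\<dots> = standard_unknot"
  proof
    have "(\<sigma> * circ_radius s, - circ_height s) \<in> sphere 0 1" if "\<sigma> = 1 \<or> \<sigma> = -1" for \<sigma> s
      using circ_on_circle[of s] that by (auto simp: norm_Pair)
    from this[of 1] this[of "-1"]
    show "(\<lambda>s. ((circ_radius s, - circ_height s), 0)) ` {0..1} \<union> (\<lambda>s. ((- circ_radius s, - circ_height s), 0)) ` {0..1}
        \<subseteq> standard_unknot"
      unfolding standard_unknot_def by auto
    show "standard_unknot \<subseteq> (\<lambda>s. ((circ_radius s, - circ_height s), 0)) ` {0..1} \<union> (\<lambda>s. ((- circ_radius s, - circ_height s), 0)) ` {0..1}"
    proof
      fix w assume "w \<in> standard_unknot"
      then obtain X Y :: real where w: "w = ((X, Y), 0)" "sqrt (X\<^sup>2 + Y\<^sup>2) = 1"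
        unfolding standard_unknot_def by (auto simp: norm_Pair)
      then have XY: "X\<^sup>2 + Y\<^sup>2 = 1" by simp
      then have "Y\<^sup>2 \<le> 1" by (metis le_add_same_cancel2 zero_le_power2)
      then have Y: "-1 \<le> -Y" "-Y \<le> 1" using abs_square_le_1[of Y] by auto
      \<comment> \<open>The tilt turns height \<open>z\<close> into second coordinate
        \<open>- z\<close>, so a target point with second coordinate \<open>Y\<close> comes from
        height \<open>- Y\<close>.\<close>
      define s where "s = circ_param (- Y)"
      have s: "0 \<le> s" "s \<le> 1" using circ_param_bounds by (auto simp: s_def)
      have h: "circ_height s = - Y" using circ_height_param[OF Y] by (simp add: s_def)
      have "(circ_radius s)\<^sup>2 = X\<^sup>2" using circ_on_circle[of s] XY h by simp
      then have "\<bar>X\<bar> = circ_radius s" using circ_radius_nonneg[OF s] by (metis abs_of_nonneg power2_eq_iff_nonneg abs_ge_zero power2_abs)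
      then have "w = ((circ_radius s, - circ_height s), 0) \<or> w = ((- circ_radius s, - circ_height s), 0)"
        using w(1) h by (auto simp: abs_if split: if_splits)
      then show "w \<in> (\<lambda>s. ((circ_radius s, - circ_height s), 0)) ` {0..1} \<union> (\<lambda>s. ((- circ_radius s, - circ_height s), 0)) ` {0..1}"
        using s by auto
    qed
  qed
  finally show ?thesis using ambient_isotopic_level_move[OF cM cE, of ?K] by simp
qed

end

text \<open>\<open>Min\<close> picks the first passage after parameter 0. All passages come after
  \<open>b\<close>, where the profile decreases, so the first one is the higher.\<close>

lemma descending_unknot:
  assumes over: "\<And>x. x \<in> crossings P \<Longrightarrow> ov x = Min (preimages P x)"
  shows "is_unknot_diagram (P, ov)"
proof -
  have fin: "finite (\<Union> (preimages P ` crossings P))"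
    using finite_crossings preimages_finite by auto
  have pos: "0 < t" if t: "t \<in> \<Union> (preimages P ` crossings P)" for t
  proof -
    obtain x where x: "x \<in> crossings P" "t \<in> preimages P x" using t by blast
    obtain t' u where "preimages P x = {t', u}" "0 < t'" "t' < u" using crossing_preimages[OF x(1)] by metis
    then show ?thesis using x(2) by auto
  qed
  \<comment> \<open>Cuts off a crossing-free initial piece; the extra bound 1 keeps it on the first
    edge.\<close>
  obtain b where "0 < b" "\<forall>t\<in>insert 1 (\<Union> (preimages P ` crossings P)). b < t"
    by (rule positive_below_finite[of "insert 1 (\<Union> (preimages P ` crossings P))"]) (use fin pos in auto)
  then have b: "0 < b" "b < 1" "\<And>x t. x \<in> crossings P \<Longrightarrow> t \<in> preimages P x \<Longrightarrow> b < t"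
    by auto
  define a where "a = b / 2"
  have ab: "0 < a" "a < b" "b < 1" using b by (auto simp: a_def)
  have free: "p t \<notin> crossings P" if "0 < t" "t \<le> b" for t
  proof
    assume "p t \<in> crossings P"
    moreover have "t \<in> preimages P (p t)" using that b n_ge by (simp add: in_preimages)
    ultimately show False using b(3) that by fastforce
  qed
  have "valid_lift (P, ov) (profile a b)"
    unfolding valid_lift_def
  proof (intro conjI ballI)
    show "continuous_on {0..real (length (fst (P, ov)))} (profile a b)"
      using continuous_profile[OF ab free] by simp
    show "profile a b 0 = profile a b (real (length (fst (P, ov))))"
      using profile_closed[OF ab free] by simp
    fix x assume "x \<in> crossings (fst (P, ov))"
    then have x: "x \<in> crossings P" by simp
    obtain t u where tu: "preimages P x = {t, u}" "0 < t" "t < u" "u < real n"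
      using crossing_preimages[OF x] by metis
    have "ov x = t" using over[OF x] tu by simp
    moreover have "other_strand P x t = u"
      unfolding other_strand_def using tu by (intro the_equality) auto
    moreover have "b < t" using b(3)[OF x] tu by auto
    ultimately show "profile a b (other_strand (fst (P, ov)) x (snd (P, ov) x)) < profile a b (snd (P, ov) x)"
      using profile_decreasing[OF ab free] tu by simp
  qed
  moreover have "ambient_isotopic (lift_image (P, ov) (profile a b)) standard_unknot"
    using lift_isotopic_unknot[OF ab free] by (simp add: lift_image_def)
  moreover have "knot_diagram (P, ov)"
  proof -
    have "ov x \<in> preimages P x" if x: "x \<in> crossings P" for x
    proof -
      obtain t u where tu: "preimages P x = {t, u}" "t < u"
        using crossing_preimages[OF x] by metis
      then show ?thesis using over[OF x] by simp
    qed
    then show ?thesis using generic by (simp add: knot_diagram_def)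
  qed
  ultimately show ?thesis unfolding is_unknot_diagram_def diagram_of_def by blast
qed

end

theorem theorem1:
  fixes K :: "point3 set"
  assumes "\<exists>D. diagram_of D K"
  shows "MRI K \<le> 2 * crossing_number K"
proof -
  \<comment> \<open>Some diagram exists, so \<open>LEAST\<close> is attained by an actual
    diagram.\<close>
  have "\<exists>m. \<exists>D. diagram_of D K \<and> m = card (crossings (fst D))" using assms by blast
  from LeastI_ex[OF this] obtain D where D: "diagram_of D K" "crossing_number K = card (crossings (fst D))"
    unfolding crossing_number_def by blast
  define P where "P = fst D"
  have kd: "knot_diagram D" using D(1) by (simp add: diagram_of_def)
  interpret plane_curve P
    using kd by unfold_locales (simp add: knot_diagram_def P_def)
  \<comment> \<open>The crossings whose over-strand is the second passage; changing exactly these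
    makes the diagram descending.\<close>
  define b where "b = {x \<in> crossings P. snd D x \<noteq> Min (preimages P x)}"
  obtain Z where Z: "Z \<subseteq> components (- curve_image P)" "finite Z" "flipped Z = b"
    "(\<Sum>R\<in>Z. card {x \<in> crossings P. x \<in> frontier R}) \<le> 2 * card (crossings P)"
    by (rule cheap_region_set[of b]) (auto simp: b_def)
  have "snd (rcc D Z) x = Min (preimages P x)" if x: "x \<in> crossings P" for x
  proof -
    have "{R \<in> Z. x \<in> region_crossings D R} = {R \<in> Z. x \<in> frontier R}"
      using x by (simp add: region_crossings_def P_def)
    then have "x \<in> b \<longleftrightarrow> odd (card {R \<in> Z. x \<in> region_crossings D R})"
      using x by (simp add: Z(3)[symmetric] flipped_def)
    then have rcc: "snd (rcc D Z) x = (if x \<in> b then other_strand P x (snd D x) else snd D x)"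
      using x by (simp add: rcc_def P_def)
    obtain t u where tu: "preimages P x = {t, u}" "t < u"
      using crossing_preimages[OF x] by metis
    have "snd D x \<in> preimages P x" using kd x by (simp add: knot_diagram_def P_def)
    then consider "snd D x = t" | "snd D x = u" using tu by auto
    then show ?thesis
    proof cases
      case 1
      then show ?thesis using tu rcc by (simp add: b_def)
    next
      case 2
      have "other_strand P x u = t"
        unfolding other_strand_def using tu by (intro the_equality) auto
      then show ?thesis using 2 tu rcc x by (simp add: b_def)
    qed
  qed
  then have "is_unknot_diagram (P, snd (rcc D Z))" by (rule descending_unknot)
  then have "is_unknot_diagram (rcc D Z)" by (simp add: rcc_def P_def)
  then have "unknotting_regions D Z"
    using Z(1,2) by (simp add: unknotting_regions_def regions_def P_def)
  then have "MRI_diagram D \<le> (\<Sum>R\<in>Z. c_region D R)"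
    unfolding MRI_diagram_def by (intro Least_le) blast
  also have "\<dots> \<le> 2 * card (crossings P)"
    using Z(4) by (simp add: c_region_def region_crossings_def P_def)
  finally have "MRI_diagram D \<le> 2 * crossing_number K" using D(2) by (simp add: P_def)
  moreover have "MRI K \<le> MRI_diagram D"
    unfolding MRI_def using D(1) by (intro Least_le) blast
  ultimately show ?thesis by linarith
qed

end
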